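(* For every infinite minimal subshift $(X,\varphi)$ over a finite alphabet, the group $\mathsf{T}(\varphi)$ is not finitely presented.
   Context: A group is finitely presented if it admits a presentation with finitely many generators and finitely many relations. A Stone system $(X,\varphi)$ is a non-empty totally disconnected compact Hausdorff space $X$ together with a self-homeomorphism $\varphi$ of $X$; it is minimal if every $\varphi$-orbit is dense, and infinite if $X$ is infinite. A subshift over a finite alphabet $A$ is a Stone system $(X,\varphi)$ where $X\subset A^{\mathbb Z}$ is a non-empty closed shift-invariant subset and $\varphi$ is the restriction of the shift. Suspension: $Y^\varphi=(X\times\mathbb R)/\mathbb Z$, the quotient by the $\mathbb Z$-action $n\cdot(x,t)=(\varphi^n(x),t-n)$; $[x,t]$ is the class of $(x,t)$, and the suspension flow is $\Phi^t([x,s])=[x,s+t]$. $\mathsf{H}_0(\varphi)$ is the group of homeomorphisms of $Y^\varphi$ that are isotopic to the identity; equivalently (Boyle–Carlsen–Eilers), the homeomorphisms $g$ of $Y^\varphi$ for which there is a continuous $\tau\colon Y^\varphi\to\mathbb R$ with $g(y)=\Phi^{\tau(y)}(y)$ for all $y$. Charts: for a clopen $C\subset X$ put $\tau_C=\min\{n\ge1:\exists x\in C,\ \varphi^n(x)\in C\}\in\mathbb N\cup\{\infty\}$. For an open interval $J\subset\mathbb R$ of length $|J|<\tau_C$, the map $\pi_{C,J}\colon C\times J\to Y^\varphi$, $(x,t)\mapsto[x,t]$, is injective; it is called a chart and its image is denoted $U_{C\times J}$ (a domain). A dyadic rational is a number $p/2^q$ with $p,q\in\mathbb Z$; an interval is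 dyadic if it is bounded with dyadic rational endpoints; a chart $\pi_{C,J}$ is dyadic if $J$ is. A piecewise linear (PL) homeomorphism between intervals is a homeomorphism that is piecewise affine with finitely many breakpoints; it is dyadic if both intervals are dyadic, the breakpoints are dyadic rationals, and each affine piece has the form $x\mapsto2^mx+b$ with $m\in\mathbb Z$, $b$ a dyadic rational. $\mathsf{T}(\varphi)$ is the group of all $g\in\mathsf{H}_0(\varphi)$ such that for every $y\in Y^\varphi$ there are a dyadic chart $\pi_{C,J}$ with $y\in U_{C\times J}$ and a dyadic PL homeomorphism $f\colon J\to f(J)\subset\mathbb R$ such that $g(U_{C\times J})=U_{C\times f(J)}$ and $\pi_{C,f(J)}^{-1}\circ g\circ\pi_{C,J}$ is the map $(x,t)\mapsto(x,f(t))$. *)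

theory Defs
  imports "HOL-Analysis.Analysis" "HOL-Algebra.Bij"
begin

section \<open>Finitely presented groups\<close>

text \<open>A letter \<open>(a, True)\<close> stands for the generator \<open>a\<close>, and \<open>(a, False)\<close> for its formal inverse.\<close>

definition words :: "'s set \<Rightarrow> ('s \<times> bool) list set" where
  "words S = lists (S \<times> UNIV)"

inductive_set presentation_rel ::
    "'s set \<Rightarrow> ('s \<times> bool) list set \<Rightarrow> (('s \<times> bool) list \<times> ('s \<times> bool) list) set"
  for S R where
  refl: "u \<in> words S \<Longrightarrow> (u, u) \<in> presentation_rel S R"
| sym: "(u, v) \<in> presentation_rel S R \<Longrightarrow> (v, u) \<in> presentation_rel S R"
| trans: "(u, v) \<in> presentation_rel S R \<Longrightarrow> (v, w) \<in> presentation_rel S R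
    \<Longrightarrow> (u, w) \<in> presentation_rel S R"
| cancel: "u \<in> words S \<Longrightarrow> v \<in> words S \<Longrightarrow> a \<in> S
    \<Longrightarrow> (u @ [(a, e), (a, \<not> e)] @ v, u @ v) \<in> presentation_rel S R"
| relator: "u \<in> words S \<Longrightarrow> v \<in> words S \<Longrightarrow> r \<in> R
    \<Longrightarrow> (u @ r @ v, u @ v) \<in> presentation_rel S R"

definition presented_group :: "'s set \<Rightarrow> ('s \<times> bool) list set \<Rightarrow> ('s \<times> bool) list set monoid" where
  "presented_group S R =
    \<lparr>carrier = words S // presentation_rel S R,
     mult = (\<lambda>A B. \<Union>u\<in>A. \<Union>v\<in>B. presentation_rel S R `` {u @ v}),
     one = presentation_rel S R `` {[]}\<rparr>"

text \<open>Generators are named by natural numbers, which is no restriction for finite generating sets.\<close>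

definition finitely_presented :: "('g, 'm) monoid_scheme \<Rightarrow> bool" where
  "finitely_presented G \<longleftrightarrow>
    (\<exists>(S :: nat set) R. finite S \<and> finite R \<and> R \<subseteq> words S \<and> G \<cong> presented_group S R)"

section \<open>Stone systems and subshifts\<close>

definition stone_system :: "'x topology \<Rightarrow> ('x \<Rightarrow> 'x) \<Rightarrow> bool" where
  "stone_system X \<phi> \<longleftrightarrow>
     topspace X \<noteq> {} \<and> compact_space X \<and> Hausdorff_space X \<and>
     (\<forall>S. connectedin X S \<longrightarrow> (\<exists>x. S \<subseteq> {x})) \<and>
     homeomorphic_map X X \<phi>"

text \<open>The integer power \<open>\<phi>\<^sup>n\<close>; the inverse is that of \<open>\<phi>\<close> as a self-map of the underlying set of \<open>X\<close>.\<close>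

definition zpow :: "'x topology \<Rightarrow> ('x \<Rightarrow> 'x) \<Rightarrow> int \<Rightarrow> 'x \<Rightarrow> 'x" where
  "zpow X \<phi> n = (if n \<ge> 0 then \<phi> ^^ nat n else inv_into (topspace X) \<phi> ^^ nat (- n))"

definition minimal_system :: "'x topology \<Rightarrow> ('x \<Rightarrow> 'x) \<Rightarrow> bool" where
  "minimal_system X \<phi> \<longleftrightarrow>
     (\<forall>x \<in> topspace X. X closure_of (range (\<lambda>n. zpow X \<phi> n x)) = topspace X)"

definition full_shift :: "'a set \<Rightarrow> (int \<Rightarrow> 'a) topology" where
  "full_shift A = product_topology (\<lambda>_. discrete_topology A) UNIV"

definition shift :: "(int \<Rightarrow> 'a) \<Rightarrow> (int \<Rightarrow> 'a)" where
  "shift x = (\<lambda>n. x (n + 1))"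

definition subshift :: "'a set \<Rightarrow> (int \<Rightarrow> 'a) set \<Rightarrow> bool" where
  "subshift A X \<longleftrightarrow> X \<noteq> {} \<and> closedin (full_shift A) X \<and> shift ` X = X"

definition subshift_top :: "'a set \<Rightarrow> (int \<Rightarrow> 'a) set \<Rightarrow> (int \<Rightarrow> 'a) topology" where
  "subshift_top A X = subtopology (full_shift A) X"

section \<open>The suspension\<close>

text \<open>The class \<open>[x,t]\<close> is the orbit of \<open>(x,t)\<close> under the action
  \<open>n \<cdot> (x,t) = (\<phi>\<^sup>n(x), t - n)\<close>.\<close>

definition susp_class :: "'x topology \<Rightarrow> ('x \<Rightarrow> 'x) \<Rightarrow> 'x \<times> real \<Rightarrow> ('x \<times> real) set" where
  "susp_class X \<phi> = (\<lambda>(x, t). range (\<lambda>n::int. (zpow X \<phi> n x, t - of_int n)))"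

definition suspension :: "'x topology \<Rightarrow> ('x \<Rightarrow> 'x) \<Rightarrow> ('x \<times> real) set topology" where
  "suspension X \<phi> = topology (\<lambda>V. V \<subseteq> susp_class X \<phi> ` (topspace X \<times> UNIV) \<and>
     openin (prod_topology X euclideanreal)
       {p \<in> topspace X \<times> UNIV. susp_class X \<phi> p \<in> V})"

definition isotopic_to_id :: "'y topology \<Rightarrow> ('y \<Rightarrow> 'y) \<Rightarrow> bool" where
  "isotopic_to_id Y g \<longleftrightarrow>
     (\<exists>H. continuous_map (prod_topology (top_of_set {0..1::real}) Y) Y H \<and>
          (\<forall>s \<in> {0..1}. homeomorphic_map Y Y (\<lambda>y. H (s, y))) \<and>
          (\<forall>y \<in> topspace Y. H (0, y) = y) \<and>
          (\<forall>y \<in> topspace Y. H (1, y) = g y))"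

text \<open>As in \<open>BijGroup\<close>, maps are normalised to be \<open>undefined\<close> outside the space.\<close>

definition H0 :: "'x topology \<Rightarrow> ('x \<Rightarrow> 'x) \<Rightarrow> (('x \<times> real) set \<Rightarrow> ('x \<times> real) set) set" where
  "H0 X \<phi> = {g \<in> extensional (topspace (suspension X \<phi>)).
     homeomorphic_map (suspension X \<phi>) (suspension X \<phi>) g \<and> isotopic_to_id (suspension X \<phi>) g}"

section \<open>Dyadic charts and dyadic piecewise linear maps\<close>

definition return_time :: "('x \<Rightarrow> 'x) \<Rightarrow> 'x set \<Rightarrow> enat" where
  "return_time \<phi> C = Inf {enat n |n. n \<ge> 1 \<and> (\<exists>x\<in>C. (\<phi> ^^ n) x \<in> C)}"

definition chart :: "'x topology \<Rightarrow> ('x \<Rightarrow> 'x) \<Rightarrow> 'x set \<Rightarrow> real set \<Rightarrow> bool" where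
  "chart X \<phi> C J \<longleftrightarrow> openin X C \<and> closedin X C \<and>
     (\<exists>a b. a < b \<and> J = {a<..<b} \<and> ereal (b - a) < ereal_of_enat (return_time \<phi> C))"

definition domain_of :: "'x topology \<Rightarrow> ('x \<Rightarrow> 'x) \<Rightarrow> 'x set \<Rightarrow> real set \<Rightarrow> ('x \<times> real) set set" where
  "domain_of X \<phi> C J = susp_class X \<phi> ` (C \<times> J)"

definition dyadic :: "real set" where
  "dyadic = {x. \<exists>p q :: int. x = of_int p / 2 powi q}"

definition dyadic_open_interval :: "real set \<Rightarrow> bool" where
  "dyadic_open_interval J \<longleftrightarrow> (\<exists>a\<in>dyadic. \<exists>b\<in>dyadic. a < b \<and> J = {a<..<b})"

definition dyadic_chart :: "'x topology \<Rightarrow> ('x \<Rightarrow> 'x) \<Rightarrow> 'x set \<Rightarrow> real set \<Rightarrow> bool" where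
  "dyadic_chart X \<phi> C J \<longleftrightarrow> chart X \<phi> C J \<and> dyadic_open_interval J"

text \<open>Here \<open>P\<close> is a finite set containing the breakpoints.\<close>

definition dyadic_PL_homeo :: "(real \<Rightarrow> real) \<Rightarrow> real set \<Rightarrow> real set \<Rightarrow> bool" where
  "dyadic_PL_homeo f J K \<longleftrightarrow>
     dyadic_open_interval J \<and> dyadic_open_interval K \<and> (\<exists>g. homeomorphism J K f g) \<and>
     (\<exists>P. finite P \<and> P \<subseteq> dyadic \<and>
        (\<forall>I. is_interval I \<and> I \<subseteq> J - P \<longrightarrow>
           (\<exists>m :: int. \<exists>b\<in>dyadic. \<forall>t\<in>I. f t = 2 powi m * t + b)))"

section \<open>The group \<open>T(\<phi>)\<close>\<close>

definition T_carrier :: "'x topology \<Rightarrow> ('x \<Rightarrow> 'x) \<Rightarrow> (('x \<times> real) set \<Rightarrow> ('x \<times> real) set) set" where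
  "T_carrier X \<phi> = {g \<in> H0 X \<phi>. \<forall>y \<in> topspace (suspension X \<phi>). \<exists>C J f.
      dyadic_chart X \<phi> C J \<and> y \<in> domain_of X \<phi> C J \<and>
      dyadic_PL_homeo f J (f ` J) \<and> dyadic_chart X \<phi> C (f ` J) \<and>
      g ` domain_of X \<phi> C J = domain_of X \<phi> C (f ` J) \<and>
      (\<forall>x\<in>C. \<forall>t\<in>J.
         inv_into (C \<times> f ` J) (susp_class X \<phi>) (g (susp_class X \<phi> (x, t))) = (x, f t))}"

definition T_group :: "'x topology \<Rightarrow> ('x \<Rightarrow> 'x) \<Rightarrow> (('x \<times> real) set \<Rightarrow> ('x \<times> real) set) monoid" where
  "T_group X \<phi> = (BijGroup (topspace (suspension X \<phi>)))\<lparr>carrier := T_carrier X \<phi>\<rparr>"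

section \<open>Well-definedness\<close>

subsection \<open>The presented group is a group\<close>

lemma presentation_rel_words:
  assumes "R \<subseteq> words S" "(u, v) \<in> presentation_rel S R"
  shows "u \<in> words S" "v \<in> words S"
  using assms(2)
proof (induction)
  case (relator u v r)
  { case 1 show ?case using relator assms(1) by (auto simp: words_def) }
  { case 2 show ?case using relator assms(1) by (auto simp: words_def) }
qed (auto simp: words_def)

lemma equiv_presentation_rel:
  assumes "R \<subseteq> words S"
  shows "equiv (words S) (presentation_rel S R)"
proof (rule equivI)
  show "presentation_rel S R \<subseteq> words S \<times> words S"
    using presentation_rel_words[OF assms] by auto
  show "refl_on (words S) (presentation_rel S R)"
    by (rule refl_onI) (auto intro: presentation_rel.refl)
  show "sym_on UNIV (presentation_rel S R)" by (auto intro!: symI presentation_rel.sym)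
  show "trans_on UNIV (presentation_rel S R)" by (auto intro!: transI intro: presentation_rel.trans)
qed

lemma words_append [simp]: "u @ v \<in> words S \<longleftrightarrow> u \<in> words S \<and> v \<in> words S"
  by (auto simp: words_def)

lemma presentation_rel_append_right:
  assumes "(u, v) \<in> presentation_rel S R" "w \<in> words S"
  shows "(u @ w, v @ w) \<in> presentation_rel S R"
  using assms(1)
proof induction
  case (cancel u v a e)
  then show ?case using presentation_rel.cancel[of u S "v @ w" a e R] assms(2) by simp
next
  case (relator u v r)
  then show ?case using presentation_rel.relator[of u S "v @ w" r R] assms(2) by simp
qed (use assms(2) in \<open>auto intro: presentation_rel.intros\<close>)

lemma presentation_rel_append_left:
  assumes "(u, v) \<in> presentation_rel S R" "w \<in> words S"
  shows "(w @ u, w @ v) \<in> presentation_rel S R"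
  using assms(1)
proof induction
  case (cancel u v a e)
  then show ?case using presentation_rel.cancel[of "w @ u" S v a e R] assms(2) by simp
next
  case (relator u v r)
  then show ?case using presentation_rel.relator[of "w @ u" S v r R] assms(2) by simp
qed (use assms(2) in \<open>auto intro: presentation_rel.intros\<close>)

lemma presented_group_mult:
  assumes "R \<subseteq> words S" "u \<in> words S" "v \<in> words S"
  shows "mult (presented_group S R) (presentation_rel S R `` {u}) (presentation_rel S R `` {v})
    = presentation_rel S R `` {u @ v}"
proof -
  note E = equiv_presentation_rel[OF assms(1)]
  have *: "presentation_rel S R `` {u' @ v'} = presentation_rel S R `` {u @ v}"
    if "(u, u') \<in> presentation_rel S R" "(v, v') \<in> presentation_rel S R" for u' v'
  proof (rule equiv_class_eq[OF E, symmetric])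
    have "u' \<in> words S" using presentation_rel_words[OF assms(1) that(1)] by simp
    then show "(u @ v, u' @ v') \<in> presentation_rel S R"
      using presentation_rel_append_right[OF that(1) assms(3)]
        presentation_rel_append_left[OF that(2), of u'] presentation_rel.trans by metis
  qed
  have ne: "presentation_rel S R `` {u} \<noteq> {}" "presentation_rel S R `` {v} \<noteq> {}"
    using assms(2,3) presentation_rel.refl by fast+
  have "mult (presented_group S R) (presentation_rel S R `` {u}) (presentation_rel S R `` {v})
    = (\<Union>u'\<in>presentation_rel S R `` {u}. \<Union>v'\<in>presentation_rel S R `` {v}.
        presentation_rel S R `` {u' @ v'})"
    by (simp add: presented_group_def)
  also have "\<dots> = (\<Union>u'\<in>presentation_rel S R `` {u}. \<Union>v'\<in>presentation_rel S R `` {v}.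
        presentation_rel S R `` {u @ v})"
    by (intro SUP_cong HOL.refl *) simp_all
  also have "\<dots> = presentation_rel S R `` {u @ v}"
    by (simp only: UN_constant ne if_False)
  finally show ?thesis .
qed

definition word_inv :: "('s \<times> bool) list \<Rightarrow> ('s \<times> bool) list" where
  "word_inv w = rev (map (\<lambda>(a, e). (a, \<not> e)) w)"

lemma word_inv_rel: "w \<in> words S \<Longrightarrow> (word_inv w @ w, []) \<in> presentation_rel S R"
proof (induction w)
  case Nil
  then show ?case by (auto simp: word_inv_def words_def intro: presentation_rel.refl)
next
  case (Cons x w)
  obtain a e where x: "x = (a, e)" by force
  have w: "w \<in> words S" "a \<in> S" using Cons.prems x by (auto simp: words_def)
  have "word_inv w \<in> words S" using w by (auto simp: words_def word_inv_def)
  then have "(word_inv w @ [(a, \<not> e), (a, \<not> \<not> e)] @ w, word_inv w @ w) \<in> presentation_rel S R"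
    using w by (intro presentation_rel.cancel)
  then show ?case using Cons.IH[OF w(1)] presentation_rel.trans
    by (fastforce simp: word_inv_def x)
qed

lemma group_presented_group:
  assumes "R \<subseteq> words S"
  shows "group (presented_group S R)"
proof (rule groupI)
  let ?c = "\<lambda>u. presentation_rel S R `` {u}"
  have car: "\<exists>u\<in>words S. x = ?c u" if "x \<in> carrier (presented_group S R)" for x
    using that by (auto simp: presented_group_def quotient_def)
  have inc: "?c u \<in> carrier (presented_group S R)" if "u \<in> words S" for u
    using that by (auto simp: presented_group_def quotient_def)
  note m = presented_group_mult[OF assms]
  have nil: "[] \<in> words S" by (simp add: words_def)
  have one: "one (presented_group S R) = ?c []" by (simp add: presented_group_def)
  show "\<one>\<^bsub>presented_group S R\<^esub> \<in> carrier (presented_group S R)" using inc[OF nil] one by simp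
  fix x assume "x \<in> carrier (presented_group S R)"
  then obtain u where u: "u \<in> words S" "x = ?c u" using car by blast
  show "\<one>\<^bsub>presented_group S R\<^esub> \<otimes>\<^bsub>presented_group S R\<^esub> x = x"
    using m[OF nil u(1)] u one by simp
  have wi: "word_inv u \<in> words S" using u(1) by (auto simp: words_def word_inv_def)
  have "?c (word_inv u) \<otimes>\<^bsub>presented_group S R\<^esub> x = ?c []"
    unfolding u(2) m[OF wi u(1)]
    by (rule equiv_class_eq[OF equiv_presentation_rel[OF assms] word_inv_rel[OF u(1)]])
  then show "\<exists>y\<in>carrier (presented_group S R). y \<otimes>\<^bsub>presented_group S R\<^esub> x = \<one>\<^bsub>presented_group S R\<^esub>"
    using inc[OF wi] one by auto
  fix y assume "y \<in> carrier (presented_group S R)"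
  then obtain v where v: "v \<in> words S" "y = ?c v" using car by blast
  have uv: "u @ v \<in> words S" using u v by simp
  show "x \<otimes>\<^bsub>presented_group S R\<^esub> y \<in> carrier (presented_group S R)"
    unfolding u(2) v(2) m[OF u(1) v(1)] by (rule inc[OF uv])
  fix z assume "z \<in> carrier (presented_group S R)"
  then obtain w where w: "w \<in> words S" "z = ?c w" using car by blast
  have vw: "v @ w \<in> words S" using w v by simp
  show "x \<otimes>\<^bsub>presented_group S R\<^esub> y \<otimes>\<^bsub>presented_group S R\<^esub> z
      = x \<otimes>\<^bsub>presented_group S R\<^esub> (y \<otimes>\<^bsub>presented_group S R\<^esub> z)"
    unfolding u(2) v(2) w(2) m[OF u(1) v(1)] m[OF v(1) w(1)] m[OF uv w(1)] m[OF u(1) vw]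
    by simp
qed

subsection \<open>Subshifts are Stone systems\<close>

lemma topspace_full_shift: "topspace (full_shift A) = UNIV \<rightarrow> A"
  by (simp add: full_shift_def PiE_UNIV_domain)

lemma topspace_subshift_top: "subshift A X \<Longrightarrow> topspace (subshift_top A X) = X"
  by (auto simp: subshift_def subshift_top_def closedin_def)

lemma subshift_stone_system:
  assumes "finite A" "subshift A X"
  shows "stone_system (subshift_top A X) shift"
proof -
  let ?F = "full_shift A" and ?X = "subshift_top A X"
  note tX = topspace_subshift_top[OF assms(2)]
  have cl: "closedin ?F X" and im: "shift ` X = X" and ne: "X \<noteq> {}"
    using assms(2) by (auto simp: subshift_def)
  have "compact_space ?F" unfolding full_shift_def
    using assms(1) by (intro compact_space_product_topology[THEN iffD2])
      (auto simp: compact_space_discrete_topology)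
  then have comp: "compact_space ?X" unfolding subshift_top_def
    using cl closedin_compact_space compact_space_subtopology by blast
  have "Hausdorff_space ?F" unfolding full_shift_def
    by (auto simp: Hausdorff_space_product_topology)
  then have haus: "Hausdorff_space ?X" unfolding subshift_top_def
    by (rule Hausdorff_space_subtopology)
  have proj: "continuous_map ?F (discrete_topology A) (\<lambda>x. x n)" for n
    unfolding full_shift_def by (rule continuous_map_product_projection) simp
  have disc: "\<exists>x. S \<subseteq> {x}" if "connectedin ?X S" for S
  proof -
    have S: "connectedin ?F S" using that by (simp add: subshift_top_def connectedin_subtopology)
    have "x = y" if "x \<in> S" "y \<in> S" for x y
    proof
      fix n
      have "connectedin (discrete_topology A) ((\<lambda>x. x n) ` S)"
        using connectedin_continuous_map_image[OF proj S] .
      then obtain a where "(\<lambda>x. x n) ` S \<subseteq> {a}"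
        using connectedin_discrete_topology by (metis empty_subsetI subset_refl)
      then show "x n = y n" using that by auto
    qed
    then have "S \<subseteq> {SOME x. x \<in> S}" by (metis singletonI someI subsetI)
    then show ?thesis by blast
  qed
  have "continuous_map ?F ?F shift"
    unfolding full_shift_def shift_def
    by (auto simp: continuous_map_componentwise_UNIV intro!: continuous_map_product_projection)
  then have cont: "continuous_map ?X ?X shift"
    unfolding subshift_top_def using im
    by (auto simp: continuous_map_in_subtopology continuous_map_from_subtopology)
  have inj: "inj_on shift X"
  proof (rule inj_onI)
    fix x y :: "int \<Rightarrow> 'a" assume "shift x = shift y"
    then have "x (n - 1 + 1) = y (n - 1 + 1)" for n unfolding shift_def by meson
    then show "x = y" by auto
  qed
  have "homeomorphic_map ?X ?X shift"
    using comp haus cont inj im tX by (intro continuous_imp_homeomorphic_map) auto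
  then show ?thesis using comp haus disc ne tX by (auto simp: stone_system_def)
qed

subsection \<open>The suspension carries the quotient topology, and charts are injective\<close>

lemma istopology_suspension:
  "istopology (\<lambda>V. V \<subseteq> susp_class X \<phi> ` (topspace X \<times> UNIV) \<and>
     openin (prod_topology X euclideanreal)
       {p \<in> topspace X \<times> UNIV. susp_class X \<phi> p \<in> V})"
proof -
  let ?P = "\<lambda>V. {p \<in> topspace X \<times> UNIV. susp_class X \<phi> p \<in> V}"
  have "?P (V \<inter> W) = ?P V \<inter> ?P W" for V W by auto
  moreover have "?P (\<Union>\<K>) = (\<Union>V\<in>\<K>. ?P V)" for \<K> by auto
  ultimately show ?thesis unfolding istopology_def
    by auto
qed

lemma openin_suspension:
  "openin (suspension X \<phi>) V \<longleftrightarrow> V \<subseteq> susp_class X \<phi> ` (topspace X \<times> UNIV) \<and>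
     openin (prod_topology X euclideanreal) {p \<in> topspace X \<times> UNIV. susp_class X \<phi> p \<in> V}"
  unfolding suspension_def by (simp only: topology_inverse'[OF istopology_suspension])

lemma topspace_suspension:
  "topspace (suspension X \<phi>) = susp_class X \<phi> ` (topspace X \<times> UNIV)" (is "_ = ?V")
proof
  have "{p \<in> topspace X \<times> UNIV. susp_class X \<phi> p \<in> ?V}
      = topspace (prod_topology X euclideanreal)" by auto
  then have "openin (suspension X \<phi>) ?V"
    unfolding openin_suspension by (simp only: openin_topspace) simp
  then show "?V \<subseteq> topspace (suspension X \<phi>)" by (rule openin_subset)
  show "topspace (suspension X \<phi>) \<subseteq> ?V"
    using openin_topspace openin_suspension by blast
qed

lemma quotient_map_suspension:
  "quotient_map (prod_topology X euclideanreal) (suspension X \<phi>) (susp_class X \<phi>)"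
  unfolding quotient_map_def by (simp add: topspace_suspension openin_suspension)

context
  fixes X :: "'x topology" and \<phi> :: "'x \<Rightarrow> 'x"
  assumes stone: "stone_system X \<phi>"
begin

lemma hom_phi: "homeomorphic_map X X \<phi>"
  using stone by (simp add: stone_system_def)

lemma bij_phi: "bij_betw \<phi> (topspace X) (topspace X)"
  using hom_phi by (simp add: bij_betw_def homeomorphic_eq_everything_map)

lemma zpow_0 [simp]: "zpow X \<phi> 0 x = x"
  by (simp add: zpow_def)

lemma zpow_of_nat: "zpow X \<phi> (int n) = \<phi> ^^ n"
  by (simp add: zpow_def)

lemma zpow_neg: "zpow X \<phi> (- int n) = inv_into (topspace X) \<phi> ^^ n"
  by (cases "n = 0") (auto simp: zpow_def)

lemma continuous_zpow: "continuous_map X X (zpow X \<phi> n)"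
proof -
  have c: "continuous_map X X (f ^^ k)" if "continuous_map X X f" for f k
    using that by (induction k) (auto intro: continuous_map_compose)
  obtain g where g: "homeomorphic_maps X X \<phi> g"
    using hom_phi homeomorphic_map_maps by blast
  have "g x = inv_into (topspace X) \<phi> x" if "x \<in> topspace X" for x
    using g that bij_phi unfolding homeomorphic_maps_def bij_betw_def
    by (metis continuous_map_image_subset_topspace image_subset_iff inv_into_f_f)
  then have "continuous_map X X (inv_into (topspace X) \<phi>)"
    using g continuous_map_eq unfolding homeomorphic_maps_def by blast
  then show ?thesis unfolding zpow_def
    using c[OF homeomorphic_imp_continuous_map[OF hom_phi]] c by simp
qed

lemma zpow_in: "x \<in> topspace X \<Longrightarrow> zpow X \<phi> n x \<in> topspace X"
  using continuous_zpow continuous_map_funspace by fastforce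

lemma zpow_Suc:
  assumes "x \<in> topspace X"
  shows "zpow X \<phi> (n + 1) x = \<phi> (zpow X \<phi> n x)"
proof (cases "n \<ge> 0")
  case True
  then show ?thesis by (simp add: zpow_def nat_add_distrib)
next
  case False
  then obtain k where k: "n = - int (Suc k)"
    by (metis not_le zero_less_Suc of_nat_0_less_iff add.inverse_inverse neg_less_0_iff_less
        gr0_implies_Suc zero_less_imp_eq_int)
  have "n + 1 = - int k" using k by simp
  then have eq: "zpow X \<phi> (n + 1) x = (inv_into (topspace X) \<phi> ^^ k) x"
    by (simp only: zpow_neg)
  have "zpow X \<phi> (n + 1) x \<in> topspace X" by (rule zpow_in[OF assms])
  moreover have "zpow X \<phi> n x = inv_into (topspace X) \<phi> (zpow X \<phi> (n + 1) x)"
    unfolding eq unfolding k zpow_neg by simp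
  ultimately show ?thesis using bij_phi by (metis bij_betw_def f_inv_into_f)
qed

lemma zpow_add:
  assumes "x \<in> topspace X"
  shows "zpow X \<phi> m (zpow X \<phi> n x) = zpow X \<phi> (m + n) x"
proof (induction m rule: int_induct[where k = 0])
  case base
  show ?case by simp
next
  case (step1 i)
  then show ?case
    using zpow_Suc[OF assms, of "i + n"] zpow_Suc[OF zpow_in[OF assms], of i n]
    by (simp add: algebra_simps)
next
  case (step2 i)
  then have "\<phi> (zpow X \<phi> (i - 1) (zpow X \<phi> n x)) = \<phi> (zpow X \<phi> (i - 1 + n) x)"
    using zpow_Suc[OF assms, of "i - 1 + n"] zpow_Suc[OF zpow_in[OF assms], of "i - 1" n]
    by (simp add: algebra_simps)
  then show ?case
    using bij_phi zpow_in assms by (meson bij_betw_def inj_onD)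
qed

lemma susp_class_eq_iff:
  assumes "x \<in> topspace X" "y \<in> topspace X"
  shows "susp_class X \<phi> (x, t) = susp_class X \<phi> (y, s) \<longleftrightarrow>
    (\<exists>n::int. y = zpow X \<phi> n x \<and> s = t - of_int n)"
proof
  assume eq: "susp_class X \<phi> (x, t) = susp_class X \<phi> (y, s)"
  have "(y, s) \<in> susp_class X \<phi> (y, s)" unfolding susp_class_def
    by (auto intro!: image_eqI[where x = 0])
  then show "\<exists>n::int. y = zpow X \<phi> n x \<and> s = t - of_int n"
    unfolding eq[symmetric] by (auto simp: susp_class_def)
next
  assume "\<exists>n::int. y = zpow X \<phi> n x \<and> s = t - of_int n"
  then obtain n :: int where n: "y = zpow X \<phi> n x" "s = t - of_int n" by blast
  show "susp_class X \<phi> (x, t) = susp_class X \<phi> (y, s)"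
  proof (intro equalityI subsetI)
    fix p assume "p \<in> susp_class X \<phi> (x, t)"
    then obtain m :: int where "p = (zpow X \<phi> m x, t - of_int m)" by (auto simp: susp_class_def)
    then have "p = (zpow X \<phi> (m - n) y, s - of_int (m - n))" by (simp add: n zpow_add assms)
    then show "p \<in> susp_class X \<phi> (y, s)" by (auto simp: susp_class_def)
  next
    fix p assume "p \<in> susp_class X \<phi> (y, s)"
    then obtain m :: int where "p = (zpow X \<phi> m y, s - of_int m)" by (auto simp: susp_class_def)
    then have "p = (zpow X \<phi> (m + n) x, t - of_int (m + n))" by (simp add: n zpow_add assms)
    then show "p \<in> susp_class X \<phi> (x, t)" by (auto simp: susp_class_def)
  qed
qed

lemma chart_subset: "chart X \<phi> C J \<Longrightarrow> C \<subseteq> topspace X"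
  by (simp add: chart_def openin_subset)

lemma inj_on_chart:
  assumes "chart X \<phi> C J"
  shows "inj_on (susp_class X \<phi>) (C \<times> J)"
proof -
  obtain a b where J: "J = {a<..<b}" and len: "ereal (b - a) < ereal_of_enat (return_time \<phi> C)"
    using assms by (auto simp: chart_def)
  have no: False if "x \<in> C" "zpow X \<phi> n x \<in> C" "t \<in> J" "t - of_int n \<in> J" "n > 0" for x t n
  proof -
    have "return_time \<phi> C \<le> enat (nat n)"
      unfolding return_time_def using that zpow_of_nat[of "nat n"]
      by (intro Inf_lower) (auto intro!: bexI[of _ x])
    then have "ereal (b - a) < ereal (real (nat n))"
      using len by (metis ereal_of_enat_le_iff ereal_of_enat_simps(1) order_less_le_trans)
    then show False using that J by auto
  qed
  show ?thesis
  proof (rule inj_onI, clarify)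
    fix x t y s assume *: "x \<in> C" "t \<in> J" "y \<in> C" "s \<in> J"
      and "susp_class X \<phi> (x, t) = susp_class X \<phi> (y, s)"
    then obtain n :: int where n: "y = zpow X \<phi> n x" "s = t - of_int n"
      using susp_class_eq_iff chart_subset[OF assms] by (metis subsetD)
    have x: "x = zpow X \<phi> (- n) y" using n * chart_subset[OF assms] by (auto simp: zpow_add)
    have "\<not> n > 0" using no[of x n t] *(1,2) *(3)[unfolded n(1)] *(4)[unfolded n(2)] by blast
    moreover have "\<not> - n > 0"
    proof
      assume "- n > 0"
      moreover have "zpow X \<phi> (- n) y \<in> C" using *(1) by (simp only: x[symmetric])
      moreover have "s - of_int (- n) \<in> J" using *(2) n(2) by simp
      ultimately show False using no *(3,4) by blast
    qed
    ultimately have "n = 0" by simp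
    then show "x = y \<and> t = s" using n by simp
  qed
qed

lemma T_local_iff:
  assumes "chart X \<phi> C J" "chart X \<phi> C (f ` J)"
  shows "(g ` domain_of X \<phi> C J = domain_of X \<phi> C (f ` J) \<and>
      (\<forall>x\<in>C. \<forall>t\<in>J.
         inv_into (C \<times> f ` J) (susp_class X \<phi>) (g (susp_class X \<phi> (x, t))) = (x, f t)))
    \<longleftrightarrow> (\<forall>x\<in>C. \<forall>t\<in>J. g (susp_class X \<phi> (x, t)) = susp_class X \<phi> (x, f t))"
    (is "?L \<longleftrightarrow> ?R")
proof
  assume L: ?L
  show ?R
  proof (intro ballI)
    fix x t assume xt: "x \<in> C" "t \<in> J"
    then have "g (susp_class X \<phi> (x, t)) \<in> susp_class X \<phi> ` (C \<times> f ` J)"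
      using L by (auto simp: domain_of_def)
    then have "susp_class X \<phi> (inv_into (C \<times> f ` J) (susp_class X \<phi>) (g (susp_class X \<phi> (x, t))))
      = g (susp_class X \<phi> (x, t))" by (rule f_inv_into_f)
    then show "g (susp_class X \<phi> (x, t)) = susp_class X \<phi> (x, f t)" using L xt by simp
  qed
next
  assume R: ?R
  show ?L
  proof (intro conjI ballI)
    show "g ` domain_of X \<phi> C J = domain_of X \<phi> C (f ` J)"
    proof -
      have "g ` domain_of X \<phi> C J = (\<lambda>(x, t). susp_class X \<phi> (x, f t)) ` (C \<times> J)"
        unfolding domain_of_def image_image by (rule image_cong) (use R in auto)
      also have "\<dots> = domain_of X \<phi> C (f ` J)" unfolding domain_of_def image_image
        by (auto simp: image_iff Bex_def)
      finally show ?thesis .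
    qed
    fix x t assume "x \<in> C" "t \<in> J"
    then show "inv_into (C \<times> f ` J) (susp_class X \<phi>) (g (susp_class X \<phi> (x, t))) = (x, f t)"
      using R inv_into_f_f[OF inj_on_chart[OF assms(2)], of "(x, f t)"] by simp
  qed
qed

end


subsection \<open>Dyadic piecewise linear homeomorphisms\<close>

lemma dyadic_iff: "x \<in> dyadic \<longleftrightarrow> (\<exists>(p::int) (k::nat). x = of_int p / 2 ^ k)"
proof
  assume "x \<in> dyadic"
  then obtain p q :: int where x: "x = of_int p / 2 powi q" by (auto simp: dyadic_def)
  show "\<exists>(p::int) (k::nat). x = of_int p / 2 ^ k"
  proof (cases "q \<ge> 0")
    case True
    then show ?thesis using x by (auto simp: power_int_def)
  next
    case False
    then have "x = of_int (p * 2 ^ nat (- q)) / 2 ^ 0"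
      using x by (simp add: power_int_def field_simps)
    then show ?thesis by blast
  qed
next
  assume "\<exists>(p::int) (k::nat). x = of_int p / 2 ^ k"
  then obtain p :: int and k :: nat where "x = of_int p / 2 ^ k" by blast
  then have "x = of_int p / 2 powi (int k)" by simp
  then show "x \<in> dyadic" unfolding dyadic_def by blast
qed

lemma dyadic_add: "x \<in> dyadic \<Longrightarrow> y \<in> dyadic \<Longrightarrow> x + y \<in> dyadic"
proof -
  assume "x \<in> dyadic" "y \<in> dyadic"
  then obtain p q :: int and k l :: nat where "x = of_int p / 2 ^ k" "y = of_int q / 2 ^ l"
    unfolding dyadic_iff by blast
  then have "x + y = of_int (p * 2 ^ l + q * 2 ^ k) / 2 ^ (k + l)"
    by (simp add: power_add add_frac_eq)
  then show ?thesis unfolding dyadic_iff by blast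
qed

lemma dyadic_mult: "x \<in> dyadic \<Longrightarrow> y \<in> dyadic \<Longrightarrow> x * y \<in> dyadic"
proof -
  assume "x \<in> dyadic" "y \<in> dyadic"
  then obtain p q :: int and k l :: nat where "x = of_int p / 2 ^ k" "y = of_int q / 2 ^ l"
    unfolding dyadic_iff by blast
  then have "x * y = of_int (p * q) / 2 ^ (k + l)"
    by (simp add: power_add)
  then show ?thesis unfolding dyadic_iff by blast
qed

lemma dyadic_of_int [simp]: "of_int n \<in> dyadic"
  unfolding dyadic_iff by (rule exI[of _ n], rule exI[of _ 0]) simp

lemma dyadic_powi [simp]: "2 powi n \<in> dyadic"
  unfolding dyadic_def mem_Collect_eq
  by (rule exI[of _ 1], rule exI[of _ "- n"]) (simp add: power_int_minus divide_simps)

lemma dyadic_minus: "x \<in> dyadic \<Longrightarrow> - x \<in> dyadic"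
  using dyadic_mult[of "of_int (-1)" x] dyadic_of_int[of "-1"] by simp

lemma dyadic_dense:
  fixes x y :: real
  assumes "x < y"
  shows "\<exists>d\<in>dyadic. x < d \<and> d < y"
proof -
  obtain k :: nat where k: "(1/2) ^ k < y - x"
    using real_arch_pow_inv[of "y - x" "1/2"] assms by auto
  define p where "p = \<lfloor>x * 2 ^ k\<rfloor> + 1"
  have "x * 2 ^ k < of_int p" "of_int p \<le> x * 2 ^ k + 1" unfolding p_def by linarith+
  moreover have "x * 2 ^ k + 1 < y * 2 ^ k" using k by (simp add: field_simps)
  ultimately have "x < of_int p / 2 ^ k" "of_int p / 2 ^ k < y" by (auto simp: field_simps)
  moreover have "of_int p / 2 ^ k \<in> dyadic" unfolding dyadic_iff by (intro exI, rule HOL.refl)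
  ultimately show ?thesis by blast
qed

definition dyadic_PL_on :: "(real \<Rightarrow> real) \<Rightarrow> real set \<Rightarrow> real set \<Rightarrow> bool" where
  "dyadic_PL_on f J P \<longleftrightarrow> (\<forall>I. is_interval I \<and> I \<subseteq> J - P \<longrightarrow>
           (\<exists>m :: int. \<exists>b\<in>dyadic. \<forall>t\<in>I. f t = 2 powi m * t + b))"

lemma dyadic_PL_homeo_alt: "dyadic_PL_homeo f J K \<longleftrightarrow>
     dyadic_open_interval J \<and> dyadic_open_interval K \<and> (\<exists>g. homeomorphism J K f g) \<and>
     (\<exists>P. finite P \<and> P \<subseteq> dyadic \<and> dyadic_PL_on f J P)"
  unfolding dyadic_PL_homeo_def dyadic_PL_on_def ..

lemma free_right:
  fixes p :: real assumes "finite P" "p < c"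
  shows "\<exists>q. p < q \<and> q < c \<and> {p<..<q} \<inter> P = {}"
proof -
  let ?Q = "insert c {x \<in> P. x > p}"
  have fin: "finite ?Q" using assms by auto
  define m where "m = Min ?Q"
  have m: "p < m" "m \<le> c" unfolding m_def using fin assms by auto
  have "x \<ge> m" if "x \<in> P" "x > p" for x unfolding m_def using fin that by auto
  then have "{p<..<(p + m) / 2} \<inter> P = {}" using m by fastforce
  then show ?thesis using m by (intro exI[of _ "(p + m) / 2"]) auto
qed

lemma dyadic_PL_value:
  assumes "dyadic_PL_homeo f J K" "p \<in> J"
  shows "\<exists>q>p. {p..<q} \<subseteq> J \<and> (\<exists>m::int. \<exists>b\<in>dyadic. \<forall>t\<in>{p..<q}. f t = 2 powi m * t + b)"
proof -
  obtain a b where J: "J = {a<..<b}" using assms by (auto simp: dyadic_PL_homeo_def dyadic_open_interval_def)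
  obtain P where P: "finite P" "dyadic_PL_on f J P" using assms by (auto simp: dyadic_PL_homeo_alt)
  have cont: "continuous_on J f"
    using assms(1) by (auto simp: dyadic_PL_homeo_def homeomorphism_def)
  obtain q where q: "p < q" "q < b" "{p<..<q} \<inter> P = {}"
    using free_right[OF P(1), of p b] assms(2) J by auto
  have "{p<..<q} \<subseteq> J - P" using q assms(2) J by auto
  then obtain m :: int and c where c: "c \<in> dyadic" "\<forall>t\<in>{p<..<q}. f t = 2 powi m * t + c"
    using P(2) is_interval_oo[of p q] unfolding dyadic_PL_on_def by blast
  have "{p<..<q} \<subseteq> J" using \<open>{p<..<q} \<subseteq> J - P\<close> by blast
  have "(f \<longlongrightarrow> f p) (at p within J)"
    using cont assms(2) unfolding continuous_on_def by blast
  then have lim: "(f \<longlongrightarrow> f p) (at p within {p<..<q})"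
    using \<open>{p<..<q} \<subseteq> J\<close> by (rule tendsto_within_subset)
  have "((\<lambda>t. 2 powi m * t + c) \<longlongrightarrow> 2 powi m * p + c) (at p within {p<..<q})"
    by (intro tendsto_intros)
  then have lim2: "(f \<longlongrightarrow> 2 powi m * p + c) (at p within {p<..<q})"
    by (rule Lim_transform_within[OF _ zero_less_one]) (use c in auto)
  have "at p within {p<..<q} \<noteq> bot"
    using islimpt_greaterThanLessThan1[OF q(1)] by (simp add: trivial_limit_within)
  then have "f p = 2 powi m * p + c" using tendsto_unique lim lim2 by blast
  then have "\<forall>t\<in>{p..<q}. f t = 2 powi m * t + c"
    using c by (auto simp: less_eq_real_def)
  moreover have "{p..<q} \<subseteq> J" using q assms(2) J by auto
  ultimately show ?thesis using q(1) c(1) by blast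
qed

lemma dyadic_PL_dyadic:
  assumes "dyadic_PL_homeo f J K" "p \<in> J"
  shows "f p \<in> dyadic \<longleftrightarrow> p \<in> dyadic"
proof -
  obtain m :: int and b where b: "b \<in> dyadic" "f p = 2 powi m * p + b"
    using dyadic_PL_value[OF assms] by fastforce
  then have p: "p = 2 powi (- m) * (f p + - b)" by (simp add: power_int_minus)
  show ?thesis
  proof
    assume "f p \<in> dyadic"
    then have "2 powi (- m) * (f p + - b) \<in> dyadic"
      using b(1) by (intro dyadic_mult dyadic_add dyadic_minus) auto
    then show "p \<in> dyadic" using p by simp
  next
    assume "p \<in> dyadic"
    then show "f p \<in> dyadic" unfolding b(2) using b(1) by (intro dyadic_mult dyadic_add) auto
  qed
qed

lemma dyadic_PL_strict_mono:
  assumes "dyadic_PL_homeo f J K"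
  shows "strict_mono_on J f"
proof -
  obtain a b where J: "J = {a<..<b}" "a < b" using assms by (auto simp: dyadic_PL_homeo_def dyadic_open_interval_def)
  have cont: "continuous_on J f" and inj: "inj_on f J"
    using assms by (auto simp: dyadic_PL_homeo_def homeomorphism_def intro: inj_on_inverseI)
  have "(a + b) / 2 \<in> J" using J by auto
  then obtain q m c where q: "q > (a + b) / 2" "{(a + b) / 2..<q} \<subseteq> J"
    "\<forall>t\<in>{(a + b) / 2..<q}. f t = 2 powi (m::int) * t + c"
    using dyadic_PL_value[OF assms] by blast
  define u v where "u = (a + b) / 2" and "v = (u + q) / 2"
  have "u < q" using q(1) by (simp add: u_def)
  then have uv: "u < v" "u \<in> {u..<q}" "v \<in> {u..<q}" by (auto simp: v_def)
  have "f u < f v" using q(3) uv by (simp add: u_def[symmetric])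
  then have uv: "u < v" "u \<in> J" "v \<in> J" "f u < f v" using uv q(2) by (auto simp: u_def[symmetric])
  have "strict_mono_on J f \<or> strict_antimono_on J f"
    using injective_eq_monotone_map[of J f] cont inj J by auto
  then show ?thesis using uv unfolding monotone_on_def by (metis less_asym)
qed

lemma dyadic_PL_restrict:
  assumes f: "dyadic_PL_homeo f J K" and "a \<in> dyadic" "b \<in> dyadic" "a < b" and sub: "{a..b} \<subseteq> J"
  shows "dyadic_PL_homeo f {a<..<b} {f a<..<f b}" "f ` {a<..<b} = {f a<..<f b}"
proof -
  have mono: "strict_mono_on J f" by (rule dyadic_PL_strict_mono[OF f])
  obtain g where g: "homeomorphism J K f g" using f by (auto simp: dyadic_PL_homeo_def)
  have cont: "continuous_on {a..b} f"
    using g sub continuous_on_subset by (auto simp: homeomorphism_def)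
  have ab: "a \<in> J" "b \<in> J" using sub assms(4) by auto
  have lt: "f x < f y" if "x \<in> {a..b}" "y \<in> {a..b}" "x < y" for x y
  proof -
    have "x \<in> J" "y \<in> J" using that sub by auto
    then show ?thesis using mono that(3) by (auto simp: strict_mono_on_def)
  qed
  show im: "f ` {a<..<b} = {f a<..<f b}"
  proof (intro equalityI subsetI)
    fix y assume "y \<in> f ` {a<..<b}"
    then show "y \<in> {f a<..<f b}" using lt[of a] lt[of _ b] by auto
  next
    fix y assume y: "y \<in> {f a<..<f b}"
    then obtain x where x: "a \<le> x" "x \<le> b" "f x = y"
      using IVT'[of f a y b] cont assms(4) by auto
    then have "x \<noteq> a" "x \<noteq> b" using y by auto
    then show "y \<in> f ` {a<..<b}" using x by (intro image_eqI[of _ _ x]) auto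
  qed
  have "homeomorphism {a<..<b} {f a<..<f b} f g"
    by (rule homeomorphism_of_subsets[OF g _ empty_subsetI im]) (use sub in auto)
  moreover have "f a \<in> dyadic" "f b \<in> dyadic" using dyadic_PL_dyadic[OF f] ab assms by auto
  moreover have "f a < f b" using lt assms(4) by auto
  moreover obtain P where "finite P" "P \<subseteq> dyadic" "dyadic_PL_on f J P"
    using f by (auto simp: dyadic_PL_homeo_alt)
  moreover have "{a<..<b} - P \<subseteq> J - P" using sub by auto
  then have "dyadic_PL_on f {a<..<b} P"
    using \<open>dyadic_PL_on f J P\<close> unfolding dyadic_PL_on_def by (meson order_trans)
  ultimately show "dyadic_PL_homeo f {a<..<b} {f a<..<f b}"
    unfolding dyadic_PL_homeo_alt dyadic_open_interval_def using assms(2-4) by blast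
qed

lemma is_interval_image:
  fixes f :: "real \<Rightarrow> real"
  assumes "is_interval I" "continuous_on I f"
  shows "is_interval (f ` I)"
  using assms connected_continuous_image is_interval_connected_1 by metis

lemma dyadic_PL_compose:
  assumes f: "dyadic_PL_homeo f J K" and h: "dyadic_PL_homeo h K L"
  shows "dyadic_PL_homeo (\<lambda>t. h (f t)) J L"
proof -
  obtain f' where f': "homeomorphism J K f f'" using f by (auto simp: dyadic_PL_homeo_def)
  obtain h' where h': "homeomorphism K L h h'" using h by (auto simp: dyadic_PL_homeo_def)
  have hom: "homeomorphism J L (\<lambda>t. h (f t)) (f' \<circ> h')"
    using homeomorphism_compose[OF f' h'] by (simp add: o_def)
  obtain P where P: "finite P" "P \<subseteq> dyadic" "dyadic_PL_on f J P"
    using f by (auto simp: dyadic_PL_homeo_alt)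
  obtain Q where Q: "finite Q" "Q \<subseteq> dyadic" "dyadic_PL_on h K Q"
    using h by (auto simp: dyadic_PL_homeo_alt)
  define R where "R = P \<union> (f -` Q \<inter> J)"
  have "inj_on f J" using f' by (auto simp: homeomorphism_def intro: inj_on_inverseI)
  then have "finite R" using P Q finite_vimage_IntI by (auto simp: R_def)
  moreover have "R \<subseteq> dyadic" using P(2) Q(2) dyadic_PL_dyadic[OF f] by (auto simp: R_def)
  moreover have "dyadic_PL_on (\<lambda>t. h (f t)) J R"
    unfolding dyadic_PL_on_def
  proof (intro allI impI, elim conjE)
    fix I assume I: "is_interval I" "I \<subseteq> J - R"
    then have "I \<subseteq> J - P" by (auto simp: R_def)
    then obtain m :: int and b where b: "b \<in> dyadic" "\<forall>t\<in>I. f t = 2 powi m * t + b"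
      using P(3) I(1) unfolding dyadic_PL_on_def by blast
    have "continuous_on I f"
      using f' I(2) continuous_on_subset[of J f I] by (auto simp: homeomorphism_def)
    then have "is_interval (f ` I)" using I(1) is_interval_image by blast
    moreover have "f ` I \<subseteq> K - Q" using I(2) f' by (auto simp: R_def homeomorphism_def)
    ultimately obtain n :: int and c where c: "c \<in> dyadic" "\<forall>t\<in>f ` I. h t = 2 powi n * t + c"
      using Q(3) unfolding dyadic_PL_on_def by blast
    have "h (f t) = 2 powi (n + m) * t + (2 powi n * b + c)" if "t \<in> I" for t
    proof -
      have "h (f t) = 2 powi n * f t + c" using c that by blast
      moreover have "f t = 2 powi m * t + b" using b that by blast
      ultimately show ?thesis by (simp only:) (simp add: power_int_add algebra_simps)
    qed
    moreover have "2 powi n * b + c \<in> dyadic"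
      using b c by (intro dyadic_add dyadic_mult) auto
    ultimately show "\<exists>m::int. \<exists>b\<in>dyadic. \<forall>t\<in>I. h (f t) = 2 powi m * t + b" by blast
  qed
  ultimately show ?thesis
    using f h hom unfolding dyadic_PL_homeo_alt by blast
qed

lemma dyadic_PL_inv:
  assumes f: "dyadic_PL_homeo f J K" and g: "homeomorphism J K f g"
  shows "dyadic_PL_homeo g K J"
proof -
  obtain P where P: "finite P" "P \<subseteq> dyadic" "dyadic_PL_on f J P"
    using f by (auto simp: dyadic_PL_homeo_alt)
  define R where "R = f ` (P \<inter> J)"
  have "finite R" using P by (simp add: R_def)
  moreover have "R \<subseteq> dyadic" using P(2) dyadic_PL_dyadic[OF f] by (auto simp: R_def)
  moreover have "dyadic_PL_on g K R"
    unfolding dyadic_PL_on_def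
  proof (intro allI impI, elim conjE)
    fix I assume I: "is_interval I" "I \<subseteq> K - R"
    have fg: "f (g t) = t" "g t \<in> J" if "t \<in> I" for t
      using that I(2) g by (auto simp: homeomorphism_def)
    have "continuous_on I g"
      using g I(2) continuous_on_subset[of K g I] by (auto simp: homeomorphism_def)
    then have "is_interval (g ` I)" using I(1) is_interval_image by blast
    moreover have "g ` I \<subseteq> J - P"
    proof
      fix s assume "s \<in> g ` I"
      then obtain t where t: "t \<in> I" "s = g t" by blast
      have "t \<notin> f ` (P \<inter> J)" using t(1) I(2) by (auto simp: R_def)
      then have "s \<notin> P" using fg[OF t(1)] t(2) by (metis IntI image_eqI)
      then show "s \<in> J - P" using fg t by auto
    qed
    ultimately obtain m :: int and b where b: "b \<in> dyadic" "\<forall>t\<in>g ` I. f t = 2 powi m * t + b"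
      using P(3) unfolding dyadic_PL_on_def by blast
    have "g t = 2 powi (- m) * t + 2 powi (- m) * (- b)" if "t \<in> I" for t
    proof -
      have "t = 2 powi m * g t + b" using fg[OF that] b(2) that by force
      then have "2 powi (- m) * t = 2 powi (- m) * (2 powi m * g t + b)" by simp
      then show ?thesis by (simp add: power_int_minus algebra_simps)
    qed
    moreover have "2 powi (- m) * (- b) \<in> dyadic"
      using b by (intro dyadic_mult dyadic_minus) auto
    ultimately show "\<exists>m::int. \<exists>b\<in>dyadic. \<forall>t\<in>I. g t = 2 powi m * t + b" by blast
  qed
  ultimately show ?thesis
    using f homeomorphism_symD[OF g] unfolding dyadic_PL_homeo_alt by blast
qed

lemma dyadic_PL_translate:
  assumes "a \<in> dyadic" "b \<in> dyadic" "a < b" "c \<in> dyadic"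
  shows "dyadic_PL_homeo (\<lambda>t. t + c) {a<..<b} {a + c<..<b + c}"
proof -
  have "homeomorphism {a<..<b} {a + c<..<b + c} (\<lambda>t. t + c) (\<lambda>t. t - c)"
    by (rule homeomorphismI) (auto intro!: continuous_intros)
  moreover have "dyadic_PL_on (\<lambda>t. t + c) {a<..<b} {}"
    unfolding dyadic_PL_on_def using assms(4) by (auto intro!: exI[of _ 0] bexI[of _ c])
  ultimately show ?thesis
    unfolding dyadic_PL_homeo_alt dyadic_open_interval_def
    using assms dyadic_add by (metis add_strict_right_mono empty_subsetI finite.emptyI)
qed

subsection \<open>Isotopies\<close>

lemma homeomorphic_map_inv_into:
  assumes "homeomorphic_map X Y f"
  shows "homeomorphic_map Y X (inv_into (topspace X) f)"
proof -
  obtain g where g: "homeomorphic_maps X Y f g"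
    using assms homeomorphic_map_maps by blast
  have "g y = inv_into (topspace X) f y" if "y \<in> topspace Y" for y
  proof -
    have "g y \<in> topspace X" "f (g y) = y"
      using g that by (auto simp: homeomorphic_maps_def continuous_map_def)
    then show ?thesis
      using homeomorphic_imp_injective_map[OF assms] by (metis inv_into_f_f)
  qed
  moreover have "homeomorphic_map Y X g"
    using g homeomorphic_maps_map homeomorphic_maps_sym by blast
  ultimately show ?thesis using homeomorphic_map_eq by blast
qed

lemma isotopic_to_id_compose:
  assumes "isotopic_to_id Y g" "isotopic_to_id Y h"
  shows "isotopic_to_id Y (\<lambda>y. g (h y))"
proof -
  obtain H where H: "continuous_map (prod_topology (top_of_set {0..1::real}) Y) Y H"
    "\<And>s. s \<in> {0..1} \<Longrightarrow> homeomorphic_map Y Y (\<lambda>y. H (s, y))"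
    "\<And>y. y \<in> topspace Y \<Longrightarrow> H (0, y) = y" "\<And>y. y \<in> topspace Y \<Longrightarrow> H (1, y) = g y"
    using assms(1) unfolding isotopic_to_id_def by blast
  obtain G where G: "continuous_map (prod_topology (top_of_set {0..1::real}) Y) Y G"
    "\<And>s. s \<in> {0..1} \<Longrightarrow> homeomorphic_map Y Y (\<lambda>y. G (s, y))"
    "\<And>y. y \<in> topspace Y \<Longrightarrow> G (0, y) = y" "\<And>y. y \<in> topspace Y \<Longrightarrow> G (1, y) = h y"
    using assms(2) unfolding isotopic_to_id_def by blast
  have Gin: "G (1, y) \<in> topspace Y" if "y \<in> topspace Y" for y
    using homeomorphic_imp_surjective_map[OF G(2)[of 1]] that by auto
  have "continuous_map (prod_topology (top_of_set {0..1::real}) Y) Y (H \<circ> (\<lambda>p. (fst p, G p)))"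
    by (rule continuous_map_compose[OF _ H(1)])
      (intro continuous_map_pairedI continuous_map_fst G(1))
  moreover have "homeomorphic_map Y Y (\<lambda>y. H (s, G (s, y)))" if "s \<in> {0..1}" for s
    using homeomorphic_map_compose[OF G(2)[OF that] H(2)[OF that]] by (simp add: o_def)
  ultimately show ?thesis
    unfolding isotopic_to_id_def using H G Gin
    by (intro exI[of _ "H \<circ> (\<lambda>p. (fst p, G p))"]) (auto simp: o_def)
qed

lemma isotopic_to_id_inv:
  assumes "homeomorphic_map Y Y g" "isotopic_to_id Y g"
  shows "isotopic_to_id Y (inv_into (topspace Y) g)"
proof -
  let ?g = "inv_into (topspace Y) g"
  obtain H where H: "continuous_map (prod_topology (top_of_set {0..1::real}) Y) Y H"
    "\<And>s. s \<in> {0..1} \<Longrightarrow> homeomorphic_map Y Y (\<lambda>y. H (s, y))"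
    "\<And>y. y \<in> topspace Y \<Longrightarrow> H (0, y) = y" "\<And>y. y \<in> topspace Y \<Longrightarrow> H (1, y) = g y"
    using assms(2) unfolding isotopic_to_id_def by blast
  have inv: "homeomorphic_map Y Y ?g" by (rule homeomorphic_map_inv_into[OF assms(1)])
  have gin: "?g y \<in> topspace Y" "g (?g y) = y" if "y \<in> topspace Y" for y
    using that homeomorphic_imp_surjective_map[OF assms(1)]
    by (metis inv_into_into, metis f_inv_into_f)
  have "continuous_map (prod_topology (top_of_set {0..1::real}) Y) (top_of_set {0..1}) (\<lambda>p. 1 - fst p)"
    using continuous_map_fst[of "top_of_set {0..1::real}" Y]
    by (auto simp: continuous_map_in_subtopology Pi_iff intro!: continuous_map_diff)
  moreover have "continuous_map (prod_topology (top_of_set {0..1::real}) Y) Y (\<lambda>p. ?g (snd p))"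
    using continuous_map_compose[OF continuous_map_snd homeomorphic_imp_continuous_map[OF inv]]
    by (simp add: o_def)
  ultimately have "continuous_map (prod_topology (top_of_set {0..1::real}) Y) Y
      (H \<circ> (\<lambda>p. (1 - fst p, ?g (snd p))))"
    by (intro continuous_map_compose[OF _ H(1)] continuous_map_pairedI)
  moreover have "homeomorphic_map Y Y (\<lambda>y. H (1 - s, ?g y))" if "s \<in> {0..1}" for s
    using homeomorphic_map_compose[OF inv H(2)[of "1 - s"]] that by (simp add: o_def)
  ultimately show ?thesis
    unfolding isotopic_to_id_def using H gin
    by (intro exI[of _ "H \<circ> (\<lambda>p. (1 - fst p, ?g (snd p)))"]) (auto simp: o_def)
qed

lemma isotopic_to_id_id:
  assumes "\<And>y. y \<in> topspace Y \<Longrightarrow> g y = y"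
  shows "isotopic_to_id Y g"
proof -
  have "homeomorphic_map Y Y (\<lambda>y. snd (s::real, y))" for s
    using homeomorphic_map_id[of Y Y] by (simp add: id_def)
  then show ?thesis
    unfolding isotopic_to_id_def using assms continuous_map_snd
    by (intro exI[of _ snd]) auto
qed

lemma isotopic_to_id_cong:
  assumes "isotopic_to_id Y g" "\<And>y. y \<in> topspace Y \<Longrightarrow> g y = h y"
  shows "isotopic_to_id Y h"
proof -
  from assms(1) obtain H where
    "continuous_map (prod_topology (top_of_set {0..1::real}) Y) Y H"
    "\<forall>s\<in>{0..1}. homeomorphic_map Y Y (\<lambda>y. H (s, y))"
    "\<forall>y\<in>topspace Y. H (0, y) = y" "\<forall>y\<in>topspace Y. H (1, y) = g y"
    unfolding isotopic_to_id_def by blast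
  then show ?thesis unfolding isotopic_to_id_def using assms(2) by (intro exI[of _ H]) auto
qed

subsection \<open>\<open>T(\<phi>)\<close> is a group of homeomorphisms\<close>

lemma return_time_antimono: "C' \<subseteq> C \<Longrightarrow> return_time \<phi> C \<le> return_time \<phi> C'"
  unfolding return_time_def by (rule Inf_superset_mono) auto

lemma interval_length_mono:
  fixes a b c d :: real
  assumes "a < b" "{a<..<b} \<subseteq> {c<..<d}"
  shows "b - a \<le> d - c"
  using assms by (simp add: greaterThanLessThan_subseteq_greaterThanLessThan)

lemma chart_smaller:
  assumes "chart X \<phi> C J" "openin X C'" "closedin X C'"
    and "return_time \<phi> C \<le> return_time \<phi> C'" "a < b" "{a + c<..<b + c} \<subseteq> J"
  shows "chart X \<phi> C' {a<..<b}"
proof -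
  obtain u v where J: "J = {u<..<v}" and l: "ereal (v - u) < ereal_of_enat (return_time \<phi> C)"
    using assms(1) by (auto simp: chart_def)
  have "b - a \<le> v - u" using interval_length_mono[of "a + c" "b + c" u v] assms(5,6) J by simp
  then have "ereal (b - a) \<le> ereal (v - u)" by simp
  also note l
  also have "ereal_of_enat (return_time \<phi> C) \<le> ereal_of_enat (return_time \<phi> C')"
    using assms(4) by simp
  finally show ?thesis using assms(2,3,5) unfolding chart_def by blast
qed

definition T_local :: "'x topology \<Rightarrow> ('x \<Rightarrow> 'x) \<Rightarrow> (('x \<times> real) set \<Rightarrow> ('x \<times> real) set)
    \<Rightarrow> ('x \<times> real) set \<Rightarrow> bool" where
  "T_local X \<phi> g y \<longleftrightarrow> (\<exists>C J f. dyadic_chart X \<phi> C J \<and> y \<in> domain_of X \<phi> C J \<and>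
      dyadic_PL_homeo f J (f ` J) \<and> dyadic_chart X \<phi> C (f ` J) \<and>
      (\<forall>x\<in>C. \<forall>t\<in>J. g (susp_class X \<phi> (x, t)) = susp_class X \<phi> (x, f t)))"

context
  fixes X :: "'x topology" and \<phi> :: "'x \<Rightarrow> 'x"
  assumes stone: "stone_system X \<phi>"
begin

lemma T_carrier_iff:
  "g \<in> T_carrier X \<phi> \<longleftrightarrow> g \<in> H0 X \<phi> \<and> (\<forall>y \<in> topspace (suspension X \<phi>). T_local X \<phi> g y)"
proof -
  have "(dyadic_chart X \<phi> C J \<and> y \<in> domain_of X \<phi> C J \<and>
      dyadic_PL_homeo f J (f ` J) \<and> dyadic_chart X \<phi> C (f ` J) \<and>
      g ` domain_of X \<phi> C J = domain_of X \<phi> C (f ` J) \<and>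
      (\<forall>x\<in>C. \<forall>t\<in>J.
         inv_into (C \<times> f ` J) (susp_class X \<phi>) (g (susp_class X \<phi> (x, t))) = (x, f t))) \<longleftrightarrow>
     (dyadic_chart X \<phi> C J \<and> y \<in> domain_of X \<phi> C J \<and>
      dyadic_PL_homeo f J (f ` J) \<and> dyadic_chart X \<phi> C (f ` J) \<and>
      (\<forall>x\<in>C. \<forall>t\<in>J. g (susp_class X \<phi> (x, t)) = susp_class X \<phi> (x, f t)))" for C J f y
    using T_local_iff[OF stone, of C J f g] unfolding dyadic_chart_def by argo
  then show ?thesis
    unfolding T_carrier_def mem_Collect_eq T_local_def by (simp only:)
qed

lemma susp_in: "x \<in> topspace X \<Longrightarrow> susp_class X \<phi> (x, t) \<in> topspace (suspension X \<phi>)"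
  by (simp add: topspace_suspension)

lemma T_local_cong:
  assumes "T_local X \<phi> g y" "\<And>z. z \<in> topspace (suspension X \<phi>) \<Longrightarrow> h z = g z"
  shows "T_local X \<phi> h y"
proof -
  obtain C J f where *: "dyadic_chart X \<phi> C J" "y \<in> domain_of X \<phi> C J"
      "dyadic_PL_homeo f J (f ` J)" "dyadic_chart X \<phi> C (f ` J)"
      "\<forall>x\<in>C. \<forall>t\<in>J. g (susp_class X \<phi> (x, t)) = susp_class X \<phi> (x, f t)"
    using assms(1) unfolding T_local_def by blast
  have "C \<subseteq> topspace X" using *(1) chart_subset[OF stone, of C J] by (simp add: dyadic_chart_def)
  then have "\<forall>x\<in>C. \<forall>t\<in>J. h (susp_class X \<phi> (x, t)) = susp_class X \<phi> (x, f t)"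
    using *(5) assms(2) susp_in by (simp add: subset_iff)
  then show ?thesis unfolding T_local_def using *(1-4) by blast
qed

lemma T_local_id:
  assumes "y \<in> topspace (suspension X \<phi>)"
  shows "T_local X \<phi> (\<lambda>z. z) y"
proof -
  obtain x t where y: "x \<in> topspace X" "y = susp_class X \<phi> (x, t)"
    using assms by (auto simp: topspace_suspension)
  obtain a where a: "a \<in> dyadic" "t - 1/2 < a" "a < t" using dyadic_dense[of "t - 1/2" t] by auto
  obtain b where b: "b \<in> dyadic" "t < b" "b < t + 1/2" using dyadic_dense[of t "t + 1/2"] by auto
  let ?J = "{a<..<b}"
  have "enat 1 \<le> return_time \<phi> (topspace X)"
    unfolding return_time_def by (rule Inf_greatest) auto
  then have "ereal_of_enat (enat 1) \<le> ereal_of_enat (return_time \<phi> (topspace X))" by (simp only: ereal_of_enat_le_iff)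
  moreover have "ereal (b - a) < ereal_of_enat (enat 1)" using a b by simp
  ultimately have "ereal (b - a) < ereal_of_enat (return_time \<phi> (topspace X))"
    using order_less_le_trans by blast
  moreover have "a < b" using a b by simp
  ultimately have "chart X \<phi> (topspace X) ?J" unfolding chart_def
    by (intro conjI openin_topspace closedin_topspace exI[of _ a] exI[of _ b] HOL.refl)
  moreover have J: "dyadic_open_interval ?J" using a b \<open>a < b\<close> unfolding dyadic_open_interval_def by blast
  ultimately have "dyadic_chart X \<phi> (topspace X) ?J" by (simp add: dyadic_chart_def)
  moreover have "dyadic_PL_homeo (\<lambda>t. t + 0) ?J {a + 0<..<b + 0}"
    using dyadic_PL_translate[of a b "of_int 0"] a b dyadic_of_int[of 0] by simp
  moreover have "y \<in> domain_of X \<phi> (topspace X) ?J" using y a b by (auto simp: domain_of_def)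
  ultimately show ?thesis unfolding T_local_def
    by (intro exI[of _ "topspace X"] exI[of _ ?J] exI[of _ "\<lambda>t. t"]) simp
qed

lemma T_local_inv:
  assumes "inj_on g (topspace (suspension X \<phi>))" "y \<in> topspace (suspension X \<phi>)" "T_local X \<phi> g y"
  shows "T_local X \<phi> (inv_into (topspace (suspension X \<phi>)) g) (g y)"
proof -
  let ?Y = "topspace (suspension X \<phi>)"
  obtain C J f where *: "dyadic_chart X \<phi> C J" "y \<in> domain_of X \<phi> C J"
      "dyadic_PL_homeo f J (f ` J)" "dyadic_chart X \<phi> C (f ` J)"
      "\<forall>x\<in>C. \<forall>t\<in>J. g (susp_class X \<phi> (x, t)) = susp_class X \<phi> (x, f t)"
    using assms(3) unfolding T_local_def by blast
  have CX: "C \<subseteq> topspace X" using *(1) chart_subset[OF stone, of C J] by (simp add: dyadic_chart_def)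
  obtain h where h: "homeomorphism J (f ` J) f h" using *(3) by (auto simp: dyadic_PL_homeo_def)
  then have hJ: "h ` (f ` J) = J" and hf: "\<And>t. t \<in> J \<Longrightarrow> h (f t) = t"
    by (auto simp: homeomorphism_def)
  have "dyadic_PL_homeo h (f ` J) (h ` (f ` J))"
    unfolding hJ by (rule dyadic_PL_inv[OF *(3) h])
  moreover have "g y \<in> domain_of X \<phi> C (f ` J)"
    using *(2,5) by (auto simp: domain_of_def)
  moreover have "inv_into ?Y g (susp_class X \<phi> (x, s)) = susp_class X \<phi> (x, h s)"
    if xs: "x \<in> C" "s \<in> f ` J" for x s
  proof -
    obtain t where t: "t \<in> J" "s = f t" using xs(2) by blast
    have "susp_class X \<phi> (x, t) \<in> ?Y" using CX xs(1) susp_in by blast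
    then have "inv_into ?Y g (g (susp_class X \<phi> (x, t))) = susp_class X \<phi> (x, t)"
      using assms(1) inv_into_f_f by metis
    then show ?thesis using *(5) xs(1) t hf by simp
  qed
  ultimately show ?thesis unfolding T_local_def using *(1,4) hJ
    by (intro exI[of _ C] exI[of _ "f ` J"] exI[of _ h]) simp
qed

lemma T_local_compose:
  assumes "T_local X \<phi> g y" "T_local X \<phi> h (g y)"
  shows "T_local X \<phi> (\<lambda>z. h (g z)) y"
proof -
  obtain C J f where f: "dyadic_chart X \<phi> C J" "y \<in> domain_of X \<phi> C J"
      "dyadic_PL_homeo f J (f ` J)" "dyadic_chart X \<phi> C (f ` J)"
      "\<forall>x\<in>C. \<forall>t\<in>J. g (susp_class X \<phi> (x, t)) = susp_class X \<phi> (x, f t)"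
    using assms(1) unfolding T_local_def by blast
  obtain D L k where k: "dyadic_chart X \<phi> D L" "g y \<in> domain_of X \<phi> D L"
      "dyadic_PL_homeo k L (k ` L)" "dyadic_chart X \<phi> D (k ` L)"
      "\<forall>x\<in>D. \<forall>t\<in>L. h (susp_class X \<phi> (x, t)) = susp_class X \<phi> (x, k t)"
    using assms(2) unfolding T_local_def by blast
  have C: "openin X C" "closedin X C" "chart X \<phi> C J" "C \<subseteq> topspace X"
    and D: "openin X D" "closedin X D" "chart X \<phi> D (k ` L)" "D \<subseteq> topspace X"
    using f(1) k(1,4) openin_subset by (auto simp: dyadic_chart_def chart_def)
  obtain x t where x: "x \<in> C" "t \<in> J" "y = susp_class X \<phi> (x, t)"
    using f(2) by (auto simp: domain_of_def)
  obtain x' t' where x': "x' \<in> D" "t' \<in> L" "g y = susp_class X \<phi> (x', t')"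
    using k(2) by (auto simp: domain_of_def)
  have "susp_class X \<phi> (x, f t) = susp_class X \<phi> (x', t')" using f(5) x x' by simp
  then obtain n :: int where n: "x' = zpow X \<phi> n x" "t' = f t - of_int n"
    using susp_class_eq_iff[OF stone] x x' C D by blast
  define E where "E = {z \<in> topspace X. zpow X \<phi> n z \<in> D} \<inter> C"
  have E: "openin X E" "closedin X E" "E \<subseteq> C" "x \<in> E"
    unfolding E_def using continuous_zpow[OF stone, of n] C D x x' n
    by (auto simp: openin_continuous_map_preimage closedin_continuous_map_preimage)
  have retE: "return_time \<phi> D \<le> return_time \<phi> E"
    unfolding return_time_def
  proof (rule Inf_superset_mono, safe)
    fix m :: nat and z assume m: "1 \<le> m" "z \<in> E" "(\<phi> ^^ m) z \<in> E"
    have z: "z \<in> topspace X" using m(2) by (simp add: E_def)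
    have "(\<phi> ^^ m) (zpow X \<phi> n z) = zpow X \<phi> n ((\<phi> ^^ m) z)"
      unfolding zpow_of_nat[OF stone, symmetric] zpow_add[OF stone z] by (simp add: add.commute)
    then have "(\<phi> ^^ m) (zpow X \<phi> n z) \<in> D" "zpow X \<phi> n z \<in> D" using m by (auto simp: E_def)
    then show "\<exists>n. enat m = enat n \<and> 1 \<le> n \<and> (\<exists>x\<in>D. (\<phi> ^^ n) x \<in> D)"
      using m(1) by blast
  qed
  obtain u v where L: "L = {u<..<v}" "u \<in> dyadic" "v \<in> dyadic"
    using k(1) by (auto simp: dyadic_chart_def dyadic_open_interval_def)
  obtain c d where J: "J = {c<..<d}"
    using f(1) by (auto simp: dyadic_chart_def dyadic_open_interval_def)
  have contf: "continuous_on J f" using f(3) by (auto simp: dyadic_PL_homeo_def homeomorphism_def)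
  have "open (f -` {u + n<..<v + n} \<inter> J)"
    using continuous_open_preimage[OF contf, of "{u + n<..<v + n}"] J by (simp add: Int_commute)
  moreover have "t \<in> f -` {u + n<..<v + n} \<inter> J" using x(2) x'(2) n(2) L by auto
  ultimately obtain e where e: "e > 0" "ball t e \<subseteq> f -` {u + n<..<v + n} \<inter> J"
    unfolding open_contains_ball by blast
  obtain a where a: "a \<in> dyadic" "t - e < a" "a < t" using dyadic_dense[of "t - e" t] e(1) by auto
  obtain b where b: "b \<in> dyadic" "t < b" "b < t + e" using dyadic_dense[of t "t + e"] e(1) by auto
  have sub: "{a..b} \<subseteq> f -` {u + n<..<v + n} \<inter> J"
  proof -
    have "{a..b} \<subseteq> ball t e" using a b by (auto simp: dist_real_def)
    then show ?thesis using e(2) by blast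
  qed
  have ab: "a < b" using a b by simp
  let ?J = "{a<..<b}"
  have r: "dyadic_PL_homeo f ?J {f a<..<f b}" "f ` ?J = {f a<..<f b}"
    using dyadic_PL_restrict[OF f(3) a(1) b(1) ab] sub by auto
  have fab: "f a < f b" "f a \<in> dyadic" "f b \<in> dyadic"
  proof -
    have J: "a \<in> J" "b \<in> J" using sub ab by auto
    show "f a < f b" using dyadic_PL_strict_mono[OF f(3)] J ab by (auto simp: strict_mono_on_def)
    show "f a \<in> dyadic" "f b \<in> dyadic" using dyadic_PL_dyadic[OF f(3)] J a b by auto
  qed
  let ?a = "f a + of_int (- n)" and ?b = "f b + of_int (- n)"
  have r2: "dyadic_PL_homeo (\<lambda>t. t + of_int (- n)) {f a<..<f b} {?a<..<?b}"
    by (rule dyadic_PL_translate[OF fab(2,3,1) dyadic_of_int])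
  have "a \<in> {a..b}" "b \<in> {a..b}" using ab by auto
  then have "f a \<in> {u + n<..<v + n}" "f b \<in> {u + n<..<v + n}" using sub by blast+
  then have abL: "{?a..?b} \<subseteq> L" using L(1) by auto
  have dya: "?a \<in> dyadic" "?b \<in> dyadic" using fab dyadic_add dyadic_of_int by blast+
  have r3: "dyadic_PL_homeo k {?a<..<?b} {k ?a<..<k ?b}" "k ` {?a<..<?b} = {k ?a<..<k ?b}"
    using dyadic_PL_restrict[OF k(3) dya _ abL] fab(1) by auto
  have kab: "k ?a < k ?b" "k ?a \<in> dyadic" "k ?b \<in> dyadic"
  proof -
    have J: "?a \<in> L" "?b \<in> L" using abL fab(1) by auto
    show "k ?a < k ?b" using dyadic_PL_strict_mono[OF k(3)] J fab(1) by (auto simp: strict_mono_on_def)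
    show "k ?a \<in> dyadic" "k ?b \<in> dyadic" using dyadic_PL_dyadic[OF k(3)] J dya by auto
  qed
  have r4: "dyadic_PL_homeo (\<lambda>t. t + of_int n) {k ?a<..<k ?b} {k ?a + of_int n<..<k ?b + of_int n}"
    by (rule dyadic_PL_translate[OF kab(2,3,1) dyadic_of_int])
  define F where "F = (\<lambda>t. k (f t + of_int (- n)) + of_int n)"
  let ?K = "{k ?a + of_int n<..<k ?b + of_int n}"
  have F: "dyadic_PL_homeo F ?J ?K" unfolding F_def
    using dyadic_PL_compose[OF dyadic_PL_compose[OF dyadic_PL_compose[OF r(1) r2] r3(1)] r4] .
  then have FJ: "F ` ?J = ?K" by (auto simp: dyadic_PL_homeo_def homeomorphism_def)
  have "?J \<subseteq> J" using sub by auto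
  then have "chart X \<phi> E ?J"
    using chart_smaller[OF C(3) E(1,2) return_time_antimono[OF E(3)] ab, of 0] by simp
  moreover have "dyadic_open_interval ?J" "dyadic_open_interval ?K"
    using F by (auto simp: dyadic_PL_homeo_def)
  moreover have "{?a<..<?b} \<subseteq> L"
    by (rule order_trans[OF _ abL]) auto
  then have "k ` {?a<..<?b} \<subseteq> k ` L" by (rule image_mono)
  then have "{k ?a<..<k ?b} \<subseteq> k ` L" unfolding r3(2) .
  then have "chart X \<phi> E ?K"
    using kab(1) by (intro chart_smaller[OF D(3) E(1,2) retE, of _ _ "- of_int n"]) auto
  ultimately have ch: "dyadic_chart X \<phi> E ?J" "dyadic_chart X \<phi> E (F ` ?J)"
    by (auto simp: dyadic_chart_def FJ)
  have "y \<in> domain_of X \<phi> E ?J" using x(3) E(4) a b by (auto simp: domain_of_def)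
  moreover have "h (g (susp_class X \<phi> (z, s))) = susp_class X \<phi> (z, F s)" if "z \<in> E" "s \<in> ?J" for z s
  proof -
    have z: "z \<in> topspace X" "z \<in> C" "zpow X \<phi> n z \<in> D" using that by (auto simp: E_def)
    have s: "s \<in> J" using that sub by auto
    have "s \<in> {a..b}" using that by simp
    then have "f s \<in> {u + n<..<v + n}" using sub by blast
    then have s2: "f s - of_int n \<in> L" using L(1) by auto
    have "g (susp_class X \<phi> (z, s)) = susp_class X \<phi> (z, f s)" using f(5) z s by blast
    also have "\<dots> = susp_class X \<phi> (zpow X \<phi> n z, f s - of_int n)"
      using susp_class_eq_iff[OF stone z(1) zpow_in[OF stone z(1)]] by blast
    finally have "h (g (susp_class X \<phi> (z, s))) = susp_class X \<phi> (zpow X \<phi> n z, k (f s - of_int n))"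
      using k(5) z s2 by simp
    also have "\<dots> = susp_class X \<phi> (z, F s)"
    proof -
      have "k (f s - of_int n) = F s - of_int n" by (simp add: F_def)
      then show ?thesis using susp_class_eq_iff[OF stone z(1) zpow_in[OF stone z(1)]] by metis
    qed
    finally show ?thesis .
  qed
  ultimately show ?thesis unfolding T_local_def using ch F FJ
    by (intro exI[of _ E] exI[of _ ?J] exI[of _ F]) simp
qed

lemma subgroup_T_carrier:
  "subgroup (T_carrier X \<phi>) (BijGroup (topspace (suspension X \<phi>)))"
proof -
  let ?S = "suspension X \<phi>" and ?Y = "topspace (suspension X \<phi>)"
  interpret B: group "BijGroup ?Y" by (rule group_BijGroup)
  have bij: "g \<in> Bij ?Y" if "g \<in> H0 X \<phi>" for g
  proof -
    have hom: "homeomorphic_map ?S ?S g" and "g \<in> extensional ?Y" using that by (auto simp: H0_def)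
    then show ?thesis
      using homeomorphic_imp_injective_map[OF hom] homeomorphic_imp_surjective_map[OF hom]
      by (simp add: Bij_def bij_betw_def)
  qed
  have mul: "g \<otimes>\<^bsub>BijGroup ?Y\<^esub> h = compose ?Y g h" if "g \<in> H0 X \<phi>" "h \<in> H0 X \<phi>" for g h
    using bij[OF that(1)] bij[OF that(2)] by (simp add: BijGroup_def)
  show ?thesis
  proof
    show "T_carrier X \<phi> \<subseteq> carrier (BijGroup ?Y)"
      using bij T_carrier_iff by (auto simp: BijGroup_def)
  next
    fix g h assume "g \<in> T_carrier X \<phi>" "h \<in> T_carrier X \<phi>"
    then have g: "g \<in> H0 X \<phi>" "\<And>y. y \<in> ?Y \<Longrightarrow> T_local X \<phi> g y"
      and h: "h \<in> H0 X \<phi>" "\<And>y. y \<in> ?Y \<Longrightarrow> T_local X \<phi> h y"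
      using T_carrier_iff by blast+
    have hY: "h y \<in> ?Y" if "y \<in> ?Y" for y
      using bij[OF h(1)] that by (auto simp: Bij_def bij_betw_def)
    have eq: "compose ?Y g h y = g (h y)" if "y \<in> ?Y" for y
      using that by (simp add: compose_def)
    have "homeomorphic_map ?S ?S (g \<circ> h)"
      using g(1) h(1) homeomorphic_map_compose unfolding H0_def by blast
    then have "homeomorphic_map ?S ?S (compose ?Y g h)"
      by (rule homeomorphic_map_eq) (simp add: eq)
    moreover have "isotopic_to_id ?S (\<lambda>y. g (h y))"
      using g(1) h(1) isotopic_to_id_compose unfolding H0_def by blast
    then have "isotopic_to_id ?S (compose ?Y g h)"
      by (rule isotopic_to_id_cong) (simp add: eq)
    ultimately have "compose ?Y g h \<in> H0 X \<phi>" by (simp add: H0_def)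
    moreover have "T_local X \<phi> (compose ?Y g h) y" if "y \<in> ?Y" for y
      using T_local_compose[OF h(2)[OF that] g(2)[OF hY[OF that]]] eq by (rule T_local_cong)
    ultimately show "g \<otimes>\<^bsub>BijGroup ?Y\<^esub> h \<in> T_carrier X \<phi>"
      using T_carrier_iff mul[OF g(1) h(1)] by simp
  next
    let ?i = "\<lambda>y\<in>?Y. y"
    have "homeomorphic_map ?S ?S ?i"
      by (rule homeomorphic_map_eq[of _ _ id]) (auto simp: homeomorphic_map_id)
    moreover have "isotopic_to_id ?S ?i" by (rule isotopic_to_id_id) simp
    ultimately have "?i \<in> H0 X \<phi>" by (simp add: H0_def)
    moreover have "T_local X \<phi> ?i y" if "y \<in> ?Y" for y
      using T_local_id[OF that] by (rule T_local_cong) simp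
    ultimately show "\<one>\<^bsub>BijGroup ?Y\<^esub> \<in> T_carrier X \<phi>"
      using T_carrier_iff by (simp add: BijGroup_def)
  next
    fix g assume "g \<in> T_carrier X \<phi>"
    then have g: "g \<in> H0 X \<phi>" "\<And>y. y \<in> ?Y \<Longrightarrow> T_local X \<phi> g y" using T_carrier_iff by blast+
    let ?g = "inv_into ?Y g" and ?h = "restrict (inv_into ?Y g) ?Y"
    have hom: "homeomorphic_map ?S ?S g" using g(1) by (simp add: H0_def)
    have "homeomorphic_map ?S ?S ?h"
      using homeomorphic_map_inv_into[OF hom] by (rule homeomorphic_map_eq) simp
    moreover have "isotopic_to_id ?S ?g"
      using isotopic_to_id_inv[OF hom] g(1) by (simp add: H0_def)
    then have "isotopic_to_id ?S ?h" by (rule isotopic_to_id_cong) simp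
    ultimately have "?h \<in> H0 X \<phi>" by (simp add: H0_def)
    moreover have "T_local X \<phi> ?h y" if y: "y \<in> ?Y" for y
    proof -
      have inj: "inj_on g ?Y" and im: "g ` ?Y = ?Y"
        using homeomorphic_imp_injective_map[OF hom] homeomorphic_imp_surjective_map[OF hom] by auto
      then obtain z where z: "z \<in> ?Y" "y = g z" using y by blast
      have "T_local X \<phi> ?g y" unfolding z(2) by (rule T_local_inv[OF inj z(1) g(2)[OF z(1)]])
      then show ?thesis by (rule T_local_cong) simp
    qed
    ultimately have "?h \<in> T_carrier X \<phi>" using T_carrier_iff by blast
    then show "inv\<^bsub>BijGroup ?Y\<^esub> g \<in> T_carrier X \<phi>"
      using inv_BijGroup[OF bij[OF g(1)]] by simp
  qed
qed

theorem group_T_group: "group (T_group X \<phi>)"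
  unfolding T_group_def by (rule group.subgroup_imp_group[OF group_BijGroup subgroup_T_carrier])

end

end

theory Submission
  imports Defs
begin

text \<open>
  Every \<open>g \<in> T(\<phi>)\<close> moves points along flow lines, \<open>g[x,t] = [x, g\<^sub>x(t)]\<close>, and by compactness \<open>g\<^sub>x\<close> on
  \<open>[0,1]\<close> depends only on a finite window of \<open>x\<close>. If \<open>T(\<phi>)\<close> is finitely presented, then for all
  sufficiently large \<open>M\<close> the following holds: for every sequence \<open>z\<close> all of whose windows of radius \<open>M\<close>
  occur in \<open>X\<close>, the same local rules make the generators act on the real line over \<open>z\<close>, and the relators,
  which have bounded displacement, act trivially. So \<open>T(\<phi>)\<close> acts on the line, and finitely many
  elements fixed before \<open>M\<close> act as prescribed by \<open>z\<close>.

  Such an action determines a point of \<open>X\<close>. For a clopen \<open>D\<close> and a map \<open>f\<close> of the unit cell let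
  \<open>f\<^sub>D\<close> act as \<open>f\<close> on the cells over \<open>D\<close>. For suitable \<open>f\<close> in Thompson's group, \<open>f\<^sub>D\<close> and
  \<open>f\<^sub>X\<^sub>-\<^sub>D\<close> commute and have product \<open>f\<^sub>X\<close>, which acts in the standard way; since orbits in the interval
  are dense, over each cell one of the two factors acts trivially and the other one as \<open>f\<close>. The sets \<open>D\<close> that act
  as \<open>f\<close> over cell \<open>i\<close> are closed under finite intersections, do not contain \<open>{}\<close>, contain the
  set of \<open>x\<close> with \<open>x\<^sub>0 = z\<^sub>i\<close>, and are carried to those of cell \<open>i + 1\<close> by the time-one flow map. Hence
  all finite windows of \<open>z\<close> at the origin are realised in \<open>X\<close>, so \<open>z \<in> X\<close>. An infinite
  minimal subshift contains no periodic sequence, whereas closing up a recurring window gives a periodic \<open>z\<close>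
  of the above kind.
\<close>

section \<open>Presentations and increasing bijections of the line\<close>

primrec word_eval :: "('g, 'm) monoid_scheme \<Rightarrow> ('s \<Rightarrow> 'g) \<Rightarrow> ('s \<times> bool) list \<Rightarrow> 'g" where
  "word_eval G q [] = \<one>\<^bsub>G\<^esub>"
| "word_eval G q (x # w) = (if snd x then q (fst x) else inv\<^bsub>G\<^esub> q (fst x)) \<otimes>\<^bsub>G\<^esub> word_eval G q w"

lemma word_eval_closed:
  assumes "group G" "q \<in> S \<rightarrow> carrier G" "w \<in> words S"
  shows "word_eval G q w \<in> carrier G"
proof -
  interpret group G by fact
  show ?thesis using assms(3)
    by (induction w) (use assms(2) in \<open>auto simp: words_def Pi_iff\<close>)
qed

lemma word_eval_append:
  assumes "group G" "q \<in> S \<rightarrow> carrier G" "v \<in> words S" "w \<in> words S"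
  shows "word_eval G q (v @ w) = word_eval G q v \<otimes>\<^bsub>G\<^esub> word_eval G q w"
proof -
  interpret group G by fact
  note c = word_eval_closed[OF assms(1,2)]
  show ?thesis using assms(3)
  proof (induction v)
    case Nil
    then show ?case using c[OF assms(4)] by simp
  next
    case (Cons x v)
    then have "v \<in> words S" "fst x \<in> S" by (auto simp: words_def)
    then show ?case using Cons.IH assms(2) c[OF assms(4)] c[of v]
      by (auto simp: Pi_iff m_assoc)
  qed
qed

lemma word_eval_presentation_rel:
  assumes "group G" "q \<in> S \<rightarrow> carrier G" "R \<subseteq> words S" "\<And>r. r \<in> R \<Longrightarrow> word_eval G q r = \<one>\<^bsub>G\<^esub>"
    and "(u, v) \<in> presentation_rel S R"
  shows "word_eval G q u = word_eval G q v"
proof -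
  interpret group G by fact
  note cl = word_eval_closed[OF assms(1,2)]
  note ap = word_eval_append[OF assms(1,2)]
  show ?thesis using assms(5)
  proof induction
    case (cancel u v a e)
    have qa: "q a \<in> carrier G" using cancel assms(2) by auto
    define c where "c = [(a, e), (a, \<not> e)]"
    have w: "c \<in> words S" using cancel by (auto simp: words_def c_def)
    have "word_eval G q c = \<one>\<^bsub>G\<^esub>" using qa by (simp add: c_def)
    then have "word_eval G q (u @ c @ v) = word_eval G q (u @ v)"
      using ap w cl cancel by simp
    then show ?case by (simp only: c_def)
  next
    case (relator u v r)
    then have r: "r \<in> words S" using assms(3) by auto
    then show ?case using ap relator cl assms(4) by simp
  qed auto
qed

lemma word_eval_hom:
  assumes "group G" "group H" "h \<in> hom G H" "q \<in> S \<rightarrow> carrier G" "w \<in> words S"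
  shows "h (word_eval G q w) = word_eval H (\<lambda>s. h (q s)) w"
proof -
  interpret group_hom G H h using assms(1-3) by (simp add: group_hom_def group_hom_axioms_def)
  show ?thesis using assms(5)
  proof (induction w)
    case (Cons x w)
    then have w: "w \<in> words S" "fst x \<in> S" by (auto simp: words_def)
    then have "q (fst x) \<in> carrier G" "word_eval G q w \<in> carrier G"
      using assms(4) word_eval_closed[OF assms(1,4)] by auto
    then show ?case using Cons.IH[OF w(1)] by simp
  qed simp
qed

lemma word_eval_presented_group:
  assumes "R \<subseteq> words S" "w \<in> words S"
  shows "word_eval (presented_group S R) (\<lambda>s. presentation_rel S R `` {[(s, True)]}) w
    = presentation_rel S R `` {w}"
proof -
  let ?P = "presented_group S R" and ?c = "\<lambda>u. presentation_rel S R `` {u}"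
  interpret group ?P by (rule group_presented_group[OF assms(1)])
  have inc: "?c u \<in> carrier ?P" if "u \<in> words S" for u
    using that by (auto simp: presented_group_def quotient_def)
  note m = presented_group_mult[OF assms(1)]
  have one: "one ?P = ?c []" by (simp add: presented_group_def)
  show ?thesis using assms(2)
  proof (induction w)
    case Nil
    then show ?case by (simp add: one)
  next
    case (Cons x w)
    obtain a e where x: "x = (a, e)" by force
    have w: "w \<in> words S" "a \<in> S" using Cons.prems x by (auto simp: words_def)
    then have l: "[(a, b)] \<in> words S" for b by (auto simp: words_def)
    have "?c [(a, False)] \<otimes>\<^bsub>?P\<^esub> ?c [(a, True)] = ?c [(a, False), (a, True)]"
      using m[OF l l] by simp
    also have "\<dots> = ?c []"
      using presentation_rel.cancel[of "[]" S "[]" a False R] w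
      by (intro equiv_class_eq[OF equiv_presentation_rel[OF assms(1)]]) (auto simp: words_def)
    finally have "inv\<^bsub>?P\<^esub> (?c [(a, True)]) = ?c [(a, False)]"
      using inc[OF l] one by (intro inv_equality) auto
    then show ?case using Cons.IH[OF w(1)] m[OF l w(1)] by (cases e) (auto simp: x)
  qed
qed

text \<open>Pulls the presentation back through the isomorphism, so that generators become elements
  of \<open>G\<close> itself and equality of words in \<open>G\<close> becomes derivability from
  \<open>R\<close>.\<close>

lemma finitely_presented_generators:
  fixes G :: "('g, 'm) monoid_scheme"
  assumes "group G" "finitely_presented G"
  obtains S :: "nat set" and R gen where "finite S" "finite R" "R \<subseteq> words S" "gen \<in> S \<rightarrow> carrier G"
    "\<And>g. g \<in> carrier G \<Longrightarrow> \<exists>w\<in>words S. word_eval G gen w = g"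
    "\<And>u v. u \<in> words S \<Longrightarrow> v \<in> words S \<Longrightarrow>
      word_eval G gen u = word_eval G gen v \<longleftrightarrow> (u, v) \<in> presentation_rel S R"
proof -
  obtain S :: "nat set" and R where S: "finite S" "finite R" "R \<subseteq> words S"
    and "G \<cong> presented_group S R"
    using assms(2) unfolding finitely_presented_def by blast
  let ?P = "presented_group S R" and ?c = "\<lambda>u. presentation_rel S R `` {u}"
  obtain h where h: "h \<in> iso G ?P" using \<open>G \<cong> ?P\<close> by (auto simp: is_iso_def)
  have P: "group ?P" by (rule group_presented_group[OF S(3)])
  have bij: "bij_betw h (carrier G) (carrier ?P)" and hom: "h \<in> hom G ?P"
    using h by (auto simp: iso_def)
  define gen where "gen s = inv_into (carrier G) h (?c [(s, True)])" for s
  have inc: "?c u \<in> carrier ?P" if "u \<in> words S" for u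
    using that by (auto simp: presented_group_def quotient_def)
  have hg: "gen s \<in> carrier G" "h (gen s) = ?c [(s, True)]" if "s \<in> S" for s
  proof -
    have "?c [(s, True)] \<in> h ` carrier G"
      using inc[of "[(s, True)]"] that bij by (auto simp: words_def bij_betw_def)
    then show "gen s \<in> carrier G" "h (gen s) = ?c [(s, True)]"
      by (auto simp: gen_def inv_into_into f_inv_into_f)
  qed
  then have gen: "gen \<in> S \<rightarrow> carrier G" by auto
  have ev: "h (word_eval G gen w) = ?c w" if "w \<in> words S" for w
  proof -
    have "h (word_eval G gen w) = word_eval ?P (\<lambda>s. h (gen s)) w"
      by (rule word_eval_hom[OF assms(1) P hom gen that])
    also have "\<dots> = word_eval ?P (\<lambda>s. ?c [(s, True)]) w"
      using that by (induction w) (auto simp: words_def hg)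
    also have "\<dots> = ?c w" by (rule word_eval_presented_group[OF S(3) that])
    finally show ?thesis .
  qed
  note cl = word_eval_closed[OF assms(1) gen]
  have inj: "inj_on h (carrier G)" using bij by (simp add: bij_betw_def)
  show thesis
  proof
    fix g assume g: "g \<in> carrier G"
    then have "h g \<in> carrier ?P" using hom by (auto simp: hom_def)
    then obtain w where w: "w \<in> words S" "h g = ?c w" by (auto simp: presented_group_def quotient_def)
    then have "word_eval G gen w = g" using ev cl[OF w(1)] g inj by (metis inj_onD)
    then show "\<exists>w\<in>words S. word_eval G gen w = g" using w by blast
  next
    fix u v assume uv: "u \<in> words S" "v \<in> words S"
    have "word_eval G gen u = word_eval G gen v \<longleftrightarrow> ?c u = ?c v"
      using ev[OF uv(1)] ev[OF uv(2)] cl[OF uv(1)] cl[OF uv(2)] inj by (metis inj_on_def)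
    also have "\<dots> \<longleftrightarrow> (u, v) \<in> presentation_rel S R"
      by (rule eq_equiv_class_iff[OF equiv_presentation_rel[OF S(3)] uv])
    finally show "word_eval G gen u = word_eval G gen v \<longleftrightarrow> (u, v) \<in> presentation_rel S R" .
  qed (use S gen in auto)
qed

text \<open>Von Dyck's theorem. Any word for \<open>g\<close> may be used to define its image,
  because two words for \<open>g\<close> are related and related words have the same value in
  \<open>Q\<close>.\<close>

lemma presentation_induced_hom:
  assumes "group G" "group Q" "R \<subseteq> words S" "q \<in> S \<rightarrow> carrier Q"
    and gen: "gen \<in> S \<rightarrow> carrier G" "\<And>g. g \<in> carrier G \<Longrightarrow> \<exists>w\<in>words S. word_eval G gen w = g"
    and rel: "\<And>u v. u \<in> words S \<Longrightarrow> v \<in> words S \<Longrightarrow> word_eval G gen u = word_eval G gen v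
      \<Longrightarrow> (u, v) \<in> presentation_rel S R"
    and one: "\<And>r. r \<in> R \<Longrightarrow> word_eval Q q r = \<one>\<^bsub>Q\<^esub>"
  obtains \<rho> where "\<rho> \<in> hom G Q" "\<And>w. w \<in> words S \<Longrightarrow> \<rho> (word_eval G gen w) = word_eval Q q w"
proof -
  define w where "w g = (SOME w. w \<in> words S \<and> word_eval G gen w = g)" for g
  have w: "w g \<in> words S" "word_eval G gen (w g) = g" if "g \<in> carrier G" for g
    using someI_ex[of "\<lambda>w. w \<in> words S \<and> word_eval G gen w = g"] gen(2)[OF that]
    by (auto simp: w_def)
  define \<rho> where "\<rho> g = word_eval Q q (w g)" for g
  note cl = word_eval_closed[OF assms(1) gen(1)]
  have ev: "\<rho> (word_eval G gen u) = word_eval Q q u" if "u \<in> words S" for u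
  proof -
    have "(w (word_eval G gen u), u) \<in> presentation_rel S R"
      using w[OF cl[OF that]] that rel by blast
    then show ?thesis unfolding \<rho>_def
      using word_eval_presentation_rel[OF assms(2,4,3) one] by blast
  qed
  have "\<rho> (g \<otimes>\<^bsub>G\<^esub> h) = \<rho> g \<otimes>\<^bsub>Q\<^esub> \<rho> h" if "g \<in> carrier G" "h \<in> carrier G" for g h
  proof -
    have gh: "w g @ w h \<in> words S" using w that by simp
    have "\<rho> (g \<otimes>\<^bsub>G\<^esub> h) = \<rho> (word_eval G gen (w g @ w h))"
      using word_eval_append[OF assms(1) gen(1), of "w g" "w h"] w that by simp
    also have "\<dots> = word_eval Q q (w g) \<otimes>\<^bsub>Q\<^esub> word_eval Q q (w h)"
      using ev[OF gh] word_eval_append[OF assms(2,4), of "w g" "w h"] w that by simp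
    finally show ?thesis by (simp add: \<rho>_def)
  qed
  moreover have "\<rho> g \<in> carrier Q" if "g \<in> carrier G" for g
    unfolding \<rho>_def using word_eval_closed[OF assms(2,4)] w that by simp
  ultimately have "\<rho> \<in> hom G Q" by (auto simp: hom_def)
  then show thesis using ev that by blast
qed

section \<open>The group of increasing bijections of the line\<close>

definition incr_group :: "(real \<Rightarrow> real) monoid" where
  "incr_group = \<lparr>carrier = {f. strict_mono f \<and> surj f}, mult = (\<circ>), one = id\<rparr>"

lemma strict_mono_inv_surj:
  fixes f :: "real \<Rightarrow> real"
  assumes "strict_mono f" "surj f"
  shows "strict_mono (inv_into UNIV f)" "surj (inv_into UNIV f)"
proof -
  have i: "inj f" using assms(1) by (rule strict_mono_imp_inj_on)
  show "strict_mono (inv_into UNIV f)"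
    using assms by (intro strict_monoI) (metis i strict_mono_less surj_f_inv_f)
  show "surj (inv_into UNIV f)" using i inj_imp_surj_inv by blast
qed

lemma group_incr_group: "group incr_group"
proof (rule groupI)
  fix f assume "f \<in> carrier incr_group"
  then have f: "strict_mono f" "surj f" by (auto simp: incr_group_def)
  then have "inv_into UNIV f \<circ> f = id" using strict_mono_imp_inj_on[OF f(1)] by (simp add: inv_o_cancel)
  then show "\<exists>g\<in>carrier incr_group. g \<otimes>\<^bsub>incr_group\<^esub> f = \<one>\<^bsub>incr_group\<^esub>"
    using strict_mono_inv_surj[OF f] by (intro bexI[of _ "inv_into UNIV f"]) (auto simp: incr_group_def)
next
  fix f g assume "f \<in> carrier incr_group" "g \<in> carrier incr_group"
  then show "f \<otimes>\<^bsub>incr_group\<^esub> g \<in> carrier incr_group"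
    unfolding incr_group_def monoid.simps partial_object.simps mem_Collect_eq
    using comp_surj strict_mono_o by blast
qed (auto simp: incr_group_def o_assoc strict_mono_def)

lemma inv_incr_group:
  assumes "f \<in> carrier incr_group" "g \<in> carrier incr_group" "g \<circ> f = id"
  shows "inv\<^bsub>incr_group\<^esub> f = g"
  using assms group.inv_equality[OF group_incr_group, of g f] by (auto simp: incr_group_def)

section \<open>Lifts to the flow lines\<close>

text \<open>Reads \<open>g\<close> in the parametrisation of the flow line through \<open>x\<close>.
  The value is unique as soon as no point of \<open>X\<close> is periodic, since then the class of
  \<open>(x,t)\<close> determines \<open>t\<close>.\<close>

definition lift :: "'x topology \<Rightarrow> ('x \<Rightarrow> 'x) \<Rightarrow> (('x \<times> real) set \<Rightarrow> ('x \<times> real) set) \<Rightarrow> 'x \<Rightarrow> real \<Rightarrow> real" where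
  "lift X \<phi> g x t = (THE s. g (susp_class X \<phi> (x, t)) = susp_class X \<phi> (x, s))"

locale free_stone_system =
  fixes X :: "'x topology" and \<phi> :: "'x \<Rightarrow> 'x"
  assumes stone: "stone_system X \<phi>"
    and free: "\<And>x n. x \<in> topspace X \<Longrightarrow> zpow X \<phi> n x = x \<Longrightarrow> n = 0"
begin

abbreviation "cls \<equiv> susp_class X \<phi>"
abbreviation "Y \<equiv> topspace (suspension X \<phi>)"
abbreviation "TG \<equiv> T_group X \<phi>"

lemma cls_inj: "x \<in> topspace X \<Longrightarrow> cls (x, t) = cls (x, s) \<longleftrightarrow> t = s"
  using susp_class_eq_iff[OF stone, of x x t s] free[of x] by (metis diff_zero of_int_0)

lemma cls_zpow: "x \<in> topspace X \<Longrightarrow> cls (zpow X \<phi> n x, t - of_int n) = cls (x, t)"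
  using susp_class_eq_iff[OF stone, of x "zpow X \<phi> n x" t "t - of_int n"] zpow_in[OF stone, of x n]
  by metis

lemma lift_eqI: "x \<in> topspace X \<Longrightarrow> g (cls (x, t)) = cls (x, s) \<Longrightarrow> lift X \<phi> g x t = s"
  unfolding lift_def by (rule the_equality) (auto simp: cls_inj)

text \<open>The chart at the class of \<open>(x,t)\<close> may be based at another representative
  \<open>(x',t')\<close>. Pulling its clopen set back along a power of \<phi> and conjugating
  \<open>f\<close> by the corresponding integer translation moves the chart to
  \<open>(x,t)\<close>.\<close>

lemma T_local_lift:
  assumes "T_local X \<phi> g (cls (x, t))" "x \<in> topspace X"
  shows "\<exists>C a b f. openin X C \<and> x \<in> C \<and> a < t \<and> t < b \<and> continuous_on {a<..<b} f \<and>
    (\<forall>w\<in>C. \<forall>s\<in>{a<..<b}. g (cls (w, s)) = cls (w, f s))"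
proof -
  obtain C J f where *: "dyadic_chart X \<phi> C J" "cls (x, t) \<in> domain_of X \<phi> C J"
      "dyadic_PL_homeo f J (f ` J)"
      "\<And>x t. x\<in>C \<Longrightarrow> t\<in>J \<Longrightarrow> g (cls (x, t)) = cls (x, f t)"
    using assms(1) unfolding T_local_def by blast
  obtain a b where J: "J = {a<..<b}" using *(1) by (auto simp: dyadic_chart_def chart_def)
  obtain x' t' where x': "x' \<in> C" "t' \<in> J" "cls (x, t) = cls (x', t')"
    using *(2) by (auto simp: domain_of_def)
  have op: "openin X C" using *(1) by (auto simp: dyadic_chart_def chart_def)
  then have CX: "C \<subseteq> topspace X" by (rule openin_subset)
  have "x' \<in> topspace X" using x' CX by blast
  then obtain n :: int where n: "x' = zpow X \<phi> n x" "t' = t - of_int n"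
    using susp_class_eq_iff[OF stone assms(2), of x' t t'] x'(3) by blast
  define D where "D = {z \<in> topspace X. zpow X \<phi> n z \<in> C}"
  have D: "openin X D" "x \<in> D" unfolding D_def
    using openin_continuous_map_preimage[OF continuous_zpow[OF stone, of n] op] x'(1) n(1) assms(2)
    by auto
  define F where "F s = f (s - of_int n) + of_int n" for s
  have "continuous_on J f" using *(3) by (auto simp: dyadic_PL_homeo_def homeomorphism_def)
  then have "continuous_on {a + n<..<b + n} F" unfolding F_def J
    by (intro continuous_on_add continuous_on_const continuous_on_compose2[of "{a<..<b}" f _ "\<lambda>s. s - of_int n"])
      (auto intro!: continuous_intros)
  moreover have "g (cls (w, s)) = cls (w, F s)" if "w \<in> D" "s \<in> {a + n<..<b + n}" for w s
  proof -
    have w: "w \<in> topspace X" "zpow X \<phi> n w \<in> C" "s - of_int n \<in> J" using that by (auto simp: D_def J)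
    have "g (cls (w, s)) = g (cls (zpow X \<phi> n w, s - of_int n))" by (simp only: cls_zpow[OF w(1)])
    also have "\<dots> = cls (zpow X \<phi> n w, F s - of_int n)" using *(4)[OF w(2,3)] by (simp add: F_def)
    also have "\<dots> = cls (w, F s)" by (rule cls_zpow[OF w(1)])
    finally show ?thesis .
  qed
  moreover have "a + n < t" "t < b + n" using x'(2) n(2) J by auto
  ultimately show ?thesis using D by metis
qed

lemma T_carrier_local: "g \<in> carrier TG \<Longrightarrow> x \<in> topspace X \<Longrightarrow> T_local X \<phi> g (cls (x, t))"
  using T_carrier_iff[OF stone, of g] susp_in[OF stone, of x t] unfolding T_group_def by auto

lemma lift_locally_const:
  assumes "g \<in> carrier TG" "x \<in> topspace X"
  shows "\<exists>C a b f. openin X C \<and> x \<in> C \<and> a < t \<and> t < b \<and> continuous_on {a<..<b} f \<and>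
    (\<forall>w\<in>C. \<forall>s\<in>{a<..<b}. lift X \<phi> g w s = f s)"
proof -
  obtain C a b f where *: "openin X C" "x \<in> C" "a < t" "t < b" "continuous_on {a<..<b} f"
    "\<forall>w\<in>C. \<forall>s\<in>{a<..<b}. g (cls (w, s)) = cls (w, f s)"
    using T_local_lift[OF T_carrier_local[OF assms] assms(2), of t] by blast
  have "lift X \<phi> g w s = f s" if "w \<in> C" "s \<in> {a<..<b}" for w s
    using lift_eqI[of w g s "f s"] openin_subset[OF *(1)] *(6) that by blast
  then show ?thesis using *(1-5) by metis
qed

lemma lift:
  assumes "g \<in> carrier TG" "x \<in> topspace X"
  shows "g (cls (x, t)) = cls (x, lift X \<phi> g x t)"
proof -
  obtain C a b f where *: "x \<in> C" "a < t" "t < b"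
    "\<forall>w\<in>C. \<forall>s\<in>{a<..<b}. g (cls (w, s)) = cls (w, f s)"
    using T_local_lift[OF T_carrier_local[OF assms] assms(2), of t] by blast
  then have "g (cls (x, t)) = cls (x, f t)" by simp
  then show ?thesis using lift_eqI[of x g t "f t"] assms(2) by simp
qed

lemma lift_zpow:
  assumes "g \<in> carrier TG" "x \<in> topspace X"
  shows "lift X \<phi> g (zpow X \<phi> n x) (t - of_int n) = lift X \<phi> g x t - of_int n"
proof (rule lift_eqI)
  have "g (cls (zpow X \<phi> n x, t - of_int n)) = cls (x, lift X \<phi> g x t)"
    using lift[OF assms] cls_zpow[OF assms(2)] by simp
  then show "g (cls (zpow X \<phi> n x, t - of_int n)) = cls (zpow X \<phi> n x, lift X \<phi> g x t - of_int n)"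
    using cls_zpow[OF assms(2)] by simp
qed (rule zpow_in[OF stone assms(2)])

lemma T_carrier_Bij: "carrier TG \<subseteq> Bij Y"
  using subgroup.subset[OF subgroup_T_carrier[OF stone]] by (simp add: T_group_def BijGroup_def)

lemma T_mult: "g \<in> carrier TG \<Longrightarrow> h \<in> carrier TG \<Longrightarrow> g \<otimes>\<^bsub>TG\<^esub> h = compose Y g h"
  using T_carrier_Bij by (auto simp: T_group_def BijGroup_def)

lemma cls_in: "x \<in> topspace X \<Longrightarrow> cls (x, t) \<in> Y"
  by (rule susp_in[OF stone])

lemma group_TG: "group TG" by (rule group_T_group[OF stone])

lemma lift_mult:
  assumes "g \<in> carrier TG" "h \<in> carrier TG" "x \<in> topspace X"
  shows "lift X \<phi> (g \<otimes>\<^bsub>TG\<^esub> h) x t = lift X \<phi> g x (lift X \<phi> h x t)"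
  by (rule lift_eqI[OF assms(3)])
    (simp add: T_mult[OF assms(1,2)] compose_eq cls_in assms lift)

lemma lift_one:
  assumes "x \<in> topspace X"
  shows "lift X \<phi> \<one>\<^bsub>TG\<^esub> x t = t"
  by (rule lift_eqI[OF assms]) (simp add: T_group_def BijGroup_def cls_in assms)

lemma lift_inv:
  assumes "g \<in> carrier TG" "x \<in> topspace X"
  shows "lift X \<phi> (inv\<^bsub>TG\<^esub> g) x (lift X \<phi> g x t) = t" "lift X \<phi> g x (lift X \<phi> (inv\<^bsub>TG\<^esub> g) x t) = t"
proof -
  interpret group TG by (rule group_TG)
  show "lift X \<phi> (inv\<^bsub>TG\<^esub> g) x (lift X \<phi> g x t) = t" "lift X \<phi> g x (lift X \<phi> (inv\<^bsub>TG\<^esub> g) x t) = t"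
    using lift_mult[of "inv\<^bsub>TG\<^esub> g" g x t] lift_mult[of g "inv\<^bsub>TG\<^esub> g" x t] lift_one[of x t] assms by auto
qed

lemma lift_ext:
  assumes "g \<in> carrier TG" "h \<in> carrier TG"
    and "\<And>x t. x \<in> topspace X \<Longrightarrow> lift X \<phi> g x t = lift X \<phi> h x t"
  shows "g = h"
proof (rule extensionalityI)
  show "g \<in> extensional Y" "h \<in> extensional Y" using assms T_carrier_Bij by (auto simp: Bij_def)
  fix y assume "y \<in> Y"
  then show "g y = h y" using lift[OF assms(1)] lift[OF assms(2)] assms(3)
    by (auto simp: topspace_suspension)
qed

lemma lift_continuous:
  assumes "g \<in> carrier TG" "x \<in> topspace X"
  shows "continuous_on UNIV (lift X \<phi> g x)"
  unfolding continuous_on_eq_continuous_at[OF open_UNIV]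
proof
  fix t
  obtain C a b f where *: "x \<in> C" "a < t" "t < b" "continuous_on {a<..<b} f"
    "\<forall>w\<in>C. \<forall>s\<in>{a<..<b}. lift X \<phi> g w s = f s"
    using lift_locally_const[OF assms, of t] by blast
  have "continuous_on {a<..<b} (lift X \<phi> g x)"
    by (rule continuous_on_eq[OF *(4)]) (use * in auto)
  then show "isCont (lift X \<phi> g x) t"
    using *(2,3) by (simp add: continuous_on_eq_continuous_at)
qed

text \<open>Finitely many of the local intervals cover \<open>{0..1}\<close>, and the neighbourhoods
  of \<open>x\<close> belonging to them have an open intersection.\<close>

lemma lift_nbhd:
  assumes "g \<in> carrier TG" "x \<in> topspace X"
  shows "\<exists>C. openin X C \<and> x \<in> C \<and> (\<forall>w\<in>C. \<forall>t\<in>{0..1}. lift X \<phi> g w t = lift X \<phi> g x t)"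
proof -
  have "\<exists>C V. openin X C \<and> x \<in> C \<and> open V \<and> t \<in> V \<and> (\<forall>w\<in>C. \<forall>s\<in>V. lift X \<phi> g w s = lift X \<phi> g x s)" for t
  proof -
    obtain C a b f where *: "openin X C" "x \<in> C" "a < t" "t < b"
      "\<forall>w\<in>C. \<forall>s\<in>{a<..<b}. lift X \<phi> g w s = f s"
      using lift_locally_const[OF assms, of t] by blast
    have "lift X \<phi> g w s = lift X \<phi> g x s" if "w \<in> C" "s \<in> {a<..<b}" for w s
      using *(2,5) that by metis
    moreover have "t \<in> {a<..<b}" "open {a<..<b}" using * by auto
    ultimately show ?thesis using *(1,2) by blast
  qed
  then have "\<forall>t. \<exists>C V. openin X C \<and> x \<in> C \<and> open V \<and> t \<in> V \<and> (\<forall>w\<in>C. \<forall>s\<in>V. lift X \<phi> g w s = lift X \<phi> g x s)"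
    by blast
  then obtain C V where "\<forall>t. openin X (C t) \<and> x \<in> C t \<and> open (V t) \<and> t \<in> V t \<and>
      (\<forall>w\<in>C t. \<forall>s\<in>V t. lift X \<phi> g w s = lift X \<phi> g x s)"
    unfolding choice_iff by blast
  then have CV: "\<And>t. openin X (C t)" "\<And>t. x \<in> C t" "\<And>t::real. open (V t)" "\<And>t. t \<in> V t"
    "\<And>t w s. w \<in> C t \<Longrightarrow> s \<in> V t \<Longrightarrow> lift X \<phi> g w s = lift X \<phi> g x s" by blast+
  have cov: "{0..1::real} \<subseteq> (\<Union>t\<in>UNIV. V t)" using CV(4) by blast
  obtain F where F: "finite F" "{0..1::real} \<subseteq> (\<Union>t\<in>F. V t)"
    using compactE_image[OF compact_Icc[of "0::real" 1] CV(3) cov] by metis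
  have ne: "F \<noteq> {}" using F(2) by auto
  have "openin X (\<Inter>t\<in>F. C t)" using CV ne F by (intro openin_Inter) auto
  moreover have "lift X \<phi> g w t = lift X \<phi> g x t" if "w \<in> (\<Inter>t\<in>F. C t)" "t \<in> {0..1}" for w t
    using CV(5) F(2) that by blast
  moreover have "x \<in> (\<Inter>t\<in>F. C t)" using CV(2) by blast
  ultimately show ?thesis by blast
qed

text \<open>Equivariance moves every time into \<open>{0..1}\<close>; there, compactness of
  \<open>X\<close> leaves only finitely many continuous functions on a compact interval.\<close>

lemma lift_bounded:
  assumes "g \<in> carrier TG"
  shows "\<exists>B. \<forall>x\<in>topspace X. \<forall>t. \<bar>lift X \<phi> g x t - t\<bar> \<le> B"
proof -
  have "\<forall>x\<in>topspace X. \<exists>C. openin X C \<and> x \<in> C \<and> (\<forall>w\<in>C. \<forall>t\<in>{0..1}. lift X \<phi> g w t = lift X \<phi> g x t)"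
    using lift_nbhd[OF assms] by blast
  then obtain C where "\<forall>x\<in>topspace X. openin X (C x) \<and> x \<in> C x \<and>
      (\<forall>w\<in>C x. \<forall>t\<in>{0..1}. lift X \<phi> g w t = lift X \<phi> g x t)"
    unfolding bchoice_iff by blast
  then have C: "\<And>x. x \<in> topspace X \<Longrightarrow> openin X (C x)" "\<And>x. x \<in> topspace X \<Longrightarrow> x \<in> C x"
    "\<And>x w t. x \<in> topspace X \<Longrightarrow> w \<in> C x \<Longrightarrow> t \<in> {0..1} \<Longrightarrow> lift X \<phi> g w t = lift X \<phi> g x t"
    by blast+
  have "\<exists>b. \<forall>t\<in>{0..1}. \<bar>lift X \<phi> g x t - t\<bar> \<le> b" if "x \<in> topspace X" for x
  proof -
    have "compact ((\<lambda>t. lift X \<phi> g x t - t) ` {0..1})"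
      using continuous_on_subset[OF lift_continuous[OF assms that]]
      by (intro compact_continuous_image continuous_intros) auto
    then obtain b where "\<forall>u\<in>(\<lambda>t. lift X \<phi> g x t - t) ` {0..1}. \<bar>u\<bar> \<le> b"
      using compact_imp_bounded bounded_real by blast
    then show ?thesis by blast
  qed
  then have "\<forall>x\<in>topspace X. \<exists>b. \<forall>t\<in>{0..1}. \<bar>lift X \<phi> g x t - t\<bar> \<le> b" by blast
  then obtain b where b: "\<forall>x\<in>topspace X. \<forall>t\<in>{0..1}. \<bar>lift X \<phi> g x t - t\<bar> \<le> b x"
    unfolding bchoice_iff by blast
  have "compact_space X" using stone by (simp add: stone_system_def)
  moreover have "\<And>U. U \<in> C ` topspace X \<Longrightarrow> openin X U" "topspace X \<subseteq> \<Union> (C ` topspace X)"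
    using C(1,2) by blast+
  ultimately obtain F where F: "finite F" "F \<subseteq> C ` topspace X" "topspace X \<subseteq> \<Union>F"
    unfolding compact_space_alt by meson
  obtain P where P: "P \<subseteq> topspace X" "finite P" "F = C ` P"
    using finite_subset_image[OF F(1,2)] by blast
  define B where "B = Max (insert 0 (b ` P))"
  have bB: "b p \<le> B" if "p \<in> P" for p unfolding B_def using P(2) that by simp
  have "\<bar>lift X \<phi> g x t - t\<bar> \<le> B" if x: "x \<in> topspace X" for x t
  proof -
    let ?n = "\<lfloor>t\<rfloor>" and ?w = "zpow X \<phi> \<lfloor>t\<rfloor> x"
    have w: "?w \<in> topspace X" by (rule zpow_in[OF stone x])
    then obtain p where p: "p \<in> P" "?w \<in> C p" using F(3) P(3) by blast
    have pX: "p \<in> topspace X" using p P by blast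
    have t: "t - of_int ?n \<in> {0..1}" unfolding atLeastAtMost_iff by linarith
    have "lift X \<phi> g x t - t = lift X \<phi> g ?w (t - of_int ?n) - (t - of_int ?n)"
      using lift_zpow[OF assms x] by simp
    also have "\<dots> = lift X \<phi> g p (t - of_int ?n) - (t - of_int ?n)"
      using C(3)[OF pX p(2) t] by simp
    finally have "\<bar>lift X \<phi> g x t - t\<bar> \<le> b p" using b pX t by metis
    then show ?thesis using bB[OF p(1)] by simp
  qed
  then show ?thesis by blast
qed

text \<open>A continuous injection of the line is monotone, and a decreasing one cannot stay at
  bounded distance from the identity.\<close>

lemma lift_strict_mono:
  assumes "g \<in> carrier TG" "x \<in> topspace X"
  shows "strict_mono (lift X \<phi> g x)"
proof -
  let ?f = "lift X \<phi> g x"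
  have "inj ?f" using lift_inv(1)[OF assms] by (metis injI)
  then have "strict_mono ?f \<or> strict_antimono_on UNIV ?f"
    using injective_eq_monotone_map[of UNIV ?f] lift_continuous[OF assms] by auto
  moreover obtain B where B: "\<And>t. \<bar>?f t - t\<bar> \<le> B" using lift_bounded[OF assms(1)] assms(2) by blast
  have "\<not> strict_antimono_on UNIV ?f"
  proof
    assume "strict_antimono_on UNIV ?f"
    moreover have "0 \<le> B" using B[of 0] by linarith
    ultimately have "?f (2 * B + 1) < ?f 0" unfolding monotone_on_def by simp
    then show False using B[of 0] B[of "2 * B + 1"] by linarith
  qed
  ultimately show ?thesis by blast
qed

end

section \<open>Local actions on the line\<close>

lemma zpow_shift:
  assumes fin: "finite A" and sub: "subshift A X" and x: "x \<in> X"
  shows "zpow (subshift_top A X) shift n x = (\<lambda>k. x (k + n))"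
proof -
  let ?X = "subshift_top A X"
  note stone = subshift_stone_system[OF fin sub]
  note S = zpow_Suc[OF stone, unfolded topspace_subshift_top[OF sub], OF x]
  show ?thesis
  proof (induction n rule: int_induct[where k = 0])
    case base
    show ?case by (simp add: zpow_0[OF stone])
  next
    case (step1 i)
    show ?case unfolding S step1(2) by (auto simp: shift_def algebra_simps)
  next
    case (step2 i)
    have e: "shift (zpow ?X shift (i - 1) x) = zpow ?X shift i x" using S[of "i - 1"] by simp
    have "zpow ?X shift (i - 1) x k = x (k + (i - 1))" for k
    proof -
      have "zpow ?X shift (i - 1) x k = shift (zpow ?X shift (i - 1) x) (k - 1)" by (simp add: shift_def)
      then show ?thesis unfolding e step2(2) by (simp add: algebra_simps)
    qed
    then show ?case by blast
  qed
qed

text \<open>A basic open set of the product restricts finitely many coordinates only, so a large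
  symmetric window around 0 sees all of them.\<close>

lemma open_contains_cylinder_full_shift:
  assumes "openin (full_shift A) T" "x \<in> T"
  shows "\<exists>N. \<forall>y\<in>UNIV \<rightarrow> A. (\<forall>k::int. \<bar>k\<bar> \<le> N \<longrightarrow> y k = x k) \<longrightarrow> y \<in> T"
proof -
  obtain U where U: "finite {i. U i \<noteq> topspace (discrete_topology A)}" "x \<in> Pi\<^sub>E UNIV U" "Pi\<^sub>E UNIV U \<subseteq> T"
    using assms unfolding full_shift_def openin_product_topology_alt by fastforce
  let ?I = "{i. U i \<noteq> A}"
  have fin: "finite ?I" using U(1) by simp
  define N where "N = Max (insert 0 (abs ` ?I))"
  have N: "\<bar>i\<bar> \<le> N" if "i \<in> ?I" for i unfolding N_def using fin that by auto
  have "y \<in> T" if y: "y \<in> UNIV \<rightarrow> A" "\<forall>k::int. \<bar>k\<bar> \<le> N \<longrightarrow> y k = x k" for y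
  proof -
    have "y i \<in> U i" for i
    proof (cases "i \<in> ?I")
      case True
      then show ?thesis using N[OF True] y(2) U(2) by auto
    next
      case False
      then show ?thesis using y(1) by auto
    qed
    then show ?thesis using U(3) by auto
  qed
  then show ?thesis by blast
qed

locale free_subshift =
  fixes A :: "'a set" and X :: "(int \<Rightarrow> 'a) set"
  assumes finA: "finite A" and sub: "subshift A X"
    and free_shift: "\<And>x n. x \<in> X \<Longrightarrow> zpow (subshift_top A X) shift n x = x \<Longrightarrow> n = 0"

sublocale free_subshift \<subseteq> free_stone_system "subshift_top A X" shift
  using subshift_stone_system[OF finA sub] free_shift topspace_subshift_top[OF sub]
  by unfold_locales auto

context free_subshift
begin

abbreviation "\<X> \<equiv> subshift_top A X"

lemma topX [simp]: "topspace \<X> = X" by (rule topspace_subshift_top[OF sub])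

lemma clopen_coordinate: "openin \<X> {x \<in> X. x k \<in> B}" "closedin \<X> {x \<in> X. x k \<in> B}"
proof -
  have "continuous_map (full_shift A) (discrete_topology A) (\<lambda>x. x k)"
    unfolding full_shift_def by (rule continuous_map_product_projection) simp
  then have c: "continuous_map \<X> (discrete_topology A) (\<lambda>x. x k)"
    unfolding subshift_top_def by (rule continuous_map_from_subtopology)
  have m: "x k \<in> A" if "x \<in> X" for x using continuous_map_image_subset_topspace[OF c] that by auto
  have "openin \<X> {x \<in> topspace \<X>. x k \<in> B \<inter> A}" "closedin \<X> {x \<in> topspace \<X>. x k \<in> B \<inter> A}"
    by (rule openin_continuous_map_preimage[OF c], simp)
      (rule closedin_continuous_map_preimage[OF c], simp)
  moreover have "{x \<in> topspace \<X>. x k \<in> B \<inter> A} = {x \<in> X. x k \<in> B}" using m by auto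
  ultimately show "openin \<X> {x \<in> X. x k \<in> B}" "closedin \<X> {x \<in> X. x k \<in> B}" by simp_all
qed

lemma coordinate_in: "x \<in> X \<Longrightarrow> x k \<in> A"
  using sub topspace_full_shift[of A] by (auto simp: subshift_def closedin_def)

lemma openin_cylinder: "openin \<X> {y \<in> X. \<forall>k::int. \<bar>k\<bar> \<le> N \<longrightarrow> y k = x k}"
proof (cases "N < 0")
  case True
  then have "{y \<in> X. \<forall>k::int. \<bar>k\<bar> \<le> N \<longrightarrow> y k = x k} = topspace \<X>" by auto
  then show ?thesis by (simp only: openin_topspace)
next
  case False
  have "{y \<in> X. \<forall>k::int. \<bar>k\<bar> \<le> N \<longrightarrow> y k = x k} = (\<Inter>k\<in>{-N..N}. {y \<in> X. y k \<in> {x k}})"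
  proof (intro equalityI subsetI)
    fix y assume y: "y \<in> (\<Inter>k\<in>{-N..N}. {y \<in> X. y k \<in> {x k}})"
    then have "y \<in> {y \<in> X. y k \<in> {x k}}" if "\<bar>k\<bar> \<le> N" for k
      by (rule INT_D) (use that in auto)
    \<comment> \<open>Membership in \<open>X\<close> is read off from the index 0, which occurs
      because \<open>N\<close> is not negative.\<close>
    from this[of 0] this show "y \<in> {y \<in> X. \<forall>k::int. \<bar>k\<bar> \<le> N \<longrightarrow> y k = x k}" using False by auto
  qed auto
  also have "openin \<X> \<dots>"
  proof (intro openin_Inter)
    fix C assume "C \<in> (\<lambda>k. {y \<in> X. y k \<in> {x k}}) ` {- N..N}"
    then obtain k where "C = {y \<in> X. y k \<in> {x k}}" by blast
    then show "openin \<X> C" by (simp only: clopen_coordinate)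
  qed (use False in auto)
  finally show ?thesis .
qed

lemma open_contains_cylinder:
  assumes "openin \<X> C" "x \<in> C"
  shows "\<exists>N. \<forall>y\<in>X. (\<forall>k::int. \<bar>k\<bar> \<le> N \<longrightarrow> y k = x k) \<longrightarrow> y \<in> C"
proof -
  obtain T where T: "openin (full_shift A) T" "C = T \<inter> X"
    using assms(1) unfolding subshift_top_def openin_subtopology by blast
  then obtain N where "\<forall>y\<in>UNIV \<rightarrow> A. (\<forall>k::int. \<bar>k\<bar> \<le> N \<longrightarrow> y k = x k) \<longrightarrow> y \<in> T"
    using open_contains_cylinder_full_shift[OF T(1)] assms(2) by blast
  then show ?thesis using coordinate_in T(2) by (intro exI[of _ N]) auto
qed

text \<open>The neighbourhood from \<open>lift_nbhd\<close> depends on \<open>x\<close>; finitely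
  many cylinders cover \<open>X\<close>, and the largest of their radii serves all points.\<close>

lemma lift_window:
  assumes "g \<in> carrier TG"
  shows "\<exists>N. \<forall>x\<in>X. \<forall>y\<in>X. (\<forall>k::int. \<bar>k\<bar> \<le> N \<longrightarrow> y k = x k) \<longrightarrow> (\<forall>t\<in>{0..1}. lift \<X> shift g y t = lift \<X> shift g x t)"
proof -
  have "\<forall>x\<in>X. \<exists>N. \<forall>y\<in>X. (\<forall>k::int. \<bar>k\<bar> \<le> N \<longrightarrow> y k = x k) \<longrightarrow> (\<forall>t\<in>{0..1}. lift \<X> shift g y t = lift \<X> shift g x t)"
  proof
    fix x assume "x \<in> X"
    then obtain C where C: "openin \<X> C" "x \<in> C" "\<forall>w\<in>C. \<forall>t\<in>{0..1}. lift \<X> shift g w t = lift \<X> shift g x t"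
      using lift_nbhd[OF assms, of x] by auto
    then show "\<exists>N. \<forall>y\<in>X. (\<forall>k::int. \<bar>k\<bar> \<le> N \<longrightarrow> y k = x k) \<longrightarrow> (\<forall>t\<in>{0..1}. lift \<X> shift g y t = lift \<X> shift g x t)"
      using open_contains_cylinder[OF C(1,2)] by meson
  qed
  then obtain N where N: "\<forall>x\<in>X. \<forall>y\<in>X. (\<forall>k::int. \<bar>k\<bar> \<le> N x \<longrightarrow> y k = x k) \<longrightarrow>
      (\<forall>t\<in>{0..1}. lift \<X> shift g y t = lift \<X> shift g x t)"
    unfolding bchoice_iff by blast
  define Cy where "Cy x = {y \<in> X. \<forall>k::int. \<bar>k\<bar> \<le> N x \<longrightarrow> y k = x k}" for x
  have "compact_space \<X>" using stone by (simp add: stone_system_def)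
  moreover have "\<And>U. U \<in> Cy ` X \<Longrightarrow> openin \<X> U" using openin_cylinder by (auto simp: Cy_def)
  moreover have "topspace \<X> \<subseteq> \<Union> (Cy ` X)" by (auto simp: Cy_def)
  ultimately obtain F where F: "finite F" "F \<subseteq> Cy ` X" "topspace \<X> \<subseteq> \<Union>F"
    unfolding compact_space_alt by meson
  obtain P where P: "P \<subseteq> X" "finite P" "F = Cy ` P"
    using finite_subset_image[OF F(1,2)] by blast
  define M where "M = Max (insert 0 (N ` P))"
  have M: "N p \<le> M" if "p \<in> P" for p unfolding M_def using P(2) that by auto
  have "lift \<X> shift g y t = lift \<X> shift g x t"
    if xy: "x \<in> X" "y \<in> X" "\<forall>k::int. \<bar>k\<bar> \<le> M \<longrightarrow> y k = x k" "t \<in> {0..1}" for x y t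
  proof -
    obtain p where p: "p \<in> P" "x \<in> Cy p" using F(3) P(3) xy(1) by auto
    have pX: "p \<in> X" using p P by blast
    have x: "\<forall>k::int. \<bar>k\<bar> \<le> N p \<longrightarrow> x k = p k" using p by (auto simp: Cy_def)
    then have y: "\<forall>k::int. \<bar>k\<bar> \<le> N p \<longrightarrow> y k = p k" using xy(3) M[OF p(1)] by auto
    have "lift \<X> shift g x t = lift \<X> shift g p t" "lift \<X> shift g y t = lift \<X> shift g p t"
      using N pX xy x y by blast+
    then show ?thesis by simp
  qed
  then show ?thesis by blast
qed

section \<open>Actions on the line over a sequence whose windows occur in the subshift\<close>

definition admissible :: "int \<Rightarrow> (int \<Rightarrow> 'a) \<Rightarrow> bool" where
  "admissible M z \<longleftrightarrow> (\<forall>m. \<exists>x\<in>X. \<forall>k. \<bar>k\<bar> \<le> M \<longrightarrow> x k = z (k + m))"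

text \<open>The sequence \<open>z\<close> need not lie in \<open>X\<close>, so there is no lift
  along \<open>z\<close> itself. Over the cell at \<open>m\<close> the comparison is with any point
  of \<open>X\<close> that agrees with \<open>z\<close> around \<open>m\<close>.\<close>

definition acts_along where
  "acts_along M z Pr \<rho> \<longleftrightarrow> (\<forall>g\<in>Pr. \<forall>x\<in>X. \<forall>m t.
    (\<forall>k. \<bar>k\<bar> \<le> M \<longrightarrow> x k = z (k + m)) \<longrightarrow> t \<in> {0..1} \<longrightarrow>
      \<rho> g (t + of_int m) = lift \<X> shift g x t + of_int m)"

text \<open>The generators act on the line over \<open>z\<close> by their local rules. A bounded
  number of letters moves a time by a bounded amount, so for large \<open>M\<close> the evaluation
  of a relator, or of a word for an element of \<open>Pr\<close>, stays where a single point of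
  \<open>X\<close> imitates \<open>z\<close>.\<close>

lemma finitely_presented_actions:
  assumes "finitely_presented TG" "finite Pr" "Pr \<subseteq> carrier TG"
  shows "\<exists>M\<ge>0. \<forall>z. admissible M z \<longrightarrow> (\<exists>\<rho>\<in>hom TG incr_group. acts_along M z Pr \<rho>)"
proof -
  obtain S :: "nat set" and R gen where S: "finite S" "finite R" "R \<subseteq> words S" "gen \<in> S \<rightarrow> carrier TG"
    and surj: "\<And>g. g \<in> carrier TG \<Longrightarrow> \<exists>w\<in>words S. word_eval TG gen w = g"
    and rel: "\<And>u v. u \<in> words S \<Longrightarrow> v \<in> words S \<Longrightarrow>
      word_eval TG gen u = word_eval TG gen v \<longleftrightarrow> (u, v) \<in> presentation_rel S R"
    using finitely_presented_generators[OF group_TG assms(1)] by blast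
  have rel1: "(u, v) \<in> presentation_rel S R"
    if "u \<in> words S" "v \<in> words S" "word_eval TG gen u = word_eval TG gen v" for u v
    using rel that by blast
  interpret G: group TG by (rule group_TG)
  have nil: "[] \<in> words S" by (simp add: words_def)
  have relator: "word_eval TG gen r = \<one>\<^bsub>TG\<^esub>" if "r \<in> R" for r
    using rel[of r "[]"] presentation_rel.relator[of "[]" S "[]" r R] S(3) nil that by auto
  have "\<forall>g\<in>Pr. \<exists>w. w \<in> words S \<and> word_eval TG gen w = g" using surj assms(3) by blast
  then obtain wd where wd: "\<forall>g\<in>Pr. wd g \<in> words S \<and> word_eval TG gen (wd g) = g"
    unfolding bchoice_iff by blast
  \<comment> \<open>Bounds the length of all words that have to be followed: the relators and one
    chosen word for each element of \<open>Pr\<close>.\<close>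
  define L where "L = Max (insert 0 (length ` (R \<union> wd ` Pr)))"
  have L: "length w \<le> L" if "w \<in> R \<union> wd ` Pr" for w
    unfolding L_def using that S(2) assms(2) by (intro Max_ge) auto
  define G0 where "G0 = gen ` S \<union> (\<lambda>s. inv\<^bsub>TG\<^esub> (gen s)) ` S"
  have G0: "finite G0" "G0 \<subseteq> carrier TG" using S by (auto simp: G0_def)
  have "\<forall>g\<in>G0. \<exists>N. \<forall>x\<in>X. \<forall>y\<in>X. (\<forall>k::int. \<bar>k\<bar> \<le> N \<longrightarrow> y k = x k) \<longrightarrow>
      (\<forall>t\<in>{0..1}. lift \<X> shift g y t = lift \<X> shift g x t)"
    using lift_window G0(2) by blast
  then obtain Ng where Ng: "\<forall>g\<in>G0. \<forall>x\<in>X. \<forall>y\<in>X. (\<forall>k::int. \<bar>k\<bar> \<le> Ng g \<longrightarrow> y k = x k) \<longrightarrow>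
      (\<forall>t\<in>{0..1}. lift \<X> shift g y t = lift \<X> shift g x t)"
    unfolding bchoice_iff by blast
  have "\<forall>g\<in>G0. \<exists>B. \<forall>x\<in>X. \<forall>t. \<bar>lift \<X> shift g x t - t\<bar> \<le> B"
    using lift_bounded G0(2) unfolding topX by blast
  then obtain Bg where Bg: "\<forall>g\<in>G0. \<forall>x\<in>X. \<forall>t. \<bar>lift \<X> shift g x t - t\<bar> \<le> Bg g"
    unfolding bchoice_iff by blast
  define N where "N = Max (insert 0 (Ng ` G0))"
  have N: "0 \<le> N" "\<And>g. g \<in> G0 \<Longrightarrow> Ng g \<le> N" unfolding N_def using G0(1) by auto
  define B where "B = Max (insert 0 (Bg ` G0))"
  have B0: "0 \<le> B" "\<And>g. g \<in> G0 \<Longrightarrow> Bg g \<le> B" unfolding B_def using G0(1) by auto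
  have B: "\<bar>lift \<X> shift g x t - t\<bar> \<le> B" if "g \<in> G0" "x \<in> X" for g x t
    using Bg B0(2) that by (meson order_trans)
  \<comment> \<open>\<open>real L * B\<close> is the drift of a word of length at most
    \<open>L\<close>; the rest makes room for a start in \<open>{0..1}\<close>, for one more letter,
    and for two points at distance at most \<open>2 * B\<close>.\<close>
  define K where "K = real L * B + 2 * B + 2"
  \<comment> \<open>A time of absolute value at most \<open>K\<close> lies in a cell of index at
    most \<open>\<lceil>K\<rceil> + 1\<close> in absolute value, and around that cell a window of
    radius \<open>N\<close> is read.\<close>
  define M where "M = N + \<lceil>K\<rceil> + 1"
  have K0: "0 \<le> real L * B" using B0 by simp
  then have M0: "0 \<le> M" using N(1) B0(1) unfolding M_def K_def by linarith
  show ?thesis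
  proof (rule exI[of _ M], intro conjI M0 allI impI)
    fix z assume "admissible M z"
    then have "\<forall>m. \<exists>x. x \<in> X \<and> (\<forall>k. \<bar>k\<bar> \<le> M \<longrightarrow> x k = z (k + m))"
      unfolding admissible_def by blast
    then obtain xx where xx: "\<forall>m. xx m \<in> X \<and> (\<forall>k. \<bar>k\<bar> \<le> M \<longrightarrow> xx m k = z (k + m))"
      unfolding choice_iff by blast
    \<comment> \<open>The local rule: in each cell, lift along a point of \<open>X\<close> that
      shows the window of \<open>z\<close> there.\<close>
    define q where "q g t = lift \<X> shift g (xx \<lfloor>t\<rfloor>) (t - of_int \<lfloor>t\<rfloor>) + of_int \<lfloor>t\<rfloor>" for g t
    \<comment> \<open>Up to distance \<open>K\<close> from \<open>m\<close> the map
      \<open>q g\<close> follows the lift along the one point \<open>x\<close>: the shifts of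
      \<open>x\<close> have the same relevant windows as the points chosen for the individual
      cells.\<close>
    have model: "q g (t + of_int m) = lift \<X> shift g x t + of_int m"
      if g: "g \<in> G0" and x: "x \<in> X" "\<forall>k. \<bar>k\<bar> \<le> M \<longrightarrow> x k = z (k + m)" and t: "\<bar>t\<bar> \<le> K" for g x m t
    proof -
      let ?k = "\<lfloor>t\<rfloor>"
      have k: "\<bar>?k\<bar> \<le> \<lceil>K\<rceil> + 1" using t by linarith
      let ?w = "zpow \<X> shift ?k x"
      have w: "?w \<in> X" using zpow_in[OF stone, of x ?k] x(1) by simp
      have "?w j = xx (?k + m) j" if "\<bar>j\<bar> \<le> Ng g" for j
      proof -
        have "\<bar>j\<bar> \<le> N" using that N(2)[OF g] by linarith
        then have "\<bar>j\<bar> \<le> M" "\<bar>j + ?k\<bar> \<le> M" using k unfolding M_def by linarith+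
        then show ?thesis using x xx zpow_shift[OF finA sub x(1)] by (simp add: algebra_simps)
      qed
      moreover have "t - of_int ?k \<in> {0..1}" unfolding atLeastAtMost_iff by linarith
      ultimately have "lift \<X> shift g ?w (t - of_int ?k) = lift \<X> shift g (xx (?k + m)) (t - of_int ?k)"
        using Ng g w xx by blast
      moreover have "lift \<X> shift g ?w (t - of_int ?k) = lift \<X> shift g x t - of_int ?k"
        using lift_zpow[of g x ?k t] g G0(2) x(1) by auto
      ultimately show ?thesis by (simp add: q_def)
    qed
    have disp: "\<bar>q g t - t\<bar> \<le> B" if "g \<in> G0" for g t
      using B[OF that, of "xx \<lfloor>t\<rfloor>" "t - of_int \<lfloor>t\<rfloor>"] xx by (simp add: q_def)
    \<comment> \<open>Points more than \<open>2 * B\<close> apart keep their order because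
      displacements are at most \<open>B\<close>; closer points are within reach of one
      \<open>x\<close>, whose lift is increasing.\<close>
    have mono: "strict_mono (q g)" if g: "g \<in> G0" for g
    proof (rule strict_monoI)
      fix t u :: real assume tu: "t < u"
      show "q g t < q g u"
      proof (cases "u - t > 2 * B")
        case True
        then show ?thesis using disp[OF g, of t] disp[OF g, of u] by linarith
      next
        case False
        let ?m = "\<lfloor>t\<rfloor>"
        have x: "xx ?m \<in> X" "\<forall>k. \<bar>k\<bar> \<le> M \<longrightarrow> xx ?m k = z (k + ?m)" using xx by auto
        have b: "\<bar>t - of_int ?m\<bar> \<le> K" "\<bar>u - of_int ?m\<bar> \<le> K"
          using False tu K0 B0(1) unfolding K_def by linarith+
        have "lift \<X> shift g (xx ?m) (t - of_int ?m) < lift \<X> shift g (xx ?m) (u - of_int ?m)"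
          using lift_strict_mono[of g "xx ?m"] g G0(2) x(1) tu by (auto simp: strict_mono_def)
        then show ?thesis using model[OF g x b(1)] model[OF g x b(2)] by simp
      qed
    qed
    have inverse: "q g (q h t) = t" if g: "g \<in> G0" "h \<in> G0"
      and gh: "\<And>x t. x \<in> X \<Longrightarrow> lift \<X> shift g x (lift \<X> shift h x t) = t" for g h t
    proof -
      let ?m = "\<lfloor>t\<rfloor>"
      let ?u = "lift \<X> shift h (xx ?m) (t - of_int ?m)"
      have x: "xx ?m \<in> X" "\<forall>k. \<bar>k\<bar> \<le> M \<longrightarrow> xx ?m k = z (k + ?m)" using xx by auto
      have b: "\<bar>t - of_int ?m\<bar> \<le> K" using K0 B0(1) unfolding K_def by linarith
      have b2: "\<bar>?u\<bar> \<le> K" using B[OF g(2) x(1), of "t - of_int ?m"] K0 B0(1) unfolding K_def by linarith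
      show ?thesis using model[OF g(2) x b] model[OF g(1) x b2] gh[OF x(1)] by simp
    qed
    have inG0: "gen s \<in> G0" "inv\<^bsub>TG\<^esub> (gen s) \<in> G0" "gen s \<in> carrier TG" if "s \<in> S" for s
      using that S(4) by (auto simp: G0_def)
    have inv1: "q (inv\<^bsub>TG\<^esub> (gen s)) (q (gen s) t) = t" "q (gen s) (q (inv\<^bsub>TG\<^esub> (gen s)) t) = t" if "s \<in> S" for s t
      using inverse inG0[OF that] lift_inv[OF inG0(3)[OF that]] by simp_all
    have qc: "q (gen s) \<in> carrier incr_group" "q (inv\<^bsub>TG\<^esub> (gen s)) \<in> carrier incr_group" if "s \<in> S" for s
      using mono inG0[OF that] inv1[OF that] by (auto simp: incr_group_def intro!: surjI)
    have qinv: "inv\<^bsub>incr_group\<^esub> (q (gen s)) = q (inv\<^bsub>TG\<^esub> (gen s))" if "s \<in> S" for s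
      by (rule inv_incr_group[OF qc[OF that]]) (simp add: fun_eq_iff inv1[OF that])
    \<comment> \<open>The displacement bound is carried through the induction so that the
      intermediate time stays within \<open>K\<close> and \<open>model\<close> applies to the next
      letter.\<close>
    have ev: "word_eval incr_group (\<lambda>s. q (gen s)) w (t + of_int m) = lift \<X> shift (word_eval TG gen w) x t + of_int m
        \<and> \<bar>lift \<X> shift (word_eval TG gen w) x t - t\<bar> \<le> real (length w) * B"
      if x: "x \<in> X" "\<forall>k. \<bar>k\<bar> \<le> M \<longrightarrow> x k = z (k + m)" and w: "w \<in> words S" "length w \<le> L" and t: "t \<in> {0..1}" for w x m t
      using w
    proof (induction w)
      case Nil
      then show ?case using lift_one[of x t] x(1) by (simp add: incr_group_def)
    next
      case (Cons p w)
      obtain s e where p: "p = (s, e)" by force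
      have w: "w \<in> words S" "s \<in> S" "length w \<le> L" using Cons.prems p by (auto simp: words_def)
      let ?u = "lift \<X> shift (word_eval TG gen w) x t"
      let ?g = "if e then gen s else inv\<^bsub>TG\<^esub> (gen s)"
      have IH: "word_eval incr_group (\<lambda>s. q (gen s)) w (t + of_int m) = ?u + of_int m"
        "\<bar>?u - t\<bar> \<le> real (length w) * B" using Cons.IH[OF w(1,3)] by auto
      have g: "?g \<in> G0" "?g \<in> carrier TG" using inG0[OF w(2)] by auto
      have "real (length w) * B \<le> real L * B" using w(3) B0(1) by (intro mult_right_mono) auto
      then have u: "\<bar>?u\<bar> \<le> K" using IH(2) t B0(1) unfolding K_def by auto
      have wc: "word_eval TG gen w \<in> carrier TG" by (rule word_eval_closed[OF group_TG S(4) w(1)])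
      have l: "lift \<X> shift (word_eval TG gen (p # w)) x t = lift \<X> shift ?g x ?u"
        using lift_mult[OF g(2) wc, of x t] x(1) by (cases e) (auto simp: p)
      have "word_eval incr_group (\<lambda>s. q (gen s)) (p # w) (t + of_int m) = q ?g (?u + of_int m)"
        using IH(1) qinv[OF w(2)] by (simp add: p incr_group_def)
      then show ?case using model[OF g(1) x u] l B[OF g(1) x(1), of ?u] IH(2) by (auto simp: algebra_simps)
    qed
    have one: "word_eval incr_group (\<lambda>s. q (gen s)) r = \<one>\<^bsub>incr_group\<^esub>" if r: "r \<in> R" for r
    proof
      fix t :: real
      let ?m = "\<lfloor>t\<rfloor>"
      have x: "xx ?m \<in> X" "\<forall>k. \<bar>k\<bar> \<le> M \<longrightarrow> xx ?m k = z (k + ?m)" using xx by auto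
      have t: "t - of_int ?m \<in> {0..1}" unfolding atLeastAtMost_iff by linarith
      have "r \<in> words S" "length r \<le> L" using r S(3) L by auto
      then show "word_eval incr_group (\<lambda>s. q (gen s)) r t = \<one>\<^bsub>incr_group\<^esub> t"
        using ev[OF x _ _ t, of r] relator[OF r] lift_one x(1) by (simp add: incr_group_def)
    qed
    have qS: "(\<lambda>s. q (gen s)) \<in> S \<rightarrow> carrier incr_group" using qc by auto
    obtain \<rho> where \<rho>: "\<rho> \<in> hom TG incr_group"
      "\<And>w. w \<in> words S \<Longrightarrow> \<rho> (word_eval TG gen w) = word_eval incr_group (\<lambda>s. q (gen s)) w"
      by (rule presentation_induced_hom[OF group_TG group_incr_group S(3) qS S(4) surj rel1 one]) blast+
    have "\<rho> g (t + of_int m) = lift \<X> shift g x t + of_int m"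
      if g: "g \<in> Pr" and x: "x \<in> X" "\<forall>k. \<bar>k\<bar> \<le> M \<longrightarrow> x k = z (k + m)" and t: "t \<in> {0..1}" for g x m t
    proof -
      have w: "wd g \<in> words S" "word_eval TG gen (wd g) = g" "length (wd g) \<le> L" using wd g L by auto
      show ?thesis using ev[OF x w(1,3) t] \<rho>(2)[OF w(1)] w(2) by simp
    qed
    then have "acts_along M z Pr \<rho>" unfolding acts_along_def by blast
    then show "\<exists>\<rho>\<in>hom TG incr_group. acts_along M z Pr \<rho>" using \<rho>(1) by blast
  qed
qed

end

section \<open>Elements supported in cells\<close>

lemma continuous_map_locally_uniform:
  assumes "\<And>x t. x \<in> topspace X \<Longrightarrow> \<exists>C a b f. openin X C \<and> x \<in> C \<and> a < t \<and> t < b \<and>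
      continuous_on {a<..<b} f \<and> (\<forall>w\<in>C. \<forall>s\<in>{a<..<b}. \<gamma> w s = f s)"
  shows "continuous_map (prod_topology X euclideanreal) euclideanreal (\<lambda>(x, t). \<gamma> x t)"
  unfolding continuous_map_def
proof (intro conjI allI impI)
  fix V :: "real set" assume V: "openin euclideanreal V"
  let ?U = "{p \<in> topspace (prod_topology X euclideanreal). (case p of (x, t) \<Rightarrow> \<gamma> x t) \<in> V}"
  show "openin (prod_topology X euclideanreal) ?U"
  proof (subst openin_subopen, intro ballI)
    fix p assume "p \<in> ?U"
    then obtain x t where p: "p = (x, t)" "x \<in> topspace X" "\<gamma> x t \<in> V" by auto
    then obtain C a b f where *: "openin X C" "x \<in> C" "a < t" "t < b"
      "continuous_on {a<..<b} f" "\<forall>w\<in>C. \<forall>s\<in>{a<..<b}. \<gamma> w s = f s"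
      using assms[of x t] by blast
    let ?W = "f -` V \<inter> {a<..<b}"
    have "open ?W" using continuous_open_preimage[OF *(5), of V] V by (simp add: Int_commute)
    then have "openin (prod_topology X euclideanreal) (C \<times> ?W)" using *(1) by (simp add: openin_prod_Times_iff)
    moreover have "p \<in> C \<times> ?W" using * p by auto
    moreover have "C \<times> ?W \<subseteq> ?U" using openin_subset[OF *(1)] *(6) by auto
    ultimately show "\<exists>T. openin (prod_topology X euclideanreal) T \<and> p \<in> T \<and> T \<subseteq> ?U" by blast
  qed
qed auto

section \<open>Homeomorphisms of the suspension induced by equivariant maps\<close>

definition equivariant :: "'x topology \<Rightarrow> ('x \<Rightarrow> 'x) \<Rightarrow> ('x \<Rightarrow> real \<Rightarrow> real) \<Rightarrow> bool" where
  "equivariant X \<phi> \<gamma> \<longleftrightarrow>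
    (\<forall>x\<in>topspace X. \<forall>n t. \<gamma> (zpow X \<phi> n x) (t - of_int n) = \<gamma> x t - of_int n)"

text \<open>The representative is chosen arbitrarily; equivariance makes the resulting class
  independent of the choice.\<close>

definition susp_map :: "'x topology \<Rightarrow> ('x \<Rightarrow> 'x) \<Rightarrow> ('x \<Rightarrow> real \<Rightarrow> real) \<Rightarrow> ('x \<times> real) set \<Rightarrow> ('x \<times> real) set" where
  "susp_map X \<phi> \<gamma> = (\<lambda>y\<in>topspace (suspension X \<phi>).
    let p = SOME p. p \<in> y in susp_class X \<phi> (fst p, \<gamma> (fst p) (snd p)))"

lemma continuous_map_interval_fst:
  "continuous_map (prod_topology (top_of_set S) Y) euclidean fst"
  by (rule continuous_map_into_fulltopology[OF continuous_map_fst])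

lemma continuous_map_snd_snd:
  "continuous_map (prod_topology Z (prod_topology X Y)) Y (\<lambda>p. snd (snd p))"
  using continuous_map_compose[OF continuous_map_snd continuous_map_snd] by (simp add: o_def)

context free_stone_system
begin

lemma susp_map_cls:
  assumes "equivariant X \<phi> \<gamma>" "x \<in> topspace X"
  shows "susp_map X \<phi> \<gamma> (cls (x, t)) = cls (x, \<gamma> x t)"
proof -
  define p where "p = (SOME p. p \<in> cls (x, t))"
  have "(zpow X \<phi> 0 x, t - of_int 0) \<in> cls (x, t)" unfolding susp_class_def by blast
  then have "p \<in> cls (x, t)" unfolding p_def by (rule someI)
  then obtain n :: int where n: "p = (zpow X \<phi> n x, t - of_int n)" by (auto simp: susp_class_def)
  have "susp_map X \<phi> \<gamma> (cls (x, t)) = cls (fst p, \<gamma> (fst p) (snd p))"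
    using cls_in[OF assms(2)] by (simp add: susp_map_def p_def[symmetric])
  also have "\<dots> = cls (zpow X \<phi> n x, \<gamma> x t - of_int n)"
    using assms by (simp add: n equivariant_def)
  also have "\<dots> = cls (x, \<gamma> x t)" by (rule cls_zpow[OF assms(2)])
  finally show ?thesis .
qed

lemma continuous_susp_map:
  assumes "equivariant X \<phi> \<gamma>"
    and "continuous_map (prod_topology X euclideanreal) euclideanreal (\<lambda>(x, t). \<gamma> x t)"
  shows "continuous_map (suspension X \<phi>) (suspension X \<phi>) (susp_map X \<phi> \<gamma>)"
proof (rule continuous_compose_quotient_map[OF quotient_map_suspension])
  have "continuous_map (prod_topology X euclideanreal) (prod_topology X euclideanreal)
      (\<lambda>p. (fst p, (\<lambda>(x, t). \<gamma> x t) p))"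
    by (intro continuous_map_pairedI continuous_map_fst assms(2))
  then have "continuous_map (prod_topology X euclideanreal) (suspension X \<phi>)
      (cls \<circ> (\<lambda>p. (fst p, (\<lambda>(x, t). \<gamma> x t) p)))"
    by (rule continuous_map_compose[OF _ quotient_imp_continuous_map[OF quotient_map_suspension]])
  then show "continuous_map (prod_topology X euclideanreal) (suspension X \<phi>) (susp_map X \<phi> \<gamma> \<circ> cls)"
    by (rule continuous_map_eq) (auto simp: susp_map_cls[OF assms(1)])
qed

lemma homeomorphic_susp_map:
  assumes "equivariant X \<phi> \<gamma>" "equivariant X \<phi> \<delta>"
    and "continuous_map (prod_topology X euclideanreal) euclideanreal (\<lambda>(x, t). \<gamma> x t)"
    and "continuous_map (prod_topology X euclideanreal) euclideanreal (\<lambda>(x, t). \<delta> x t)"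
    and "\<And>x t. x \<in> topspace X \<Longrightarrow> \<gamma> x (\<delta> x t) = t" "\<And>x t. x \<in> topspace X \<Longrightarrow> \<delta> x (\<gamma> x t) = t"
  shows "homeomorphic_map (suspension X \<phi>) (suspension X \<phi>) (susp_map X \<phi> \<gamma>)"
proof -
  have "homeomorphic_maps (suspension X \<phi>) (suspension X \<phi>) (susp_map X \<phi> \<gamma>) (susp_map X \<phi> \<delta>)"
    unfolding homeomorphic_maps_def
    using continuous_susp_map assms by (auto simp: topspace_suspension susp_map_cls)
  then show ?thesis by (rule homeomorphic_maps_imp_map)
qed

text \<open>The homotopy descends to the suspension because the product of a quotient map with the
  locally compact Hausdorff space \<open>{0..1}\<close> is again a quotient map.\<close>

lemma isotopic_susp_map:
  assumes eq: "\<And>s. s \<in> {0..1} \<Longrightarrow> equivariant X \<phi> (\<Gamma> s)" "\<And>s. s \<in> {0..1} \<Longrightarrow> equivariant X \<phi> (\<Delta> s)"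
    and cont: "continuous_map (prod_topology (top_of_set {0..1::real}) (prod_topology X euclideanreal))
      euclideanreal (\<lambda>(s, x, t). \<Gamma> s x t)"
      "\<And>s. s \<in> {0..1} \<Longrightarrow>
        continuous_map (prod_topology X euclideanreal) euclideanreal (\<lambda>(x, t). \<Gamma> s x t)"
      "\<And>s. s \<in> {0..1} \<Longrightarrow>
        continuous_map (prod_topology X euclideanreal) euclideanreal (\<lambda>(x, t). \<Delta> s x t)"
    and inv: "\<And>s x t. s \<in> {0..1} \<Longrightarrow> x \<in> topspace X \<Longrightarrow> \<Gamma> s x (\<Delta> s x t) = t"
      "\<And>s x t. s \<in> {0..1} \<Longrightarrow> x \<in> topspace X \<Longrightarrow> \<Delta> s x (\<Gamma> s x t) = t"
    and zero: "\<And>x t. x \<in> topspace X \<Longrightarrow> \<Gamma> 0 x t = t"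
  shows "susp_map X \<phi> (\<Gamma> 1) \<in> H0 X \<phi>"
proof -
  let ?I = "top_of_set {0..1::real}" and ?S = "suspension X \<phi>" and ?P = "prod_topology X euclideanreal"
  have hom: "homeomorphic_map ?S ?S (susp_map X \<phi> (\<Gamma> s))" if "s \<in> {0..1}" for s
    using homeomorphic_susp_map[OF eq(1)[OF that] eq(2)[OF that] cont(2)[OF that] cont(3)[OF that]]
      inv that by blast
  have "locally_compact_space ?I"
    using compact_imp_locally_compact_space[of ?I] by (simp add: compact_space_subtopology)
  then have q: "quotient_map (prod_topology ?I ?P) (prod_topology ?I ?S) (\<lambda>(s, p). (s, cls p))"
    using quotient_map_prod_right[OF _ _ quotient_map_suspension] Hausdorff_space_subtopology
      Hausdorff_space_euclidean by blast
  let ?H = "\<lambda>(s, y). susp_map X \<phi> (\<Gamma> s) y"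
  have "continuous_map (prod_topology ?I ?P) ?P (\<lambda>q. (fst (snd q), (\<lambda>(s, x, t). \<Gamma> s x t) q))"
    using continuous_map_compose[OF continuous_map_snd continuous_map_fst]
    by (intro continuous_map_pairedI cont(1)) (auto simp: o_def)
  then have "continuous_map (prod_topology ?I ?P) ?S
      (cls \<circ> (\<lambda>q. (fst (snd q), (\<lambda>(s, x, t). \<Gamma> s x t) q)))"
    by (rule continuous_map_compose[OF _ quotient_imp_continuous_map[OF quotient_map_suspension]])
  then have "continuous_map (prod_topology ?I ?P) ?S (?H \<circ> (\<lambda>(s, p). (s, cls p)))"
    by (rule continuous_map_eq) (auto simp: susp_map_cls[OF eq(1)])
  then have "continuous_map (prod_topology ?I ?S) ?S ?H"
    by (rule continuous_compose_quotient_map[OF q])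
  moreover have "susp_map X \<phi> (\<Gamma> 0) y = y" if "y \<in> topspace ?S" for y
    using that susp_map_cls[OF eq(1)[of 0]] zero by (auto simp: topspace_suspension)
  ultimately have "isotopic_to_id ?S (susp_map X \<phi> (\<Gamma> 1))"
    unfolding isotopic_to_id_def using hom by (intro exI[of _ ?H]) auto
  then show ?thesis using hom[of 1] by (auto simp: H0_def susp_map_def)
qed

lemma susp_map_in_T:
  assumes "susp_map X \<phi> \<gamma> \<in> H0 X \<phi>"
    and "\<And>x t. x \<in> topspace X \<Longrightarrow> T_local X \<phi> (susp_map X \<phi> \<gamma>) (cls (x, t))"
  shows "susp_map X \<phi> \<gamma> \<in> carrier TG"
  using assms T_carrier_iff[OF stone, of "susp_map X \<phi> \<gamma>"]
  by (auto simp: T_group_def topspace_suspension)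

lemma lift_susp_map:
  assumes "equivariant X \<phi> \<gamma>" "x \<in> topspace X"
  shows "lift X \<phi> (susp_map X \<phi> \<gamma>) x t = \<gamma> x t"
  by (rule lift_eqI) (auto simp: susp_map_cls assms)

text \<open>Return times are at least 1 by definition, so an interval shorter than 1 is short enough
  for every clopen set.\<close>

lemma dyadic_chart_short:
  assumes "openin X C" "closedin X C" "a \<in> dyadic" "b \<in> dyadic" "a < b" "b - a < 1"
  shows "dyadic_chart X \<phi> C {a<..<b}"
proof -
  have "enat 1 \<le> return_time \<phi> C"
    unfolding return_time_def by (rule Inf_greatest) auto
  then have "ereal_of_enat (enat 1) \<le> ereal_of_enat (return_time \<phi> C)" by (simp only: ereal_of_enat_le_iff)
  moreover have "ereal (b - a) < ereal_of_enat (enat 1)" using assms(6) by simp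
  ultimately have "ereal (b - a) < ereal_of_enat (return_time \<phi> C)"
    using order_less_le_trans by blast
  then show ?thesis using assms unfolding dyadic_chart_def chart_def dyadic_open_interval_def by blast
qed

lemma T_local_susp_map:
  assumes "equivariant X \<phi> \<gamma>" "openin X C" "closedin X C" "x \<in> C"
    and "a \<in> dyadic" "b \<in> dyadic" "a < t" "t < b" "b - a < 1"
    and "dyadic_PL_homeo f {a<..<b} {c<..<d}" "d - c < 1"
    and "\<And>w s. w \<in> C \<Longrightarrow> s \<in> {a<..<b} \<Longrightarrow> \<gamma> w s = f s"
  shows "T_local X \<phi> (susp_map X \<phi> \<gamma>) (cls (x, t))"
proof -
  have CX: "C \<subseteq> topspace X" using assms(2) by (rule openin_subset)
  have im: "f ` {a<..<b} = {c<..<d}" using assms(10) by (auto simp: dyadic_PL_homeo_def homeomorphism_def)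
  have "dyadic_chart X \<phi> C {a<..<b}" using assms by (intro dyadic_chart_short) auto
  moreover have "dyadic_chart X \<phi> C {c<..<d}"
  proof -
    have "c < d" using im assms(7,8) by (metis greaterThanLessThan_empty_iff image_is_empty leD less_trans not_le)
    moreover have "dyadic_open_interval {c<..<d}" using assms(10) by (simp add: dyadic_PL_homeo_def)
    then obtain c' d' where "c' \<in> dyadic" "d' \<in> dyadic" "c' < d'" "{c<..<d} = {c'<..<d'}"
      by (auto simp: dyadic_open_interval_def)
    \<comment> \<open>Dyadicity is known only for some endpoints of the same interval; they are
      identified with \<open>c\<close> and \<open>d\<close> as infimum and supremum.\<close>
    moreover from this have "c = c' \<and> d = d'"
      using \<open>c < d\<close> by (metis cInf_greaterThanLessThan cSup_greaterThanLessThan)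
    ultimately show ?thesis using assms(2,3,11) by (intro dyadic_chart_short) auto
  qed
  moreover have "cls (x, t) \<in> domain_of X \<phi> C {a<..<b}"
    using assms(4,7,8) by (auto simp: domain_of_def)
  moreover have "susp_map X \<phi> \<gamma> (cls (w, s)) = cls (w, f s)" if "w \<in> C" "s \<in> {a<..<b}" for w s
    using susp_map_cls[OF assms(1), of w s] CX that assms(12) by auto
  ultimately show ?thesis unfolding T_local_def
    using assms(10) im by (intro exI[of _ C] exI[of _ "{a<..<b}"] exI[of _ f]) auto
qed

section \<open>The suspension flow at dyadic times\<close>

definition flow where
  "flow c = susp_map X \<phi> (\<lambda>x t. t + c)"

lemma equivariant_translation: "equivariant X \<phi> (\<lambda>x t. t + c)"
  by (simp add: equivariant_def)

text \<open>The flow run for time \<open>s * c\<close> is an isotopy from the identity, and locally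
  the map is a dyadic translation.\<close>

lemma flow_in_T:
  assumes "c \<in> dyadic"
  shows "flow c \<in> carrier TG"
  unfolding flow_def
proof (rule susp_map_in_T)
  have "susp_map X \<phi> (\<lambda>x t. t + 1 * c) \<in> H0 X \<phi>"
    using equivariant_translation[of "- (_ * c)"]
    by (intro isotopic_susp_map[of "\<lambda>s x t. t + s * c" "\<lambda>s x t. t - s * c"])
      (auto simp: equivariant_translation case_prod_unfold continuous_map_snd
        intro!: continuous_map_add continuous_map_diff continuous_map_real_mult
          continuous_map_interval_fst continuous_map_snd_snd)
  then show "susp_map X \<phi> (\<lambda>x t. t + c) \<in> H0 X \<phi>" by simp
  fix x t assume x: "x \<in> topspace X"
  obtain a where a: "a \<in> dyadic" "t - 1/2 < a" "a < t" using dyadic_dense[of "t - 1/2" t] by auto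
  obtain b where b: "b \<in> dyadic" "t < b" "b < t + 1/2" using dyadic_dense[of t "t + 1/2"] by auto
  have "dyadic_PL_homeo (\<lambda>t. t + c) {a<..<b} {a + c<..<b + c}"
    using a b assms by (intro dyadic_PL_translate) auto
  then show "T_local X \<phi> (susp_map X \<phi> (\<lambda>x t. t + c)) (cls (x, t))"
    using a b x by (intro T_local_susp_map[OF equivariant_translation openin_topspace closedin_topspace]) auto
qed

lemma lift_flow: "x \<in> topspace X \<Longrightarrow> lift X \<phi> (flow c) x t = t + c"
  unfolding flow_def by (simp add: lift_susp_map equivariant_translation)


end

section \<open>Maps of the unit cell and their action over clopen sets\<close>

definition cell_homeo :: "(real \<Rightarrow> real) \<Rightarrow> bool" where
  "cell_homeo f \<longleftrightarrow> strict_mono f \<and> continuous_on UNIV f \<and> (\<forall>t. t \<le> 1/8 \<or> 7/8 \<le> t \<longrightarrow> f t = t)"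

definition per :: "(real \<Rightarrow> real) \<Rightarrow> real \<Rightarrow> real" where
  "per f t = f (t - of_int \<lfloor>t\<rfloor>) + of_int \<lfloor>t\<rfloor>"

text \<open>The cell of index \<open>n\<close> on the line over \<open>x\<close> is the cell of
  index 0 over the \<open>n\<close>-th iterate of \<open>x\<close>; this is why membership in
  \<open>D\<close> is tested on that iterate.\<close>

definition cell_action :: "'x topology \<Rightarrow> ('x \<Rightarrow> 'x) \<Rightarrow> (real \<Rightarrow> real) \<Rightarrow> 'x set \<Rightarrow> 'x \<Rightarrow> real \<Rightarrow> real" where
  "cell_action X \<phi> f D x t = (if zpow X \<phi> \<lfloor>t\<rfloor> x \<in> D then per f t else t)"

lemma cell_homeo_unit:
  assumes "cell_homeo f" "t \<in> {0..<1}" shows "f t \<in> {0..<1}"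
proof -
  have m: "strict_mono f" "f 0 = 0" "f 1 = 1" using assms by (auto simp: cell_homeo_def)
  then show ?thesis using assms(2) strict_mono_less[OF m(1), of t 1] strict_mono_less_eq[OF m(1), of 0 t]
    by auto
qed

lemma floor_per: "cell_homeo f \<Longrightarrow> \<lfloor>per f t\<rfloor> = \<lfloor>t\<rfloor>"
  using cell_homeo_unit[of f "t - of_int \<lfloor>t\<rfloor>"] unfolding per_def floor_eq_iff
  by simp linarith

text \<open>The margins of width 1/8 on which \<open>f\<close> is the identity let the formula of
  one cell persist slightly beyond both of its ends.\<close>

lemma per_eq:
  assumes "cell_homeo f" "of_int n - 1/8 < t" "t < of_int n + 9/8"
  shows "per f t = f (t - of_int n) + of_int n"
proof -
  have f: "f u = u" if "u \<le> 1/8 \<or> 7/8 \<le> u" for u using that assms(1) by (auto simp: cell_homeo_def)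
  consider "\<lfloor>t\<rfloor> = n" | "\<lfloor>t\<rfloor> = n - 1" "t < of_int n" | "\<lfloor>t\<rfloor> = n + 1" "t \<ge> of_int n + 1"
    using assms(2,3) by linarith
  then show ?thesis
    by cases (use assms f in \<open>auto simp: per_def\<close>)
qed

lemma per_id: "per id = id" "per (\<lambda>t. t) = id"
  by (auto simp: per_def)

lemma per_o: "cell_homeo g \<Longrightarrow> per f (per g t) = per (f \<circ> g) t"
  using floor_per[of g t] by (simp add: per_def)

lemma cell_homeo_surj:
  assumes "cell_homeo f" shows "surj f"
proof -
  have m: "strict_mono f" "continuous_on UNIV f" and f: "\<And>t. t \<le> 1/8 \<or> 7/8 \<le> t \<Longrightarrow> f t = t"
    using assms by (auto simp: cell_homeo_def)
  have "\<exists>t. f t = s" for s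
  proof (cases "s \<le> 1/8 \<or> 7/8 \<le> s")
    case False
    then have "\<exists>t\<ge>1/8. t \<le> 7/8 \<and> f t = s"
      using f[of "1/8"] f[of "7/8"] continuous_on_subset[OF m(2)] by (intro IVT') auto
    then show ?thesis by blast
  qed (use f in blast)
  then show ?thesis by (metis surjI)
qed

lemma strict_mono_surj_continuous:
  fixes f :: "real \<Rightarrow> real"
  assumes "strict_mono f" "surj f"
  shows "continuous_on UNIV f"
  using assms strict_mono_mono[OF assms(1)] by (intro continuous_onI_mono) (auto dest: monoD)

lemma cell_homeo_inv:
  assumes "cell_homeo f" shows "cell_homeo (inv_into UNIV f)"
proof -
  have m: "strict_mono f" and f: "\<And>t. t \<le> 1/8 \<or> 7/8 \<le> t \<Longrightarrow> f t = t"
    using assms by (auto simp: cell_homeo_def)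
  note i = strict_mono_inv_surj[OF m cell_homeo_surj[OF assms]]
  have "inv_into UNIV f t = t" if "t \<le> 1/8 \<or> 7/8 \<le> t" for t
    using f[OF that] strict_mono_imp_inj_on[OF m] by (metis inv_f_eq)
  then show ?thesis unfolding cell_homeo_def
    using i strict_mono_surj_continuous by blast
qed

lemma cell_homeo_o:
  assumes "cell_homeo f" "cell_homeo g" shows "cell_homeo (f \<circ> g)"
  using assms continuous_on_compose[of UNIV g f] continuous_on_subset[of UNIV f]
  by (auto simp: cell_homeo_def strict_mono_o simp del: comp_apply) (auto simp: comp_def)

text \<open>A convex combination of the identity and an increasing map is increasing, so the
  straight-line homotopy is an isotopy.\<close>

lemma cell_homeo_interpolate:
  assumes "cell_homeo f" "s \<in> {0..1}" shows "cell_homeo (\<lambda>t. t + s * (f t - t))"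
proof -
  have m: "strict_mono f" "continuous_on UNIV f" and f: "\<And>t. t \<le> 1/8 \<or> 7/8 \<le> t \<Longrightarrow> f t = t"
    using assms by (auto simp: cell_homeo_def)
  have "t + s * (f t - t) < u + s * (f u - u)" if "t < u" for t u
  proof -
    have "f t < f u" using m(1) that by (simp add: strict_mono_def)
    have "0 < (1 - s) * (u - t) + s * (f u - f t)"
    proof (cases "s = 0")
      case False
      then show ?thesis using \<open>f t < f u\<close> that assms(2) by (intro add_nonneg_pos mult_nonneg_nonneg mult_pos_pos) auto
    qed (use that in simp)
    then show ?thesis by (simp add: algebra_simps)
  qed
  then show ?thesis using m(2) f
    by (auto simp: cell_homeo_def strict_mono_def intro!: continuous_intros)
qed

lemma cell_action_interpolate: "cell_action X \<phi> (\<lambda>t. t + s * (f t - t)) D x t = t + s * (cell_action X \<phi> f D x t - t)"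
  by (simp add: cell_action_def per_def algebra_simps)

lemma cell_action_o: "cell_homeo g \<Longrightarrow> cell_action X \<phi> f D x (cell_action X \<phi> g D x t) = cell_action X \<phi> (f \<circ> g) D x t"
  by (simp add: cell_action_def floor_per per_o)

context free_stone_system
begin

lemma equivariant_cell_action: "equivariant X \<phi> (cell_action X \<phi> f D)"
  unfolding equivariant_def
proof (intro ballI allI)
  fix x n and t :: real assume "x \<in> topspace X"
  then have "zpow X \<phi> \<lfloor>t - of_int n\<rfloor> (zpow X \<phi> n x) = zpow X \<phi> \<lfloor>t\<rfloor> x" by (simp add: zpow_add[OF stone])
  then show "cell_action X \<phi> f D (zpow X \<phi> n x) (t - of_int n) = cell_action X \<phi> f D x t - of_int n"
    by (simp add: cell_action_def per_def)
qed

lemma cell_action_near_integer: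
  assumes "cell_homeo f" "of_int n - 1/8 < t" "t < of_int n + 1/8"
  shows "cell_action X \<phi> f D x t = t"
  using per_eq[OF assms(1), of n t] assms by (auto simp: cell_action_def cell_homeo_def)

lemma clopen_zpow:
  assumes "openin X D" "closedin X D"
  shows "openin X {w \<in> topspace X. zpow X \<phi> n w \<in> D}" "closedin X {w \<in> topspace X. zpow X \<phi> n w \<in> D}"
  using openin_continuous_map_preimage[OF continuous_zpow[OF stone] assms(1)]
    closedin_continuous_map_preimage[OF continuous_zpow[OF stone] assms(2)] by auto

lemma clopen_neg:
  assumes "openin X D" "closedin X D"
  shows "openin X (topspace X - D)" "closedin X (topspace X - D)"
  using assms by auto

text \<open>Near an integer time nothing moves, whatever \<open>x\<close> is. Inside a cell the test
  for membership in \<open>D\<close> is locally constant in \<open>x\<close> because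
  \<open>D\<close> is clopen.\<close>

lemma continuous_cell_action:
  assumes "cell_homeo f" "openin X D" "closedin X D"
  shows "continuous_map (prod_topology X euclideanreal) euclideanreal (\<lambda>(x, t). cell_action X \<phi> f D x t)"
proof (rule continuous_map_locally_uniform)
  fix x t assume x: "x \<in> topspace X"
  show "\<exists>C a b h. openin X C \<and> x \<in> C \<and> a < t \<and> t < b \<and> continuous_on {a<..<b} h \<and>
      (\<forall>w\<in>C. \<forall>s\<in>{a<..<b}. cell_action X \<phi> f D w s = h s)"
  proof (cases "t \<in> \<int>")
    case True
    then obtain n where n: "t = of_int n" by (elim Ints_cases)
    show ?thesis
      by (rule exI[of _ "topspace X"], rule exI[of _ "t - 1/8"], rule exI[of _ "t + 1/8"], rule exI[of _ "\<lambda>s. s"])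
        (use x cell_action_near_integer[OF assms(1)] n in auto)
  next
    case False
    define n where "n = \<lfloor>t\<rfloor>"
    have t: "of_int n < t" "t < of_int n + 1"
      using False unfolding n_def by (metis Ints_of_int of_int_floor_le order_less_le, linarith)
    have fl: "\<lfloor>s\<rfloor> = n" if "s \<in> {of_int n<..<of_int n + 1}" for s :: real
      using that by (simp add: floor_eq_iff)
    define C where "C = (if zpow X \<phi> n x \<in> D then {w \<in> topspace X. zpow X \<phi> n w \<in> D}
        else {w \<in> topspace X. zpow X \<phi> n w \<in> topspace X - D})"
    define h where "h = (if zpow X \<phi> n x \<in> D then (\<lambda>s. f (s - of_int n) + of_int n) else (\<lambda>s. s))"
    have cf: "continuous_on UNIV f" using assms(1) by (simp add: cell_homeo_def)
    have "openin X C" "x \<in> C" unfolding C_def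
      using clopen_zpow[OF assms(2,3)] clopen_zpow[OF clopen_neg[OF assms(2,3)]] x zpow_in[OF stone x] by auto
    moreover have "continuous_on {of_int n<..<of_int n + 1} h"
      unfolding h_def by (auto intro!: continuous_intros continuous_on_compose2[OF cf])
    moreover have "cell_action X \<phi> f D w s = h s" if "w \<in> C" "s \<in> {of_int n<..<of_int n + 1}" for w s
      using that fl[OF that(2)] by (auto simp: cell_action_def C_def h_def per_def split: if_splits)
    ultimately show ?thesis using t by blast
  qed
qed

lemma susp_map_cell_action_H0:
  assumes f: "cell_homeo f" and D: "openin X D" "closedin X D"
  shows "susp_map X \<phi> (cell_action X \<phi> f D) \<in> H0 X \<phi>"
proof -
  let ?f = "\<lambda>s t. t + s * (f t - t)"
  note c = cell_homeo_interpolate[OF f]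
  have inv: "?f s \<circ> inv_into UNIV (?f s) = id" "inv_into UNIV (?f s) \<circ> ?f s = id" if "s \<in> {0..1}" for s
  proof -
    have "inj (?f s)" using c[OF that] by (auto simp: cell_homeo_def intro: strict_mono_imp_inj_on)
    then show "?f s \<circ> inv_into UNIV (?f s) = id" "inv_into UNIV (?f s) \<circ> ?f s = id"
      using cell_homeo_surj[OF c[OF that]] by (simp_all add: surj_iff inj_iff)
  qed
  have id: "cell_action X \<phi> id D x t = t" "cell_action X \<phi> (\<lambda>t. t) D x t = t" for x t by (auto simp: cell_action_def per_id)
  have "susp_map X \<phi> (cell_action X \<phi> (?f 1) D) \<in> H0 X \<phi>"
  proof (rule isotopic_susp_map[of "\<lambda>s. cell_action X \<phi> (?f s) D" "\<lambda>s. cell_action X \<phi> (inv_into UNIV (?f s)) D"])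
    have "continuous_map (prod_topology (top_of_set {0..1}) (prod_topology X euclideanreal)) euclideanreal
        (\<lambda>p. (\<lambda>(x, t). cell_action X \<phi> f D x t) (snd p))"
      using continuous_map_compose[OF continuous_map_snd continuous_cell_action[OF f D]] by (simp add: o_def)
    then show "continuous_map (prod_topology (top_of_set {0..1}) (prod_topology X euclideanreal))
        euclideanreal (\<lambda>(s, x, t). cell_action X \<phi> (?f s) D x t)"
      unfolding cell_action_interpolate
      by (auto simp: case_prod_unfold intro!: continuous_map_add continuous_map_diff continuous_map_real_mult
          continuous_map_interval_fst continuous_map_snd_snd)
  qed (auto simp: equivariant_cell_action id cell_action_o c cell_homeo_inv inv
      intro!: continuous_cell_action D c cell_homeo_inv simp del: cell_action_interpolate)
  then show ?thesis by simp
qed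

definition cell_elt where "cell_elt f D = susp_map X \<phi> (cell_action X \<phi> f D)"

lemma lift_cell_elt: "x \<in> topspace X \<Longrightarrow> lift X \<phi> (cell_elt f D) x t = cell_action X \<phi> f D x t"
  unfolding cell_elt_def by (rule lift_susp_map[OF equivariant_cell_action])

end

text \<open>The open interval contains the support with a margin and is shorter than 1, so a single
  chart holds everything that moves in a cell.\<close>

definition cell_PL :: "(real \<Rightarrow> real) \<Rightarrow> bool" where
  "cell_PL f \<longleftrightarrow> cell_homeo f \<and> dyadic_PL_homeo f {1/16<..<15/16} {1/16<..<15/16}"

lemma dyadic_fraction: "of_int p / 2 ^ k \<in> dyadic"
  unfolding dyadic_iff by blast

lemma dyadic_PL_id: "a \<in> dyadic \<Longrightarrow> b \<in> dyadic \<Longrightarrow> a < b \<Longrightarrow> dyadic_PL_homeo (\<lambda>t. t) {a<..<b} {a<..<b}"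
  using dyadic_PL_translate[of a b "of_int 0"] dyadic_of_int[of 0] by simp

lemma sixteenths_dyadic: "1/16 \<in> dyadic" "15/16 \<in> dyadic" "1/8 \<in> dyadic" "- (1/8) \<in> dyadic"
    "7/8 \<in> dyadic" "9/8 \<in> dyadic"
  using dyadic_fraction[of 1 4] dyadic_fraction[of 15 4] dyadic_fraction[of 1 3]
    dyadic_fraction[of "-1" 3] dyadic_fraction[of 7 3] dyadic_fraction[of 9 3] by simp_all

lemma cell_PL_o:
  assumes "cell_PL f" "cell_PL g" shows "cell_PL (f \<circ> g)"
  using assms cell_homeo_o dyadic_PL_compose unfolding cell_PL_def comp_def by blast

lemma cell_PL_inv:
  assumes "cell_PL f" shows "cell_PL (inv_into UNIV f)"
proof -
  have c: "cell_homeo f" and pl: "dyadic_PL_homeo f {1/16<..<15/16} {1/16<..<15/16}"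
    using assms by (auto simp: cell_PL_def)
  then obtain g where g: "homeomorphism {1/16<..<15/16} {1/16<..<15/16} f g"
    by (auto simp: dyadic_PL_homeo_def)
  have inj: "inj f" using c by (auto simp: cell_homeo_def intro: strict_mono_imp_inj_on)
  have "inv_into UNIV f t = g t" if "t \<in> {1/16<..<15/16}" for t
    using g that inj by (intro inv_f_eq) (auto simp: homeomorphism_def)
  then have "homeomorphism {1/16<..<15/16} {1/16<..<15/16} f (inv_into UNIV f)"
    by (intro homeomorphism_cong[OF g]) auto
  then show ?thesis using dyadic_PL_inv[OF pl] cell_homeo_inv[OF c] by (simp add: cell_PL_def)
qed

context free_stone_system
begin

text \<open>Three kinds of charts suffice: around either end of the cell the map is the identity,
  and in the middle it is \<open>f\<close> over \<open>D\<close> and the identity over the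
  complement.\<close>

lemma cell_elt_in_T:
  assumes f: "cell_PL f" and D: "openin X D" "closedin X D"
  shows "cell_elt f D \<in> carrier TG"
  unfolding cell_elt_def
proof (rule susp_map_in_T)
  have c: "cell_homeo f" and pl: "dyadic_PL_homeo f {1/16<..<15/16} {1/16<..<15/16}"
    using f by (auto simp: cell_PL_def)
  show "susp_map X \<phi> (cell_action X \<phi> f D) \<in> H0 X \<phi>" by (rule susp_map_cell_action_H0[OF c D])
  fix x and t :: real assume x: "x \<in> topspace X"
  let ?g = "susp_map X \<phi> (cell_action X \<phi> f D)"
  note T = T_local_susp_map[OF equivariant_cell_action[of f D]]
  define w u where "w = zpow X \<phi> \<lfloor>t\<rfloor> x" and "u = t - of_int \<lfloor>t\<rfloor>"
  have w: "w \<in> topspace X" unfolding w_def by (rule zpow_in[OF stone x])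
  have u: "0 \<le> u" "u < 1" unfolding u_def by linarith+
  have fl: "\<lfloor>s\<rfloor> = 0" if "s \<in> {1/16<..<15/16}" for s :: real using that by (simp add: floor_eq_iff)
  consider "u < 1/8" | "7/8 < u" | "1/8 \<le> u" "u \<le> 7/8" by linarith
  then have "T_local X \<phi> ?g (cls (w, u))"
  proof cases
    case 1
    show ?thesis
      by (rule T[OF openin_topspace closedin_topspace w, of "- (1/8)" "1/8" _ "\<lambda>t. t" "- (1/8)" "1/8"])
        (use 1 u cell_action_near_integer[OF c, of 0] sixteenths_dyadic in \<open>auto intro: dyadic_PL_id\<close>)
  next
    case 2
    show ?thesis
      by (rule T[OF openin_topspace closedin_topspace w, of "7/8" "9/8" _ "\<lambda>t. t" "7/8" "9/8"])
        (use 2 u cell_action_near_integer[OF c, of 1] sixteenths_dyadic in \<open>auto intro: dyadic_PL_id\<close>)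
  next
    case 3
    show ?thesis
    proof (cases "w \<in> D")
      case True
      show ?thesis
        by (rule T[OF D True, of "1/16" "15/16" _ f "1/16" "15/16"])
          (use 3 u sixteenths_dyadic pl fl in \<open>auto simp: cell_action_def per_def zpow_0[OF stone]\<close>)
    next
      case False
      then have F: "w \<in> topspace X - D" using w by blast
      show ?thesis
        by (rule T[OF clopen_neg[OF D] F, of "1/16" "15/16" _ "\<lambda>t. t" "1/16" "15/16"])
          (use 3 u sixteenths_dyadic fl in \<open>auto simp: cell_action_def per_def zpow_0[OF stone] intro: dyadic_PL_id\<close>)
    qed
  qed
  then show "T_local X \<phi> ?g (cls (x, t))" unfolding w_def u_def cls_zpow[OF x] .
qed

end

section \<open>Rigidity on an interval\<close>

text \<open>The standard generator of Thompson's group \<open>F\<close>, with slopes \<open>1/2, 1, 2\<close> on the unit interval.\<close>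

definition thompson_map :: "real \<Rightarrow> real" where
  "thompson_map t = min t (max (t / 2) (max (t - 1/4) (2 * t - 1)))"

text \<open>The copy of \<open>thompson_map\<close> on the interval of length
  \<open>1 / 2 ^ k\<close> starting at \<open>c\<close>. Together with the copy on the right half of
  that interval it generates a copy of \<open>F\<close>.\<close>

definition \<theta> :: "real \<Rightarrow> nat \<Rightarrow> real \<Rightarrow> real" where
  "\<theta> c k t = c + thompson_map ((t - c) * 2 ^ k) / 2 ^ k"

lemma thompson_map_simps:
  "t \<le> 0 \<Longrightarrow> thompson_map t = t" "0 \<le> t \<Longrightarrow> t \<le> 1/2 \<Longrightarrow> thompson_map t = t / 2"
  "1/2 \<le> t \<Longrightarrow> t \<le> 3/4 \<Longrightarrow> thompson_map t = t - 1/4" "3/4 \<le> t \<Longrightarrow> t \<le> 1 \<Longrightarrow> thompson_map t = 2 * t - 1"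
  "1 \<le> t \<Longrightarrow> thompson_map t = t"
  by (auto simp: thompson_map_def min_def max_def)

lemma strict_mono_thompson_map: "strict_mono thompson_map"
  by (rule strict_monoI) (auto simp: thompson_map_def min_def max_def)

lemma continuous_thompson_map: "continuous_on UNIV thompson_map"
  unfolding thompson_map_def by (intro continuous_intros) auto

lemma thompson_map_less: "0 < t \<Longrightarrow> t < 1 \<Longrightarrow> thompson_map t < t"
  by (auto simp: thompson_map_def min_def max_def)

lemma \<theta>_affine: "\<theta> c k (c + t / 2 ^ k) = c + thompson_map t / 2 ^ k"
  by (simp add: \<theta>_def)

lemma strict_mono_\<theta>: "strict_mono (\<theta> c k)"
proof (rule strict_monoI)
  fix t u :: real assume "t < u"
  then have "(t - c) * 2 ^ k < (u - c) * 2 ^ k" by simp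
  then have "thompson_map ((t - c) * 2 ^ k) < thompson_map ((u - c) * 2 ^ k)" by (rule strict_monoD[OF strict_mono_thompson_map])
  then show "\<theta> c k t < \<theta> c k u" by (simp add: \<theta>_def divide_strict_right_mono)
qed

lemma continuous_\<theta>: "continuous_on UNIV (\<theta> c k)"
  unfolding \<theta>_def by (intro continuous_intros continuous_on_compose2[OF continuous_thompson_map]) auto

lemma \<theta>_outside: "t \<le> c \<or> c + 1 / 2 ^ k \<le> t \<Longrightarrow> \<theta> c k t = t"
proof -
  assume "t \<le> c \<or> c + 1 / 2 ^ k \<le> t"
  then have "(t - c) * 2 ^ k \<le> 0 \<or> 1 \<le> (t - c) * 2 ^ k"
    by (auto simp: field_simps mult_le_0_iff)
  then show ?thesis using thompson_map_simps(1,5) by (auto simp: \<theta>_def)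
qed

lemma \<theta>_less:
  assumes "c < t" "t < c + 1 / 2 ^ k" shows "c < \<theta> c k t" "\<theta> c k t < t"
proof -
  have *: "0 < (t - c) * 2 ^ k" "(t - c) * 2 ^ k < 1" using assms by (auto simp: field_simps)
  then have "thompson_map ((t - c) * 2 ^ k) / 2 ^ k < ((t - c) * 2 ^ k) / 2 ^ k"
    using thompson_map_less by (intro divide_strict_right_mono) auto
  then show "\<theta> c k t < t" by (simp add: \<theta>_def)
  show "c < \<theta> c k t" using strict_monoD[OF strict_mono_\<theta> assms(1), of c k] \<theta>_outside[of c c k] by simp
qed

lemma \<theta>_interval: "\<theta> c k t \<in> {c..c + 1 / 2 ^ k} \<longleftrightarrow> t \<in> {c..c + 1 / 2 ^ k}"
  using strict_mono_less_eq[OF strict_mono_\<theta>, of c k c t] strict_mono_less_eq[OF strict_mono_\<theta>, of c k t "c + 1 / 2 ^ k"]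
    \<theta>_outside[of c c k] \<theta>_outside[of "c + 1 / 2 ^ k" c k] by simp

lemma \<theta>_commute:
  assumes "c + 1 / 2 ^ k \<le> c'"
  shows "\<theta> c k (\<theta> c' k' t) = \<theta> c' k' (\<theta> c k t)"
proof (cases "t \<le> c'")
  case True
  then have "\<theta> c k t \<le> c'"
    using \<theta>_less(2)[of c t k] \<theta>_outside[of t c k] by (cases "c < t \<and> t < c + 1 / 2 ^ k") auto
  then show ?thesis using True by (simp add: \<theta>_outside)
next
  case False
  then have "c' \<le> \<theta> c' k' t"
    using \<theta>_less(1)[of c' t k'] \<theta>_outside[of t c' k'] by (cases "t < c' + 1 / 2 ^ k'") auto
  then show ?thesis using False assms by (simp add: \<theta>_outside)
qed

text \<open>Since \<open>f\<close> is increasing and fixes 1/16 and 15/16, it restricts to a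
  homeomorphism of the interval between them; only the affine pieces remain to be checked.\<close>

lemma cell_PL_I:
  assumes c: "cell_homeo f" and P: "finite P" "P \<subseteq> dyadic" "dyadic_PL_on f {1/16<..<15/16} P"
  shows "cell_PL f"
proof -
  have m: "strict_mono f" "continuous_on UNIV f" and f: "f (1/16) = 1/16" "f (15/16) = 15/16"
    using c by (auto simp: cell_homeo_def)
  let ?J = "{1/16<..<15/16::real}" and ?g = "inv_into UNIV f"
  have s: "surj f" by (rule cell_homeo_surj[OF c])
  have inj: "inj f" using m(1) by (rule strict_mono_imp_inj_on)
  have J: "f t \<in> ?J \<longleftrightarrow> t \<in> ?J" for t
    using strict_mono_less[OF m(1), of "1/16" t] strict_mono_less[OF m(1), of t "15/16"] f by auto
  have "continuous_on UNIV ?g" using cell_homeo_inv[OF c] by (simp add: cell_homeo_def)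
  then have c: "continuous_on ?J f" "continuous_on ?J ?g"
    using continuous_on_subset m(2) subset_UNIV by blast+
  have "?g t \<in> ?J \<longleftrightarrow> t \<in> ?J" for t using J[of "?g t"] surj_f_inv_f[OF s] by simp
  then have "f ` ?J \<subseteq> ?J" "?g ` ?J \<subseteq> ?J" using J by blast+
  then have "homeomorphism ?J ?J f ?g"
    using c s inj by (intro homeomorphismI) (simp_all add: surj_f_inv_f)
  moreover have "dyadic_open_interval ?J"
    unfolding dyadic_open_interval_def using sixteenths_dyadic by (intro bexI[of _ "1/16"] bexI[of _ "15/16"]) auto
  ultimately show ?thesis unfolding cell_PL_def dyadic_PL_homeo_alt using assms by blast
qed

lemma interval_side:
  assumes "is_interval I" "p \<notin> I" shows "(\<forall>t\<in>I. t < p) \<or> (\<forall>t\<in>I. (p::real) < t)"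
  using assms unfolding is_interval_1 by (meson not_le_imp_less order_less_le)

lemma cell_PL_\<theta>:
  assumes "c \<in> dyadic" "1/8 \<le> c" "c + 1 / 2 ^ k \<le> 7/8"
  shows "cell_PL (\<theta> c k)"
proof (rule cell_PL_I)
  show "cell_homeo (\<theta> c k)"
    unfolding cell_homeo_def using strict_mono_\<theta> continuous_\<theta> \<theta>_outside assms(2,3) by auto
  let ?l = "1 / 2 ^ k :: real"
  \<comment> \<open>The rescaled breakpoints 0, 1/2, 3/4 and 1 of
    \<open>thompson_map\<close>.\<close>
  let ?P = "{c, c + ?l * (1/2), c + ?l * (3/4), c + ?l}"
  have l: "?l \<in> dyadic" using dyadic_fraction[of 1 k] by simp
  have h: "1/2 \<in> dyadic" "3/4 \<in> dyadic" "1/4 \<in> dyadic"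
    using dyadic_fraction[of 1 1] dyadic_fraction[of 3 2] dyadic_fraction[of 1 2] by simp_all
  show "?P \<subseteq> dyadic" using assms(1) l h by (auto intro!: dyadic_add dyadic_mult simp del: times_divide_eq_right times_divide_eq_left)
  show "dyadic_PL_on (\<theta> c k) {1/16<..<15/16} ?P"
    unfolding dyadic_PL_on_def
  proof (intro allI impI, elim conjE)
    fix I :: "real set" assume I: "is_interval I" "I \<subseteq> {1/16<..<15/16} - ?P"
    have n: "c \<notin> I" "c + ?l * (1/2) \<notin> I" "c + ?l * (3/4) \<notin> I" "c + ?l \<notin> I" using I(2) by auto
    note side = interval_side[OF I(1) n(1)] interval_side[OF I(1) n(2)] interval_side[OF I(1) n(3)]
      interval_side[OF I(1) n(4)]
    have l0: "0 < ?l" by simp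
    consider "\<forall>t\<in>I. t < c" | "\<forall>t\<in>I. c < t \<and> t < c + ?l * (1/2)"
      | "\<forall>t\<in>I. c + ?l * (1/2) < t \<and> t < c + ?l * (3/4)" | "\<forall>t\<in>I. c + ?l * (3/4) < t \<and> t < c + ?l"
      | "\<forall>t\<in>I. c + ?l < t"
      using side by blast
    then show "\<exists>m :: int. \<exists>b\<in>dyadic. \<forall>t\<in>I. \<theta> c k t = 2 powi m * t + b"
    proof cases
      case 1
      then show ?thesis by (intro exI[of _ 0] bexI[of _ 0]) (auto simp: \<theta>_outside intro: dyadic_of_int[of 0, simplified])
    next
      case 2
      have "\<theta> c k t = 2 powi (-1) * t + 1/2 * c" if "t \<in> I" for t
      proof -
        have "0 \<le> (t - c) * 2 ^ k" "(t - c) * 2 ^ k \<le> 1/2" using 2 that by (auto simp: field_simps)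
        then show ?thesis by (simp add: \<theta>_def thompson_map_simps power_int_minus field_simps)
      qed
      moreover have "1/2 * c \<in> dyadic" using h assms(1) by (intro dyadic_mult)
      ultimately show ?thesis by blast
    next
      case 3
      have "\<theta> c k t = 2 powi 0 * t + - (1/4 * ?l)" if "t \<in> I" for t
      proof -
        have "1/2 \<le> (t - c) * 2 ^ k" "(t - c) * 2 ^ k \<le> 3/4" using 3 that by (auto simp: field_simps)
        then show ?thesis by (simp add: \<theta>_def thompson_map_simps field_simps)
      qed
      moreover have "- (1/4 * ?l) \<in> dyadic" using h l by (intro dyadic_mult dyadic_minus)
      ultimately show ?thesis by blast
    next
      case 4
      have "\<theta> c k t = 2 powi 1 * t + - (c + ?l)" if "t \<in> I" for t
      proof -
        have "3/4 \<le> (t - c) * 2 ^ k" "(t - c) * 2 ^ k \<le> 1" using 4 that by (auto simp: field_simps)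
        then show ?thesis by (simp add: \<theta>_def thompson_map_simps field_simps)
      qed
      moreover have "- (c + ?l) \<in> dyadic" using assms(1) l by (intro dyadic_add dyadic_minus)
      ultimately show ?thesis by blast
    next
      case 5
      then show ?thesis by (intro exI[of _ 0] bexI[of _ 0]) (auto simp: \<theta>_outside intro: dyadic_of_int[of 0, simplified])
    qed
  qed
qed simp

section \<open>Density of dyadic orbits and its consequences for commuting maps\<close>

lemma not_Ints_between:
  fixes x :: real
  assumes "of_int n < x" "x < of_int n + 1" shows "x \<notin> \<int>"
proof
  assume "x \<in> \<int>"
  then obtain m where m: "x = of_int m" by (elim Ints_cases)
  then have "n < m" "of_int m < (of_int (n + 1) :: real)" using assms by auto
  then show False unfolding of_int_less_iff by linarith
qed

text \<open>Thompson's group is transitive on the dyadic points of the open unit interval. By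
  induction on the exponent of the denominator: every point other than 1/2 is joined by the two
  generators and their inverses to a point with denominator \<open>2 ^ n\<close> instead of
  \<open>2 ^ Suc n\<close>.\<close>

lemma dyadic_orbit_unit:
  assumes half: "1/2 \<in> E" and x0: "\<And>t. thompson_map t \<in> E \<longleftrightarrow> t \<in> E" and x1: "\<And>t. \<theta> (1/2) 1 t \<in> E \<longleftrightarrow> t \<in> E"
    and "t * 2 ^ n \<in> \<int>" "0 < t" "t < 1"
  shows "t \<in> E"
  using assms(4-6)
proof (induction n arbitrary: t)
  case 0
  then show ?case using not_Ints_between[of 0 t] by simp
next
  case (Suc n)
  have i: "(2 * t) * 2 ^ n \<in> \<int>" using Suc.prems(1) by (simp add: mult.assoc mult.left_commute)
  have high: "s \<in> E" if "3/4 \<le> s" "s < 1" "(2 * s) * 2 ^ n \<in> \<int>" for s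
  proof -
    have "(2 * s - 1) * 2 ^ n \<in> \<int>" using Ints_diff[OF that(3), of "2 ^ n"] by (simp add: algebra_simps)
    then have "2 * s - 1 \<in> E" using that by (intro Suc.IH) auto
    then show ?thesis using x0[of s] that by (simp add: thompson_map_simps)
  qed
  have mid: "s \<in> E" if "1/2 < s" "s < 3/4" "(2 * s) * 2 ^ n \<in> \<int>" for s
  proof -
    \<comment> \<open>A point strictly between 1/2 and 3/4 forces \<open>n\<close> to be at least 2,
      so that 1/2 and 3/4 are themselves multiples of \<open>1 / 2 ^ n\<close> and may be
      subtracted.\<close>
    have "2 * s \<notin> \<int>" "2 * s * 2 \<notin> \<int>"
      using that not_Ints_between[of 1 "2 * s"] not_Ints_between[of 2 "2 * s * 2"] by auto
    then have "n \<noteq> 0 \<and> n \<noteq> 1" using that(3) by (metis mult.right_neutral power_0 power_one_right)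
    then have "n = (n - 2) + 2" by linarith
    then obtain j where j: "n = j + 2" by blast
    show ?thesis
    proof (cases "s \<le> 5/8")
      case True
      have "(1/2) * 2 ^ n \<in> (\<int> :: real set)" using Ints_of_int[of "2 ^ (j + 1)"] by (simp add: j)
      then have "(2 * s - 1/2) * 2 ^ n \<in> \<int>" using Ints_diff[OF that(3)] by (simp add: algebra_simps)
      then have "2 * s - 1/2 \<in> E" using that True by (intro Suc.IH) auto
      moreover have "\<theta> (1/2) 1 (2 * s - 1/2) = s"
        using that True by (simp add: \<theta>_def thompson_map_simps) (simp add: field_simps)
      ultimately show ?thesis using x1[of "2 * s - 1/2"] by simp
    next
      case False
      have "(3/4) * 2 ^ n \<in> (\<int> :: real set)" using Ints_of_int[of "3 * 2 ^ j"] by (simp add: j)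
      then have "(2 * s - 3/4) * 2 ^ n \<in> \<int>" using Ints_diff[OF that(3)] by (simp add: algebra_simps)
      then have "2 * s - 3/4 \<in> E" using that False by (intro Suc.IH) auto
      moreover have "thompson_map (s + 1/8) = 2 * s - 3/4" using that False by (simp add: thompson_map_simps)
      moreover have "\<theta> (1/2) 1 (s + 1/8) = s"
        using that False by (simp add: \<theta>_def thompson_map_simps) (simp add: field_simps)
      ultimately show ?thesis using x0[of "s + 1/8"] x1[of "s + 1/8"] by simp
    qed
  qed
  consider "t \<le> 1/4" | "1/4 < t" "t < 1/2" | "t = 1/2" | "1/2 < t" "t < 3/4" | "3/4 \<le> t" by linarith
  then show ?case
  proof cases
    case 1
    then have "2 * t \<in> E" using i Suc.prems by (intro Suc.IH) auto
    then show ?thesis using x0[of "2 * t"] 1 Suc.prems by (simp add: thompson_map_simps)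
  next
    case 2
    have "2 * t \<notin> \<int>" using 2 not_Ints_between[of 0 "2 * t"] by auto
    then have "n \<noteq> 0" using i by (metis mult.right_neutral power_0)
    then obtain j where j: "n = j + 1" using not0_implies_Suc by auto
    have "(1/2) * 2 ^ n \<in> (\<int> :: real set)" using Ints_of_int[of "2 ^ j"] by (simp add: j)
    then have "(2 * (t + 1/4)) * 2 ^ n \<in> \<int>" using Ints_add[OF i] by (simp add: algebra_simps)
    then have "t + 1/4 \<in> E" using mid[of "t + 1/4"] 2 by simp
    then show ?thesis using x0[of "t + 1/4"] 2 by (simp add: thompson_map_simps)
  next
    case 3
    then show ?thesis using half by metis
  qed (use mid high i Suc.prems in auto)
qed

lemma dyadic_orbit:
  assumes half: "c + 1 / 2 ^ Suc k \<in> E"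
    and x0: "\<And>t. \<theta> c k t \<in> E \<longleftrightarrow> t \<in> E" and x1: "\<And>t. \<theta> (c + 1 / 2 ^ Suc k) (Suc k) t \<in> E \<longleftrightarrow> t \<in> E"
    and d: "d \<in> dyadic" "0 < d" "d < 1"
  shows "c + d / 2 ^ k \<in> E"
proof -
  obtain p :: int and n where "d = of_int p / 2 ^ n" using d(1) unfolding dyadic_iff by blast
  then have dn: "d * 2 ^ n \<in> \<int>" by simp
  have "d \<in> {t. c + t / 2 ^ k \<in> E}"
  proof (rule dyadic_orbit_unit[OF _ _ _ dn d(2,3)])
    show "1/2 \<in> {t. c + t / 2 ^ k \<in> E}" using half by simp
    show "thompson_map t \<in> {t. c + t / 2 ^ k \<in> E} \<longleftrightarrow> t \<in> {t. c + t / 2 ^ k \<in> E}" for t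
      using x0[of "c + t / 2 ^ k"] by (simp add: \<theta>_affine)
    have e: "\<theta> (c + 1 / 2 ^ Suc k) (Suc k) (c + t / 2 ^ k) = c + \<theta> (1/2) 1 t / 2 ^ k" for t
    proof -
      have "(c + t / 2 ^ k - (c + 1 / 2 ^ Suc k)) * 2 ^ Suc k = (t - 1/2) * 2 ^ 1" by (simp add: field_simps)
      then show ?thesis unfolding \<theta>_def by (simp add: add_divide_distrib)
    qed
    show "\<theta> (1/2) 1 t \<in> {t. c + t / 2 ^ k \<in> E} \<longleftrightarrow> t \<in> {t. c + t / 2 ^ k \<in> E}" for t
      using x1[of "c + t / 2 ^ k"] unfolding e by simp
  qed
  then show ?thesis by simp
qed

text \<open>If \<open>b\<close> moved \<open>t\<close>, one of the given fixed points would lie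
  strictly between \<open>t\<close> and \<open>b t\<close>, against monotonicity.\<close>

lemma strict_mono_fix_dense:
  assumes m: "strict_mono (b :: real \<Rightarrow> real)" and e: "b c = c" "b (c + 1 / 2 ^ k) = c + 1 / 2 ^ k"
    and fixd: "\<And>d. d \<in> dyadic \<Longrightarrow> 0 < d \<Longrightarrow> d < 1 \<Longrightarrow> b (c + d / 2 ^ k) = c + d / 2 ^ k"
    and t: "t \<in> {c..c + 1 / 2 ^ k}"
  shows "b t = t"
proof (rule ccontr)
  assume ne: "b t \<noteq> t"
  then have "t \<noteq> c" "t \<noteq> c + 1 / 2 ^ k" using e by metis+
  then have t': "c < t" "t < c + 1 / 2 ^ k" using t unfolding atLeastAtMost_iff by linarith+
  have bt: "c < b t" "b t < c + 1 / 2 ^ k"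
    using strict_monoD[OF m t'(1)] strict_monoD[OF m t'(2)] e by auto
  define u v where "u = min t (b t)" and "v = max t (b t)"
  have uv: "u < v" "c < u" "v < c + 1 / 2 ^ k" using ne t' bt by (auto simp: u_def v_def)
  then have "(u - c) * 2 ^ k < (v - c) * 2 ^ k" by simp
  then obtain d where d: "d \<in> dyadic" "(u - c) * 2 ^ k < d" "d < (v - c) * 2 ^ k"
    using dyadic_dense by blast
  have "0 \<le> (u - c) * 2 ^ k" "(v - c) * 2 ^ k \<le> 1" using uv by (auto simp: field_simps)
  then have "0 < d" "d < 1" using d by auto
  then have bd: "b (c + d / 2 ^ k) = c + d / 2 ^ k" using fixd d(1) by blast
  define x where "x = c + d / 2 ^ k"
  have x: "u < x" "x < v" unfolding x_def using d by (simp_all add: field_simps)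
  have bx: "b x = x" using bd by (simp add: x_def)
  show False
  proof (cases "t < b t")
    case True
    then have "t < x" "x < b t" using x by (simp_all add: u_def v_def)
    then show False using strict_monoD[OF m, of t x] bx by simp
  next
    case False
    then have "x < t" "b t < x" using x by (simp_all add: u_def v_def)
    then show False using strict_monoD[OF m, of x t] bx by simp
  qed
qed

text \<open>The fixed points of \<open>a\<close> are invariant under the copy of \<open>F\<close> on
  the interval and include the midpoint, whose orbit is dense.\<close>

lemma centralizer_trivial:
  assumes m: "strict_mono a" and e: "a c = c" "a (c + 1 / 2 ^ k) = c + 1 / 2 ^ k"
      "a (c + 1 / 2 ^ Suc k) = c + 1 / 2 ^ Suc k"
    and com: "\<And>t. t \<in> {c..c + 1 / 2 ^ k} \<Longrightarrow> a (\<theta> c k t) = \<theta> c k (a t)"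
      "\<And>t. t \<in> {c..c + 1 / 2 ^ k} \<Longrightarrow>
        a (\<theta> (c + 1 / 2 ^ Suc k) (Suc k) t) = \<theta> (c + 1 / 2 ^ Suc k) (Suc k) (a t)"
    and t: "t \<in> {c..c + 1 / 2 ^ k}"
  shows "a t = t"
proof (rule strict_mono_fix_dense[OF m e(1,2) _ t])
  fix d :: real assume d: "d \<in> dyadic" "0 < d" "d < 1"
  let ?I = "{c..c + 1 / 2 ^ k}"
  \<comment> \<open>The implication makes invariance true for every real \<open>t\<close>, also
    outside the interval, as \<open>dyadic_orbit\<close> demands.\<close>
  define E where "E = {t. t \<in> ?I \<longrightarrow> a t = t}"
  note i = strict_mono_\<theta>[THEN strict_mono_imp_inj_on, THEN inj_eq]
  have I1: "\<theta> (c + 1 / 2 ^ Suc k) (Suc k) t \<in> ?I \<longleftrightarrow> t \<in> ?I" for t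
  proof -
    have "\<theta> (c + 1 / 2 ^ Suc k) (Suc k) c = c" "\<theta> (c + 1 / 2 ^ Suc k) (Suc k) (c + 1 / 2 ^ k) = c + 1 / 2 ^ k"
      by (rule \<theta>_outside; simp add: field_simps)+
    then show ?thesis
      using strict_mono_less_eq[OF strict_mono_\<theta>, of "c + 1 / 2 ^ Suc k" "Suc k" c t]
        strict_mono_less_eq[OF strict_mono_\<theta>, of "c + 1 / 2 ^ Suc k" "Suc k" t "c + 1 / 2 ^ k"] by simp
  qed
  have "c + d / 2 ^ k \<in> E"
  proof (rule dyadic_orbit[OF _ _ _ d])
    show "c + 1 / 2 ^ Suc k \<in> E" using e(3) by (simp add: E_def)
    show "\<theta> c k t \<in> E \<longleftrightarrow> t \<in> E" for t
      using com(1)[of t] i[of c k "a t" t] \<theta>_interval[of c k t] unfolding E_def mem_Collect_eq by metis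
    show "\<theta> (c + 1 / 2 ^ Suc k) (Suc k) t \<in> E \<longleftrightarrow> t \<in> E" for t
      using com(2)[of t] i[of "c + 1 / 2 ^ Suc k" "Suc k" "a t" t] I1[of t]
      unfolding E_def mem_Collect_eq by metis
  qed
  moreover have "c + d / 2 ^ k \<in> ?I" using d by (auto simp: field_simps)
  ultimately show "a (c + d / 2 ^ k) = c + d / 2 ^ k" by (simp add: E_def)
qed


text \<open>The infimum \<open>e\<close> of the points moved by \<open>a1\<close> is preserved by
  every map that commutes with \<open>a1\<close>, so \<open>b0\<close> and \<open>b1\<close> fix it.
  Their common fixed points form a closed set, invariant under both generators; pushing left with
  the second generator shows that it contains the midpoint \<open>h\<close>, and the orbit of
  \<open>h\<close> is dense.\<close>

lemma one_side_trivial: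
  fixes a0 a1 b0 b1 :: "real \<Rightarrow> real" and c :: real and k :: nat
  defines "q \<equiv> c + 1 / 2 ^ k" and "h \<equiv> c + 1 / 2 ^ Suc k"
  assumes m: "strict_mono a0" "strict_mono a1" "strict_mono b0" "strict_mono b1"
    and s: "surj b0" "surj b1"
    and ends: "a1 q = q" "b0 c = c" "b0 q = q" "b1 c = c" "b1 q = q"
    and com: "\<And>t. a0 (b0 t) = b0 (a0 t)" "\<And>t. a0 (b1 t) = b1 (a0 t)"
      "\<And>t. a1 (b0 t) = b0 (a1 t)" "\<And>t. a1 (b1 t) = b1 (a1 t)"
    and prod: "\<And>t. t \<in> {c..q} \<Longrightarrow> a0 (b0 t) = \<theta> c k t" "\<And>t. t \<in> {c..q} \<Longrightarrow> a1 (b1 t) = \<theta> h (Suc k) t"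
    and left: "\<And>t. t \<in> {c..h} \<Longrightarrow> a1 t = t"
    and nontriv: "t0 \<in> {c..q}" "a1 t0 \<noteq> t0"
    and t: "t \<in> {c..q}"
  shows "b0 t = t \<and> b1 t = t"
proof -
  have ch: "c < h" "h < q" "q = h + 1 / 2 ^ Suc k" unfolding h_def q_def by (simp_all add: field_simps)
  define N where "N = {t \<in> {c..q}. a1 t \<noteq> t}"
  define e where "e = Inf N"
  have Ne: "N \<noteq> {}" "bdd_below N" using nontriv by (auto simp: N_def intro: bdd_belowI[of _ c])
  have Nh: "h \<le> n" "n < q" if "n \<in> N" for n
    using that left[of n] ends(1) ch unfolding N_def by (fastforce, cases "n = q", auto)
  have e: "h \<le> e" "e < q"
  proof -
    show "h \<le> e" unfolding e_def using Ne Nh by (intro cInf_greatest) auto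
    have "e \<le> t0" unfolding e_def using nontriv Ne by (intro cInf_lower) (auto simp: N_def)
    then show "e < q" using Nh(2)[of t0] nontriv by (auto simp: N_def)
  qed
  have fix_e: "b e = e" if b: "strict_mono b" "surj b" "b c = c" "b q = q" and ab: "\<And>t. a1 (b t) = b (a1 t)" for b
  proof -
    have inj: "b t = b u \<longleftrightarrow> t = u" for t u using strict_mono_eq[OF b(1)] .
    have I: "b t \<in> {c..q} \<longleftrightarrow> t \<in> {c..q}" for t
      using strict_mono_less_eq[OF b(1), of c t] strict_mono_less_eq[OF b(1), of t q] b(3,4) by simp
    have bN: "b n \<in> N \<longleftrightarrow> n \<in> N" for n using I[of n] ab[of n] inj[of "a1 n" n] by (auto simp: N_def)
    have "b e \<le> e" unfolding e_def
    proof (rule cInf_greatest[OF Ne(1)])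
      fix n assume n: "n \<in> N"
      obtain n' where n': "n = b n'" using b(2) by (metis surjD)
      then have "n' \<in> N" using n bN by simp
      then have "e \<le> n'" unfolding e_def using Ne(2) by (rule cInf_lower)
      then show "b (Inf N) \<le> n" using strict_mono_less_eq[OF b(1), of e n'] n' by (simp add: e_def)
    qed
    moreover have "e \<le> b e"
    proof -
      obtain e' where e': "e = b e'" using b(2) by (metis surjD)
      have "e' \<le> n" if "n \<in> N" for n
      proof -
        have "e \<le> b n" unfolding e_def using bN that Ne(2) by (intro cInf_lower) auto
        then show ?thesis using strict_mono_less_eq[OF b(1), of e' n] e' by simp
      qed
      then have "e' \<le> e" unfolding e_def using Ne(1) by (intro cInf_greatest) auto
      then show ?thesis using strict_mono_less_eq[OF b(1), of e' e] e' by simp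
    qed
    ultimately show ?thesis by simp
  qed
  have be: "b0 e = e" "b1 e = e" using fix_e m s ends com by blast+
  define E where "E = {t. b0 t = t \<and> b1 t = t}"
  have inj0: "a0 t = a0 u \<longleftrightarrow> t = u" and inj1: "a1 t = a1 u \<longleftrightarrow> t = u"
    and injb0: "b0 t = b0 u \<longleftrightarrow> t = u" and injb1: "b1 t = b1 u \<longleftrightarrow> t = u" for t u
    using strict_mono_eq m by blast+
  \<comment> \<open>The generator is \<open>a0\<close> after \<open>b0\<close>. As \<open>a0\<close>
    is injective and commutes with \<open>b0\<close> and \<open>b1\<close>, it drops out of the
    fixed point equations.\<close>
  have E0: "\<theta> c k t \<in> E \<longleftrightarrow> t \<in> E" if "t \<in> {c..q}" for t
  proof -
    have p: "\<theta> c k t = a0 (b0 t)" using prod(1)[OF that] by simp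
    have "b0 (a0 (b0 t)) = a0 (b0 (b0 t))" "b1 (a0 (b0 t)) = a0 (b1 (b0 t))" using com by simp_all
    then have "\<theta> c k t \<in> E \<longleftrightarrow> b0 (b0 t) = b0 t \<and> b1 (b0 t) = b0 t" unfolding p E_def by (simp add: inj0)
    also have "\<dots> \<longleftrightarrow> t \<in> E" unfolding E_def using injb0[of "b0 t" t] by auto
    finally show ?thesis .
  qed
  have E1: "\<theta> h (Suc k) t \<in> E \<longleftrightarrow> t \<in> E" if "t \<in> {c..q}" for t
  proof -
    have p: "\<theta> h (Suc k) t = a1 (b1 t)" using prod(2)[OF that] by simp
    have "b0 (a1 (b1 t)) = a1 (b0 (b1 t))" "b1 (a1 (b1 t)) = a1 (b1 (b1 t))" using com by simp_all
    then have "\<theta> h (Suc k) t \<in> E \<longleftrightarrow> b0 (b1 t) = b1 t \<and> b1 (b1 t) = b1 t" unfolding p E_def by (simp add: inj1)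
    also have "\<dots> \<longleftrightarrow> t \<in> E" unfolding E_def using injb1[of "b1 t" t] by auto
    finally show ?thesis .
  qed
  have "closed E"
  proof -
    have "closed {t. b0 t = t}" "closed {t. b1 t = t}"
      using strict_mono_surj_continuous m s by (auto intro!: closed_Collect_eq continuous_intros)
    moreover have "E = {t. b0 t = t} \<inter> {t. b1 t = t}" by (auto simp: E_def)
    ultimately show ?thesis by auto
  qed
  \<comment> \<open>The least common fixed point between \<open>h\<close> and \<open>e\<close> is
    attained because the set is closed. If it were larger than \<open>h\<close>, the second
    generator would produce a smaller one.\<close>
  define l where "l = Inf (E \<inter> {h..e})"
  have eQ: "e \<in> E \<inter> {h..e}" using be e by (auto simp: E_def)
  have bQ: "bdd_below (E \<inter> {h..e})" by (rule bdd_belowI[of _ h]) auto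
  have lQ: "l \<in> E \<inter> {h..e}" unfolding l_def
    using eQ bQ \<open>closed E\<close> by (intro closed_contains_Inf) auto
  have "l = h"
  proof (rule ccontr)
    assume "l \<noteq> h"
    then have l: "h < l" "l < q" "l \<le> e" using lQ e by auto
    have lt: "h < \<theta> h (Suc k) l" "\<theta> h (Suc k) l < l" using \<theta>_less[of h l "Suc k"] l ch(3) by auto
    have "l \<in> {c..q}" using l ch by auto
    then have "\<theta> h (Suc k) l \<in> E \<inter> {h..e}" using E1[of l] lQ lt l by auto
    then have "l \<le> \<theta> h (Suc k) l" unfolding l_def using bQ by (intro cInf_lower)
    then show False using lt by simp
  qed
  then have hE: "h \<in> E" using lQ by simp
  define E' where "E' = {t. t \<in> {c..q} \<longrightarrow> t \<in> E}"
  have I1: "\<theta> h (Suc k) t \<in> {c..q} \<longleftrightarrow> t \<in> {c..q}" for t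
  proof -
    have "\<theta> h (Suc k) c = c" "\<theta> h (Suc k) q = q" using ch by (auto intro!: \<theta>_outside)
    then show ?thesis
      using strict_mono_less_eq[OF strict_mono_\<theta>, of h "Suc k" c t]
        strict_mono_less_eq[OF strict_mono_\<theta>, of h "Suc k" t q] by simp
  qed
  have orbit: "c + d / 2 ^ k \<in> E" if d: "d \<in> dyadic" "0 < d" "d < 1" for d
  proof -
    have "c + d / 2 ^ k \<in> E'"
    proof (rule dyadic_orbit[of c k E' d, folded h_def])
      show "h \<in> E'" using hE by (simp add: E'_def)
      show "\<theta> c k t \<in> E' \<longleftrightarrow> t \<in> E'" for t
        using E0[of t] \<theta>_interval[of c k t, folded q_def] by (auto simp: E'_def)
      show "\<theta> h (Suc k) t \<in> E' \<longleftrightarrow> t \<in> E'" for t using E1[of t] I1[of t] by (auto simp: E'_def)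
    qed (rule d)+
    moreover have "c + d / 2 ^ k \<in> {c..q}" unfolding q_def using d by (auto simp: field_simps)
    ultimately show ?thesis by (simp add: E'_def)
  qed
  show ?thesis
    using strict_mono_fix_dense[OF m(3) ends(2,3)[unfolded q_def], of t]
      strict_mono_fix_dense[OF m(4) ends(4,5)[unfolded q_def], of t] orbit t
    unfolding E_def q_def by blast
qed

section \<open>Maps commuting with a periodic family of bumps\<close>

lemma per_unit: "t \<in> {0..<1} \<Longrightarrow> per f (t + of_int i) = f t + of_int i"
proof -
  assume "t \<in> {0..<1}"
  then have "\<lfloor>t\<rfloor> = 0" by (simp add: floor_eq_iff)
  then show ?thesis by (simp add: per_def)
qed

lemma per_\<theta>_fixed:
  assumes "0 \<le> c" "c + 1 / 2 ^ k < 1"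
  shows "per (\<theta> c k) t = t \<longleftrightarrow> (\<forall>i::int. t \<notin> {c + of_int i<..<c + 1 / 2 ^ k + of_int i})"
proof -
  let ?u = "t - of_int \<lfloor>t\<rfloor>"
  have u: "0 \<le> ?u" "?u < 1" by linarith+
  have "per (\<theta> c k) t = t \<longleftrightarrow> \<theta> c k ?u = ?u" by (auto simp: per_def)
  also have "\<dots> \<longleftrightarrow> ?u \<notin> {c<..<c + 1 / 2 ^ k}"
    using \<theta>_less(2)[of c ?u k] \<theta>_outside[of ?u c k] by (cases "c < ?u \<and> ?u < c + 1 / 2 ^ k") auto
  also have "\<dots> \<longleftrightarrow> (\<forall>i::int. t \<notin> {c + of_int i<..<c + 1 / 2 ^ k + of_int i})"
  proof
    assume L: "?u \<notin> {c<..<c + 1 / 2 ^ k}"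
    show "\<forall>i::int. t \<notin> {c + of_int i<..<c + 1 / 2 ^ k + of_int i}"
    proof
      fix i :: int
      show "t \<notin> {c + of_int i<..<c + 1 / 2 ^ k + of_int i}"
      proof
        assume t: "t \<in> {c + of_int i<..<c + 1 / 2 ^ k + of_int i}"
        then have "of_int i < t" "t < of_int i + 1" using assms unfolding greaterThanLessThan_iff by linarith+
        then have "\<lfloor>t\<rfloor> = i" by linarith
        then show False using L t by auto
      qed
    qed
  next
    assume "\<forall>i::int. t \<notin> {c + of_int i<..<c + 1 / 2 ^ k + of_int i}"
    from this[rule_format, of "\<lfloor>t\<rfloor>"] show "?u \<notin> {c<..<c + 1 / 2 ^ k}" by auto
  qed
  finally show ?thesis .
qed

text \<open>The fixed points of the periodic bump are mapped onto themselves by \<open>h\<close>, so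
  \<open>h\<close> carries components of the set of moved points onto components, respecting their
  ends.\<close>

lemma commuting_permutes:
  assumes c: "0 \<le> c" "c + 1 / 2 ^ k < 1" and h: "strict_mono h" "surj h"
    and com: "\<And>t. h (per (\<theta> c k) t) = per (\<theta> c k) (h t)"
  shows "\<exists>j::int. h (c + of_int i) = c + of_int j \<and> h (c + 1 / 2 ^ k + of_int i) = c + 1 / 2 ^ k + of_int j"
proof -
  let ?B = "per (\<theta> c k)" and ?l = "1 / 2 ^ k :: real"
  note fx = per_\<theta>_fixed[OF c]
  have l0: "0 < ?l" by simp
  have Bh: "?B (h t) = h t \<longleftrightarrow> ?B t = t" for t using com[of t] strict_mono_eq[OF h(1)] by metis
  have "c < 1" using c l0 by linarith
  then have ends: "?B (c + of_int i) = c + of_int i" "?B (c + ?l + of_int i) = c + ?l + of_int i" for i :: int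
    using \<theta>_outside[of c c k] \<theta>_outside[of "c + ?l" c k] per_unit[of c "\<theta> c k" i] per_unit[of "c + ?l" "\<theta> c k" i] c
    by auto
  define u v where "u = h (c + of_int i)" and "v = h (c + ?l + of_int i)"
  have uv: "u < v" unfolding u_def v_def using h(1) by (intro strict_monoD[OF h(1)]) simp
  have B: "?B u = u" "?B v = v" unfolding u_def v_def using Bh ends by blast+
  have moved: "?B t \<noteq> t" if "u < t" "t < v" for t
  proof -
    obtain t' where t': "t = h t'" using h(2) by (metis surjD)
    then have "c + of_int i < t'" "t' < c + ?l + of_int i"
      using that strict_mono_less[OF h(1)] by (auto simp: u_def v_def)
    then have "?B t' \<noteq> t'" unfolding fx by auto
    then show ?thesis using Bh t' by simp
  qed
  have "u < (u + v) / 2" "(u + v) / 2 < v" using uv by auto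
  then obtain j :: int where j: "(u + v) / 2 \<in> {c + of_int j<..<c + ?l + of_int j}"
    using moved fx by blast
  have "\<not> (u < c + of_int j \<and> c + of_int j < v)" "\<not> (u < c + ?l + of_int j \<and> c + ?l + of_int j < v)"
    using moved ends by blast+
  moreover have "u \<notin> {c + of_int j<..<c + ?l + of_int j}" "v \<notin> {c + of_int j<..<c + ?l + of_int j}"
    using B fx by blast+
  ultimately have "u = c + of_int j" "v = c + ?l + of_int j" using j uv by auto
  then show ?thesis unfolding u_def v_def by blast
qed

text \<open>The inverse of \<open>h\<close> also commutes with the bump, so every component occurs
  as an image.\<close>

lemma commuting_surj:
  assumes c: "0 \<le> c" "c + 1 / 2 ^ k < 1" and h: "strict_mono h" "surj h"
    and com: "\<And>t. h (per (\<theta> c k) t) = per (\<theta> c k) (h t)"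
  shows "\<exists>i::int. h (c + of_int i) = c + of_int j \<and> h (c + 1 / 2 ^ k + of_int i) = c + 1 / 2 ^ k + of_int j"
proof -
  let ?g = "inv_into UNIV h"
  have i: "inj h" using h(1) by (rule strict_mono_imp_inj_on)
  have "?g (per (\<theta> c k) t) = per (\<theta> c k) (?g t)" for t
    using com[of "?g t"] i surj_f_inv_f[OF h(2)] by (intro inv_f_eq) auto
  then obtain i :: int where "?g (c + of_int j) = c + of_int i" "?g (c + 1 / 2 ^ k + of_int j) = c + 1 / 2 ^ k + of_int i"
    using commuting_permutes[OF c strict_mono_inv_surj[OF h], of j] by blast
  then show ?thesis using surj_f_inv_f[OF h(2)] by metis
qed

text \<open>The commutator with the half translation has no integer drift, although \<open>a\<close> itself may have one.\<close>

lemma commutator_fixes_ends: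
  assumes c: "0 \<le> c" "c + 1/2 + 1 / 2 ^ k < 1" and a: "strict_mono a" "surj a"
    and com: "\<And>t. a (per (\<theta> c k) t) = per (\<theta> c k) (a t)"
      "\<And>t. a (per (\<theta> (c + 1/2) k) t) = per (\<theta> (c + 1/2) k) (a t)"
    and w: "\<And>t. w (a t + 1/2) = a (t + 1/2)"
  shows "w (c + of_int i) = c + of_int i \<and> w (c + 1 / 2 ^ k + of_int i) = c + 1 / 2 ^ k + of_int i"
proof -
  let ?l = "1 / 2 ^ k :: real"
  have l0: "0 < ?l" by simp
  have c1: "c + ?l < 1" and c2: "0 \<le> c + 1/2" using c by auto
  note per = commuting_permutes[OF c(1) c1 a com(1)]
  note sur = commuting_surj[OF c(1) c1 a com(1)]
  \<comment> \<open>Let \<open>m\<close> be the index of the half-translated bump that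
    \<open>a\<close> maps to number \<open>i - 1\<close>. The bumps \<open>m\<close> and
    \<open>m + 1\<close> of the other family lie on its two sides and have consecutive images, which
    must therefore be the numbers \<open>i - 1\<close> and \<open>i\<close>.\<close>
  obtain m :: int where m: "a (c + 1/2 + of_int m) = c + 1/2 + of_int (i - 1)"
      "a (c + 1/2 + ?l + of_int m) = c + 1/2 + ?l + of_int (i - 1)"
    using commuting_surj[OF c2 c(2) a com(2), of "i - 1"] by blast
  obtain j :: int where j: "a (c + of_int m) = c + of_int j" using per by blast
  obtain j1 :: int where j1: "a (c + of_int (m + 1)) = c + of_int j1" "a (c + ?l + of_int (m + 1)) = c + ?l + of_int j1"
    using per by blast
  obtain n :: int where n: "a (c + of_int n) = c + of_int (j + 1)" using sur by blast
  note less = strict_mono_less[OF a(1)] and le = strict_mono_less_eq[OF a(1)]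
  have "c + of_int m < c + of_int n" using less[of "c + of_int m" "c + of_int n"] j n by simp
  then have "c + of_int (m + 1) \<le> c + of_int n" by simp
  then have "j1 \<le> j + 1" using le[of "c + of_int (m + 1)" "c + of_int n"] j1 n by simp
  moreover have "c + of_int j < c + 1/2 + of_int (i - 1)" using less[of "c + of_int m" "c + 1/2 + of_int m"] j m by simp
  then have "j \<le> i - 1" by linarith
  moreover have "c + 1/2 + of_int (i - 1) < c + of_int j1"
    using less[of "c + 1/2 + of_int m" "c + of_int (m + 1)"] j1 m by simp
  then have "i \<le> j1" by linarith
  ultimately have ij: "j1 = i" by linarith
  show ?thesis using w[of "c + 1/2 + of_int m"] w[of "c + 1/2 + ?l + of_int m"] m j1 ij
    by (simp add: algebra_simps)
qed

section \<open>Relations between cell elements\<close>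

text \<open>The commutator of \<open>\<theta> c k\<close> with the translation by one half: near
  \<open>c\<close> it is \<theta>, and half a unit further right it is the inverse of the translate.
  Being a commutator, its image under an action can be controlled by
  \<open>commutator_fixes_ends\<close>.\<close>

definition half_comm :: "real \<Rightarrow> nat \<Rightarrow> real \<Rightarrow> real" where
  "half_comm c k = \<theta> c k \<circ> inv_into UNIV (\<theta> (c + 1/2) k)"

lemma inj_\<theta>: "inj (\<theta> c k)"
  using strict_mono_\<theta> by (rule strict_mono_imp_inj_on)

lemma inv_\<theta>: "inv_into UNIV (\<theta> c k) (\<theta> c k t) = t"
  by (rule inv_f_f[OF inj_\<theta>])

lemma \<theta>_shift: "\<theta> (c + d) k (t + d) = \<theta> c k t + d"
  by (simp add: \<theta>_def)

lemma half_comm_left: "t \<le> c + 1/2 \<Longrightarrow> half_comm c k t = \<theta> c k t"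
  using inv_\<theta>[of "c + 1/2" k t] by (simp add: half_comm_def \<theta>_outside)

lemma half_comm_right: "half_comm c k (\<theta> c k t + 1/2) = \<theta> c k (t + 1/2)"
  using inv_\<theta>[of "c + 1/2" k "t + 1/2"] by (simp add: half_comm_def \<theta>_shift)

lemma half_comm_commute:
  assumes "c' + 1 / 2 ^ k' \<le> c"
  shows "\<theta> c' k' (half_comm c k t) = half_comm c k (\<theta> c' k' t)"
proof -
  let ?f = "\<theta> (c + 1/2) k"
  have s: "surj ?f"
  proof -
    have "\<exists>t. ?f t = s" for s
    proof (cases "s \<le> c + 1/2 \<or> c + 1/2 + 1 / 2 ^ k \<le> s")
      case False
      have "\<exists>t\<ge>c + 1/2. t \<le> c + 1/2 + 1 / 2 ^ k \<and> ?f t = s"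
        using False continuous_on_subset[OF continuous_\<theta>] by (intro IVT') (auto simp: \<theta>_outside)
      then show ?thesis by blast
    qed (use \<theta>_outside in blast)
    then show ?thesis by (metis surjI)
  qed
  have "c' + 1 / 2 ^ k' \<le> c + 1/2" using assms by simp
  then have "\<theta> c' k' (?f u) = ?f (\<theta> c' k' u)" for u by (rule \<theta>_commute)
  then have "\<theta> c' k' (inv_into UNIV ?f t) = inv_into UNIV ?f (\<theta> c' k' t)"
    using surj_f_inv_f[OF s] inv_\<theta> by metis
  then show ?thesis using \<theta>_commute[OF assms] by (simp add: half_comm_def)
qed

lemma cell_PL_half_comm:
  assumes "c \<in> dyadic" "1/8 \<le> c" "c + 1 / 2 ^ k \<le> 3/8"
  shows "cell_PL (half_comm c k)"
proof -
  have "c + 1/2 \<in> dyadic" using assms(1) dyadic_fraction[of 1 1] by (intro dyadic_add) auto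
  then show ?thesis unfolding half_comm_def
    using assms by (intro cell_PL_o cell_PL_inv cell_PL_\<theta>) auto
qed

lemma cell_PL_homeo: "cell_PL f \<Longrightarrow> cell_homeo f"
  by (simp add: cell_PL_def)

context free_stone_system
begin

definition clopen :: "'x set \<Rightarrow> bool" where
  "clopen D \<longleftrightarrow> openin X D \<and> closedin X D"

lemma cell_elt_in: "cell_PL f \<Longrightarrow> clopen D \<Longrightarrow> cell_elt f D \<in> carrier TG"
  by (simp add: cell_elt_in_T clopen_def)

lemma T_mult_closed: "g \<in> carrier TG \<Longrightarrow> h \<in> carrier TG \<Longrightarrow> g \<otimes>\<^bsub>TG\<^esub> h \<in> carrier TG"
  using group.is_monoid[OF group_TG] by (rule monoid.m_closed)

text \<open>Over disjoint sets no cell is touched by both elements.\<close>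

lemma cell_elt_commute:
  assumes "cell_PL f" "cell_PL g" "clopen D" "clopen E"
    and "D \<inter> E = {} \<or> (\<forall>t. f (g t) = g (f t))"
  shows "cell_elt f D \<otimes>\<^bsub>TG\<^esub> cell_elt g E = cell_elt g E \<otimes>\<^bsub>TG\<^esub> cell_elt f D"
proof (rule lift_ext)
  fix x t assume x: "x \<in> topspace X"
  have "f \<circ> g = g \<circ> f" if "w \<in> D" "w \<in> E" for w using assms(5) that by auto
  then have "cell_action X \<phi> f D x (cell_action X \<phi> g E x t) = cell_action X \<phi> g E x (cell_action X \<phi> f D x t)"
    using assms(1,2)[THEN cell_PL_homeo] by (auto simp: cell_action_def floor_per per_o)
  then show "lift X \<phi> (cell_elt f D \<otimes>\<^bsub>TG\<^esub> cell_elt g E) x t = lift X \<phi> (cell_elt g E \<otimes>\<^bsub>TG\<^esub> cell_elt f D) x t"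
    using assms x by (simp add: lift_mult cell_elt_in lift_cell_elt)
qed (use assms T_mult_closed cell_elt_in in auto)

lemma cell_elt_union:
  assumes "cell_PL f" "clopen D" "clopen E" "clopen (D \<union> E)" "D \<inter> E = {}"
  shows "cell_elt f D \<otimes>\<^bsub>TG\<^esub> cell_elt f E = cell_elt f (D \<union> E)"
proof (rule lift_ext)
  fix x t assume x: "x \<in> topspace X"
  have "cell_action X \<phi> f D x (cell_action X \<phi> f E x t) = cell_action X \<phi> f (D \<union> E) x t"
    using assms(5) cell_PL_homeo[OF assms(1)] by (auto simp: cell_action_def floor_per)
  then show "lift X \<phi> (cell_elt f D \<otimes>\<^bsub>TG\<^esub> cell_elt f E) x t = lift X \<phi> (cell_elt f (D \<union> E)) x t"
    using assms x by (simp add: lift_mult cell_elt_in lift_cell_elt)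
qed (use assms T_mult_closed cell_elt_in in auto)

lemma cell_elt_empty:
  assumes "cell_PL f" shows "cell_elt f {} = \<one>\<^bsub>TG\<^esub>"
proof (rule lift_ext)
  show "\<one>\<^bsub>TG\<^esub> \<in> carrier TG" using group.is_monoid[OF group_TG] by (rule monoid.one_closed)
  show "cell_elt f {} \<in> carrier TG" using assms by (simp add: cell_elt_in clopen_def)
qed (simp add: lift_cell_elt lift_one cell_action_def)

text \<open>Conjugation by the time-one flow carries every cell to the next one, hence replaces
  \<open>D\<close> by its image under \<phi>.\<close>

lemma flow_cell_elt:
  assumes "cell_PL f" "clopen D"
  shows "flow 1 \<otimes>\<^bsub>TG\<^esub> cell_elt f D = cell_elt f {x \<in> topspace X. zpow X \<phi> (-1) x \<in> D} \<otimes>\<^bsub>TG\<^esub> flow 1"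
proof -
  let ?D = "{x \<in> topspace X. zpow X \<phi> (-1) x \<in> D}"
  have D: "clopen ?D" using assms(2) clopen_zpow[of D "-1"] by (simp add: clopen_def)
  have F: "flow 1 \<in> carrier TG" using flow_in_T[of "of_int 1"] dyadic_of_int[of 1] by simp
  note e = cell_elt_in[OF assms] cell_elt_in[OF assms(1) D]
  show ?thesis
  proof (rule lift_ext)
    fix x and t :: real assume x: "x \<in> topspace X"
    have "zpow X \<phi> (-1) (zpow X \<phi> (\<lfloor>t\<rfloor> + 1) x) = zpow X \<phi> \<lfloor>t\<rfloor> x" using zpow_add[OF stone x] by simp
    then have "cell_action X \<phi> f ?D x (t + 1) = cell_action X \<phi> f D x t + 1"
      using zpow_in[OF stone x] by (simp add: cell_action_def per_def)
    then show "lift X \<phi> (flow 1 \<otimes>\<^bsub>TG\<^esub> cell_elt f D) x t = lift X \<phi> (cell_elt f ?D \<otimes>\<^bsub>TG\<^esub> flow 1) x t"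
      using e F x by (simp add: lift_mult lift_cell_elt lift_flow)
  qed (use e F T_mult_closed in auto)
qed

text \<open>The bounds on \<open>c\<close> keep the bump and its half translate in one cell, so the
  commutator identity can be localised over a clopen set.\<close>

lemma half_comm_cell_elt:
  assumes "clopen D" "c \<in> dyadic" "1/8 \<le> c" "c + 1 / 2 ^ k \<le> 3/8"
  shows "cell_elt (half_comm c k) D \<otimes>\<^bsub>TG\<^esub> (flow (1/2) \<otimes>\<^bsub>TG\<^esub> cell_elt (\<theta> c k) D) = cell_elt (\<theta> c k) D \<otimes>\<^bsub>TG\<^esub> flow (1/2)"
proof -
  have F: "flow (1/2) \<in> carrier TG" using flow_in_T[of "1/2"] dyadic_fraction[of 1 1] by simp
  have PL: "cell_PL (\<theta> c k)" using assms by (intro cell_PL_\<theta>) auto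
  have h: "cell_homeo (\<theta> c k)" using PL by (rule cell_PL_homeo)
  note e = cell_elt_in[OF PL assms(1)] cell_elt_in[OF cell_PL_half_comm[OF assms(2-4)] assms(1)]
  show ?thesis
  proof (rule lift_ext)
    fix x and t :: real assume x: "x \<in> topspace X"
    define n u where "n = \<lfloor>t\<rfloor>" and "u = t - of_int n"
    have t: "t = u + of_int n" and u: "0 \<le> u" "u < 1" unfolding u_def n_def by (simp, linarith+)
    \<comment> \<open>In the left half of a cell, adding one half does not leave the cell. In the
      right half the bump is the identity, and adding one half leads to the left half of the next
      cell, where \<open>half_comm\<close> equals \<theta>.\<close>
    have "cell_action X \<phi> (half_comm c k) D x (cell_action X \<phi> (\<theta> c k) D x t + 1/2) = cell_action X \<phi> (\<theta> c k) D x (t + 1/2)"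
    proof (cases "u < 1/2")
      case True
      have b: "0 \<le> \<theta> c k u" "\<theta> c k u < 1/2"
        using strict_mono_less_eq[OF strict_mono_\<theta>, of c k 0 u] strict_mono_less[OF strict_mono_\<theta>, of c k u "1/2"]
          \<theta>_outside[of 0 c k] \<theta>_outside[of "1/2" c k] u True assms by auto
      have fl: "\<lfloor>t\<rfloor> = n" "\<lfloor>t + 1/2\<rfloor> = n" "\<lfloor>\<theta> c k u + of_int n + 1/2\<rfloor> = n"
        using t u True b by (auto simp: floor_eq_iff)
      show ?thesis
      proof (cases "zpow X \<phi> n x \<in> D")
        case True
        have "per (\<theta> c k) t = \<theta> c k u + of_int n" unfolding per_def fl by (simp add: u_def)
        then have "cell_action X \<phi> (half_comm c k) D x (cell_action X \<phi> (\<theta> c k) D x t + 1/2)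
            = per (half_comm c k) (\<theta> c k u + of_int n + 1/2)" using True fl by (simp add: cell_action_def)
        also have "\<dots> = half_comm c k (\<theta> c k u + 1/2) + of_int n"
          unfolding per_def fl by (simp add: algebra_simps)
        also have "\<dots> = \<theta> c k (u + 1/2) + of_int n" by (simp add: half_comm_right)
        also have "\<dots> = cell_action X \<phi> (\<theta> c k) D x (t + 1/2)"
          using True by (simp add: cell_action_def per_def fl) (simp add: t algebra_simps)
        finally show ?thesis .
      next
        case False
        then show ?thesis by (simp add: cell_action_def fl)
      qed
    next
      case False
      have xu: "\<theta> c k u = u" using False assms by (intro \<theta>_outside) auto
      have fl: "\<lfloor>t\<rfloor> = n" "\<lfloor>t + 1/2\<rfloor> = n + 1"
        using t u False by (auto simp: floor_eq_iff)
      have "per (\<theta> c k) t = t" unfolding per_def fl using xu by (simp add: u_def)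
      then have "cell_action X \<phi> (\<theta> c k) D x t = t" by (simp add: cell_action_def)
      moreover have "per (half_comm c k) (t + 1/2) = per (\<theta> c k) (t + 1/2)"
        unfolding per_def fl using half_comm_left[of "t + 1/2 - of_int (n + 1)" c k] t u assms by simp
      ultimately show ?thesis by (simp add: cell_action_def)
    qed
    then show "lift X \<phi> (cell_elt (half_comm c k) D \<otimes>\<^bsub>TG\<^esub> (flow (1/2) \<otimes>\<^bsub>TG\<^esub> cell_elt (\<theta> c k) D)) x t
        = lift X \<phi> (cell_elt (\<theta> c k) D \<otimes>\<^bsub>TG\<^esub> flow (1/2)) x t"
      using e F x T_mult_closed by (simp add: lift_mult lift_cell_elt lift_flow)
  qed (use e F T_mult_closed in auto)
qed

lemma clopen_Int: "clopen D \<Longrightarrow> clopen E \<Longrightarrow> clopen (D \<inter> E)"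
  by (auto simp: clopen_def)

lemma clopen_Diff: "clopen D \<Longrightarrow> clopen E \<Longrightarrow> clopen (D - E)"
  by (auto simp: clopen_def openin_diff closedin_diff)

lemma clopen_topspace: "clopen (topspace X)"
  by (simp add: clopen_def)

lemma clopen_subset: "clopen D \<Longrightarrow> D \<subseteq> topspace X"
  by (simp add: clopen_def openin_subset)

end

text \<open>By the pigeonhole principle two positions of \<open>x\<close> carry the same window of
  radius \<open>M\<close>. The block between them is repeated; the equal windows make also those
  windows of \<open>z\<close> that cross a seam occur in \<open>x\<close>.\<close>

lemma exists_periodic_pattern:
  fixes x :: "int \<Rightarrow> 'a"
  assumes "finite A" "\<And>k. x k \<in> A" "0 \<le> M"
  shows "\<exists>z p. 0 < p \<and> (\<forall>k. z (k + p) = z k) \<and> (\<forall>m. \<exists>n. \<forall>k. \<bar>k\<bar> \<le> M \<longrightarrow> z (k + m) = x (k + n))"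
proof -
  let ?f = "\<lambda>n::nat. map (\<lambda>k. x (int n + k)) [-M..M]"
  let ?L = "{xs. set xs \<subseteq> A \<and> length xs = length [-M..M]}"
  have "range ?f \<subseteq> ?L" using assms(2) by auto
  moreover have "finite ?L" using assms(1) by (rule finite_lists_length_eq)
  ultimately have "finite (range ?f)" by (rule finite_subset)
  then have "\<not> inj ?f" using finite_imageD infinite_UNIV_nat by blast
  then obtain i0 j0 where "?f i0 = ?f j0" "i0 \<noteq> j0" unfolding inj_def by blast
  then obtain i j where ij: "?f i = ?f j" "i < j" by (metis linorder_neqE_nat)
  define p where "p = int j - int i"
  have p: "0 < p" using ij by (simp add: p_def)
  have rep: "x (int i + k) = x (int i + k + p)" if "\<bar>k\<bar> \<le> M" for k
  proof -
    have "k \<in> set [-M..M]" using that by auto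
    then have "x (int i + k) = x (int j + k)" using ij(1) unfolding map_eq_conv by blast
    then show ?thesis by (simp add: p_def add.commute)
  qed
  \<comment> \<open>Offsets reaching up to \<open>M\<close> beyond the block may be reduced modulo
    \<open>p\<close>: subtract the period step by step, using \<open>rep\<close> each time. Negative
    offsets are treated likewise by \<open>down\<close>.\<close>
  have up: "x (int i + s mod p) = x (int i + s)" if "0 \<le> s" "s \<le> p + M" for s
    using that
  proof (induction "nat s" arbitrary: s rule: less_induct)
    case less
    show ?case
    proof (cases "s < p")
      case False
      then have "x (int i + (s - p) mod p) = x (int i + (s - p))" using less p assms(3) by (intro less.hyps) auto
      also have "\<dots> = x (int i + s)" using rep[of "s - p"] False less.prems by simp
      finally show ?thesis by (simp add: mod_diff_right_eq[symmetric])
    qed (use less in simp)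
  qed
  have down: "x (int i + s mod p) = x (int i + s)" if "s < 0" "- M \<le> s" for s
    using that
  proof (induction "nat (- s)" arbitrary: s rule: less_induct)
    case less
    have "x (int i + (s + p) mod p) = x (int i + (s + p))"
    proof (cases "s + p < 0")
      case True
      then show ?thesis using less p by (intro less.hyps) auto
    next
      case False
      then show ?thesis using up[of "s + p"] less.prems assms(3) by simp
    qed
    also have "\<dots> = x (int i + s)" using rep[of s] less.prems by (simp add: add.assoc)
    finally show ?case by simp
  qed
  define z where "z k = x (int i + k mod p)" for k
  have "z (k + m) = x (k + (int i + m mod p))" if "\<bar>k\<bar> \<le> M" for k m
  proof -
    have m: "0 \<le> m mod p" "m mod p < p" using p by simp_all
    have "(k + m) mod p = (k + m mod p) mod p" by (simp add: mod_add_right_eq)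
    then have "z (k + m) = x (int i + (k + m mod p) mod p)" by (simp add: z_def)
    also have "\<dots> = x (int i + (k + m mod p))"
      using up[of "k + m mod p"] down[of "k + m mod p"] that m by (cases "k + m mod p < 0") auto
    finally show ?thesis by (simp add: algebra_simps)
  qed
  then show ?thesis using p by (intro exI[of _ z] exI[of _ p]) (auto simp: z_def)
qed

text \<open>A periodic point has a finite orbit. It is closed, because the space is Hausdorff, and
  dense by minimality, so it would be all of \<open>X\<close>.\<close>

lemma infinite_minimal_free:
  assumes fin: "finite A" and sub: "subshift A X" and inf: "infinite X"
    and min: "minimal_system (subshift_top A X) shift" and x: "x \<in> X"
    and fp: "zpow (subshift_top A X) shift n x = x"
  shows "n = 0"
proof (rule ccontr)
  assume n: "n \<noteq> 0"
  let ?X = "subshift_top A X"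
  note zs = zpow_shift[OF fin sub x]
  note top = topspace_subshift_top[OF sub]
  note stone = subshift_stone_system[OF fin sub]
  have per: "x (k + n) = x k" for k using fp zs by metis
  have per2: "x (k + n * m) = x k" for k m
  proof (induction m rule: int_induct[where k = 0])
    case (step1 i)
    then show ?case using per[of "k + n * i"] by (simp add: algebra_simps)
  next
    case (step2 i)
    then show ?case using per[of "k + n * (i - 1)"] by (simp add: algebra_simps)
  qed simp
  have "zpow ?X shift m x = zpow ?X shift (m mod n) x" for m
  proof
    fix k
    have "k + m = k + m mod n + n * (m div n)" by simp
    then show "zpow ?X shift m x k = zpow ?X shift (m mod n) x k" unfolding zs using per2 by metis
  qed
  moreover have "m mod n \<in> {- \<bar>n\<bar>..\<bar>n\<bar>}" for m :: int
  proof (cases "0 < n")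
    case True
    then show ?thesis using pos_mod_bound[of n m] pos_mod_sign[of n m] unfolding atLeastAtMost_iff by linarith
  next
    case False
    then have "n < 0" using n by simp
    then show ?thesis using neg_mod_bound[of n m] neg_mod_sign[of n m] unfolding atLeastAtMost_iff by linarith
  qed
  ultimately have "range (\<lambda>m. zpow ?X shift m x) \<subseteq> (\<lambda>m. zpow ?X shift m x) ` {- \<bar>n\<bar>..\<bar>n\<bar>}"
    by blast
  then have fo: "finite (range (\<lambda>m. zpow ?X shift m x))" using finite_subset by blast
  have "range (\<lambda>m. zpow ?X shift m x) \<subseteq> topspace ?X" using zpow_in[OF stone] x top by auto
  then have "closedin ?X (range (\<lambda>m. zpow ?X shift m x))"
    using fo stone by (auto simp: stone_system_def intro: closedin_Hausdorff_finite)
  then have "range (\<lambda>m. zpow ?X shift m x) = topspace ?X"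
    using min x top closure_of_closedin unfolding minimal_system_def by metis
  then show False using fo inf top by simp
qed

section \<open>Reading off the sequence\<close>

context free_subshift
begin

text \<open>Only elements over sets determined by the letter at 0 can be put into the finite set
  \<open>Pr\<close>. The action of elements over other clopen sets is controlled by the relations
  that they satisfy in the group.\<close>

lemma finitely_presented_admissible:
  assumes fp: "finitely_presented TG"
  shows "\<exists>M\<ge>0. \<forall>z. admissible M z \<longrightarrow> z \<in> X"
proof -
  let ?w0 = "half_comm (1/4) 4" and ?w1 = "half_comm (9/32) 5"
  define Fs where "Fs = {?w0, ?w1, \<theta> (1/4) 5, \<theta> (17/64) 6, \<theta> (3/16) 4, \<theta> (11/16) 4, \<theta> (5/16) 4, \<theta> (13/16) 4}"
  \<comment> \<open>Everything is read off on \<open>[1/4, 5/16]\<close>, where \<open>?w0, ?w1\<close> generate a copy of \<open>F\<close>. The next two maps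
    generate a copy of \<open>F\<close> on its left half. The last four have supports adjacent to it or to its half
    translate; commuting with them pins its ends.\<close>
  define Bs where "Bs = insert A ((\<lambda>a. {a}) ` A)"
  define cyl where "cyl B = {x \<in> X. x 0 \<in> B}" for B
  define Pr where "Pr = (\<lambda>(f, B). cell_elt f (cyl B)) ` (Fs \<times> Bs) \<union> {flow (1/2), flow 1}"
  have dy: "1/4 \<in> dyadic" "9/32 \<in> dyadic" "17/64 \<in> dyadic" "3/16 \<in> dyadic" "11/16 \<in> dyadic"
    "5/16 \<in> dyadic" "13/16 \<in> dyadic" "1/2 \<in> dyadic" "1 \<in> dyadic"
    using dyadic_fraction[of 1 2] dyadic_fraction[of 9 5] dyadic_fraction[of 17 6] dyadic_fraction[of 3 4]
      dyadic_fraction[of 11 4] dyadic_fraction[of 5 4] dyadic_fraction[of 13 4] dyadic_fraction[of 1 1]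
      dyadic_fraction[of 1 0] by simp_all
  have PLw: "cell_PL ?w0" "cell_PL ?w1" using dy by (auto intro!: cell_PL_half_comm)
  have PLx: "cell_PL (\<theta> (1/4) 4)" "cell_PL (\<theta> (9/32) 5)" using dy by (auto intro!: cell_PL_\<theta>)
  have PLy: "cell_PL (\<theta> (1/4) 5)" "cell_PL (\<theta> (17/64) 6)" "cell_PL (\<theta> (3/16) 4)"
    "cell_PL (\<theta> (11/16) 4)" "cell_PL (\<theta> (5/16) 4)" "cell_PL (\<theta> (13/16) 4)"
    using dy by (auto intro!: cell_PL_\<theta>)
  have PL: "cell_PL f" if "f \<in> Fs" for f using that PLw PLy unfolding Fs_def by blast
  have cl_coord: "clopen {x \<in> X. x k \<in> B}" for k B using clopen_coordinate by (simp add: clopen_def)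
  have cl_cyl: "clopen (cyl B)" for B unfolding cyl_def by (rule cl_coord)
  have clX: "clopen X" using clopen_topspace by simp
  have flowT: "flow (1/2) \<in> carrier TG" "flow 1 \<in> carrier TG" using flow_in_T dy by auto
  have "finite Pr" unfolding Pr_def Fs_def Bs_def using finA by simp
  moreover have "Pr \<subseteq> carrier TG"
  proof
    fix g assume "g \<in> Pr"
    then consider f B where "g = cell_elt f (cyl B)" "f \<in> Fs" | "g = flow (1/2)" | "g = flow 1"
      unfolding Pr_def by fast
    then show "g \<in> carrier TG" using flowT cell_elt_in[OF PL cl_cyl] by cases auto
  qed
  ultimately obtain M where M: "M \<ge> 0"
    "\<forall>z. admissible M z \<longrightarrow> (\<exists>\<rho>\<in>hom TG incr_group. acts_along M z Pr \<rho>)"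
    using finitely_presented_actions[OF fp] by blast
  show ?thesis
  proof (rule exI[of _ M], intro conjI M(1) allI impI)
    fix z assume adm: "admissible M z"
    obtain \<rho> where \<rho>: "\<rho> \<in> hom TG incr_group" "acts_along M z Pr \<rho>"
      using M(2) adm by blast
    have "\<forall>m. \<exists>x. x \<in> X \<and> (\<forall>k. \<bar>k\<bar> \<le> M \<longrightarrow> x k = z (k + m))" using adm unfolding admissible_def by blast
    then obtain xx where xx: "\<forall>m. xx m \<in> X \<and> (\<forall>k. \<bar>k\<bar> \<le> M \<longrightarrow> xx m k = z (k + m))"
      unfolding choice_iff by blast
    have xx0: "xx m 0 = z m" for m using xx[rule_format, of m] M(1) by auto
    have zA: "z m \<in> A" for m using coordinate_in[of "xx m" 0] xx xx0 by simp
    have model: "\<rho> g t = lift \<X> shift g (xx \<lfloor>t\<rfloor>) (t - of_int \<lfloor>t\<rfloor>) + of_int \<lfloor>t\<rfloor>" if "g \<in> Pr" for g t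
    proof -
      have "t - of_int \<lfloor>t\<rfloor> \<in> {0..1}" unfolding atLeastAtMost_iff by linarith
      then have "\<rho> g (t - of_int \<lfloor>t\<rfloor> + of_int \<lfloor>t\<rfloor>) = lift \<X> shift g (xx \<lfloor>t\<rfloor>) (t - of_int \<lfloor>t\<rfloor>) + of_int \<lfloor>t\<rfloor>"
        using that xx by (intro \<rho>(2)[unfolded acts_along_def, rule_format]) auto
      then show ?thesis by simp
    qed
    have flow: "\<rho> (flow c) t = t + c" if "c = 1/2 \<or> c = 1" for c t
    proof -
      have "flow c \<in> Pr" using that unfolding Pr_def by blast
      then show ?thesis using model[of "flow c" t] lift_flow[of "xx \<lfloor>t\<rfloor>"] xx by simp
    qed
    have presc: "\<rho> (cell_elt f (cyl B)) t = (if z \<lfloor>t\<rfloor> \<in> B then per f t else t)" if "f \<in> Fs" "B \<in> Bs" for f B t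
    proof -
      let ?m = "\<lfloor>t\<rfloor>"
      have "cell_elt f (cyl B) \<in> Pr"
        unfolding Pr_def using that by (intro UnI1 image_eqI[of _ _ "(f, B)"]) simp_all
      moreover have "lift \<X> shift (cell_elt f (cyl B)) (xx ?m) (t - of_int ?m)
          = (if z ?m \<in> B then f (t - of_int ?m) else t - of_int ?m)"
        using xx xx0[of ?m] by (simp add: lift_cell_elt cell_action_def per_def zpow_0[OF stone] cyl_def)
      ultimately show ?thesis using model by (simp add: per_def)
    qed
    have full: "\<rho> (cell_elt f X) t = per f t" if "f \<in> Fs" for f t
    proof -
      have "cyl A = X" using coordinate_in by (auto simp: cyl_def)
      then show ?thesis using presc[OF that, of A t] zA by (simp add: Bs_def)
    qed
    have mult: "\<rho> (g \<otimes>\<^bsub>TG\<^esub> h) t = \<rho> g (\<rho> h t)" if "g \<in> carrier TG" "h \<in> carrier TG" for g h t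
      using hom_mult[OF \<rho>(1) that] by (simp add: incr_group_def)
    have incr: "strict_mono (\<rho> g)" "surj (\<rho> g)" if "g \<in> carrier TG" for g
      using hom_in_carrier[OF \<rho>(1) that] by (auto simp: incr_group_def)
    have commE: "\<rho> (cell_elt f D) (\<rho> (cell_elt g E) t) = \<rho> (cell_elt g E) (\<rho> (cell_elt f D) t)"
      if "cell_PL f" "cell_PL g" "clopen D" "clopen E" "D \<inter> E = {} \<or> (\<forall>t. f (g t) = g (f t))" for f g D E t
      using mult[OF cell_elt_in[OF that(1,3)] cell_elt_in[OF that(2,4)], of t] cell_elt_commute[OF that]
        mult[OF cell_elt_in[OF that(2,4)] cell_elt_in[OF that(1,3)], of t] by simp
    have com: "\<rho> (cell_elt g D) (per f t) = per f (\<rho> (cell_elt g D) t)"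
      if "f \<in> Fs" "cell_PL g" "clopen D" "\<And>t. f (g t) = g (f t)" for f g D t
      using commE[OF that(2) PL[OF that(1)] that(3) clX, of t] that(4) full[OF that(1)] by simp
    define W0 W1 where "W0 D = \<rho> (cell_elt ?w0 D)" and "W1 D = \<rho> (cell_elt ?w1 D)" for D
    have Win: "strict_mono (W0 D)" "strict_mono (W1 D)" "surj (W0 D)" "surj (W1 D)" if "clopen D" for D
      using incr cell_elt_in PLw that by (auto simp: W0_def W1_def)
    have Wcom: "W0 D (W0 E t) = W0 E (W0 D t)" "W0 D (W1 E t) = W1 E (W0 D t)"
      "W1 D (W0 E t) = W0 E (W1 D t)" "W1 D (W1 E t) = W1 E (W1 D t)" if "clopen D" "clopen E" "D \<inter> E = {}" for D E t
      unfolding W0_def W1_def by (rule commE; use that PLw in blast)+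
    have Wun: "W0 (D \<union> E) t = W0 D (W0 E t)" "W1 (D \<union> E) t = W1 D (W1 E t)"
      if "clopen D" "clopen E" "clopen (D \<union> E)" "D \<inter> E = {}" for D E t
    proof -
      have "\<rho> (cell_elt f (D \<union> E)) t = \<rho> (cell_elt f D) (\<rho> (cell_elt f E) t)" if f: "cell_PL f" for f
        using cell_elt_union[OF f \<open>clopen D\<close> \<open>clopen E\<close> \<open>clopen (D \<union> E)\<close> \<open>D \<inter> E = {}\<close>]
          mult[OF cell_elt_in[OF f \<open>clopen D\<close>] cell_elt_in[OF f \<open>clopen E\<close>], of t] by simp
      then show "W0 (D \<union> E) t = W0 D (W0 E t)" "W1 (D \<union> E) t = W1 D (W1 E t)"
        using PLw by (simp_all add: W0_def W1_def)
    qed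
    \<comment> \<open>On \<open>{1/4..5/16}\<close> the maps \<open>half_comm\<close> and \<theta>
      agree, and 9/32 is the midpoint; so over \<open>X\<close> the standard generators of
      \<open>F\<close> on this interval appear.\<close>
    have WX: "W0 X (t + of_int i) = \<theta> (1/4) 4 t + of_int i" "W1 X (t + of_int i) = \<theta> (9/32) 5 t + of_int i"
      if "t \<in> {1/4..5/16}" for t and i :: int
      using that per_unit[of t] half_comm_left[of t] by (auto simp: W0_def W1_def full Fs_def)
    \<comment> \<open>The image under \<rho> of \<open>half_comm_cell_elt\<close>; the half flow
      acts as the translation by one half.\<close>
    have rel: "W0 D (\<rho> (cell_elt (\<theta> (1/4) 4) D) t + 1/2) = \<rho> (cell_elt (\<theta> (1/4) 4) D) (t + 1/2)"
      "W1 D (\<rho> (cell_elt (\<theta> (9/32) 5) D) t + 1/2) = \<rho> (cell_elt (\<theta> (9/32) 5) D) (t + 1/2)" if D: "clopen D" for D t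
    proof -
      have "\<rho> (cell_elt (half_comm c k) D) (\<rho> (cell_elt (\<theta> c k) D) t + 1/2) = \<rho> (cell_elt (\<theta> c k) D) (t + 1/2)"
        if c: "cell_PL (half_comm c k)" "cell_PL (\<theta> c k)" "c \<in> dyadic" "1/8 \<le> c" "c + 1 / 2 ^ k \<le> 3/8" for c k
      proof -
        note w = cell_elt_in[OF c(1) D] and x = cell_elt_in[OF c(2) D]
        have "\<rho> (cell_elt (half_comm c k) D \<otimes>\<^bsub>TG\<^esub> (flow (1/2) \<otimes>\<^bsub>TG\<^esub> cell_elt (\<theta> c k) D)) t
            = \<rho> (cell_elt (\<theta> c k) D \<otimes>\<^bsub>TG\<^esub> flow (1/2)) t"
          by (simp only: half_comm_cell_elt[OF D c(3-5)])
        then show ?thesis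
          unfolding mult[OF w T_mult_closed[OF flowT(1) x]] mult[OF flowT(1) x] mult[OF x flowT(1)]
          using flow[of "1/2"] by simp
      qed
      from this[of "1/4" 4] this[of "9/32" 5]
      show "W0 D (\<rho> (cell_elt (\<theta> (1/4) 4) D) t + 1/2) = \<rho> (cell_elt (\<theta> (1/4) 4) D) (t + 1/2)"
        "W1 D (\<rho> (cell_elt (\<theta> (9/32) 5) D) t + 1/2) = \<rho> (cell_elt (\<theta> (9/32) 5) D) (t + 1/2)"
        using PLw PLx dy(1,2) by (simp_all add: W0_def W1_def)
    qed
    \<comment> \<open>The bump starting at 3/16 ends at 1/4, and the next one starts at 5/16. The
      bumps at 11/16 and 13/16 are their half translates, as \<open>commutator_fixes_ends\<close>
      requires.\<close>
    have ends_aux: "w (1/4 + of_int i) = 1/4 + of_int i \<and> w (5/16 + of_int i) = 5/16 + of_int i"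
      if g: "cell_PL g" "clopen D" and w: "\<And>t. w (\<rho> (cell_elt g D) t + 1/2) = \<rho> (cell_elt g D) (t + 1/2)"
        and c: "\<And>c t. c \<in> {3/16, 11/16, 5/16, 13/16} \<Longrightarrow> \<theta> c 4 (g t) = g (\<theta> c 4 t)"
      for g D w and i :: int
    proof -
      note a = incr[OF cell_elt_in[OF g]]
      have b: "\<rho> (cell_elt g D) (per (\<theta> c 4) t) = per (\<theta> c 4) (\<rho> (cell_elt g D) t)" if "c \<in> {3/16, 11/16, 5/16, 13/16}" for c t
      proof (rule com[OF _ g])
        show "\<theta> c 4 \<in> Fs" using that unfolding Fs_def by blast
      qed (rule c[OF that])
      have "w (3/16 + of_int i) = 3/16 + of_int i \<and> w (3/16 + 1 / 2 ^ 4 + of_int i) = 3/16 + 1 / 2 ^ 4 + of_int i"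
        by (rule commutator_fixes_ends[where a = "\<rho> (cell_elt g D)"])
          (use a w b[of "3/16"] b[of "11/16"] in simp_all)
      moreover have "w (5/16 + of_int i) = 5/16 + of_int i \<and> w (5/16 + 1 / 2 ^ 4 + of_int i) = 5/16 + 1 / 2 ^ 4 + of_int i"
        by (rule commutator_fixes_ends[where a = "\<rho> (cell_elt g D)"])
          (use a w b[of "5/16"] b[of "13/16"] in simp_all)
      ultimately show ?thesis by simp
    qed
    have ends0: "W0 D (1/4 + of_int i) = 1/4 + of_int i \<and> W0 D (5/16 + of_int i) = 5/16 + of_int i"
      if D: "clopen D" for D and i :: int
    proof (rule ends_aux[OF PLx(1) D rel(1)[OF D]])
      fix c t :: real assume "c \<in> {3/16, 11/16, 5/16, 13/16}"
      then show "\<theta> c 4 (\<theta> (1/4) 4 t) = \<theta> (1/4) 4 (\<theta> c 4 t)"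
        using \<theta>_commute[of c 4 "1/4" 4 t] \<theta>_commute[of "1/4" 4 c 4 t] by auto
    qed
    have ends1: "W1 D (1/4 + of_int i) = 1/4 + of_int i \<and> W1 D (5/16 + of_int i) = 5/16 + of_int i"
      if D: "clopen D" for D and i :: int
    proof (rule ends_aux[OF PLx(2) D rel(2)[OF D]])
      fix c t :: real assume "c \<in> {3/16, 11/16, 5/16, 13/16}"
      then show "\<theta> c 4 (\<theta> (9/32) 5 t) = \<theta> (9/32) 5 (\<theta> c 4 t)"
        using \<theta>_commute[of c 4 "9/32" 5 t] \<theta>_commute[of "9/32" 5 c 4 t] by auto
    qed
    \<comment> \<open>Both bumps end at 9/32, and \<open>half_comm (9/32) 5\<close> moves nothing to
      the left of 9/32.\<close>
    have comy: "W1 D (per (\<theta> c k) t) = per (\<theta> c k) (W1 D t)"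
      if "clopen D" "(c, k) = (1/4, 5) \<or> (c, k) = (17/64, 6)" for D c k t
      unfolding W1_def
    proof (rule com[OF _ PLw(2) that(1)])
      show "\<theta> c k \<in> Fs" using that(2) unfolding Fs_def by blast
      show "\<theta> c k (half_comm (9/32) 5 t) = half_comm (9/32) 5 (\<theta> c k t)" for t
        using that(2) by (intro half_comm_commute) auto
    qed
    \<comment> \<open>\<open>W1 D\<close> commutes with a copy of \<open>F\<close> on
      \<open>{1/4..9/32}\<close>. Commuting with the bump from 17/64 to 9/32 pins these two points,
      since they lie between ends that are already fixed; then \<open>centralizer_trivial\<close>
      applies.\<close>
    have left: "W1 D (t + of_int i) = t + of_int i" if D: "clopen D" and t: "t \<in> {1/4..9/32}" for D t and i :: int
    proof -
      define a where "a t = W1 D (t + of_int i) - of_int i" for t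
      have m: "strict_mono a" using Win(2)[OF D] by (auto simp: a_def strict_mono_def)
      obtain j :: int where j: "W1 D (17/64 + of_int i) = 17/64 + of_int j"
          "W1 D (17/64 + 1 / 2 ^ 6 + of_int i) = 17/64 + 1 / 2 ^ 6 + of_int j"
        using commuting_permutes[of "17/64" 6 "W1 D" i] Win[OF D] comy[OF D, of "17/64" 6] by auto
      have "W1 D (1/4 + of_int i) < W1 D (17/64 + of_int i)" "W1 D (17/64 + of_int i) < W1 D (5/16 + of_int i)"
        using Win(2)[OF D] by (auto simp: strict_mono_def)
      then have "j = i" using j(1) ends1[OF D, of i] by auto
      then have e: "a (1/4) = 1/4" "a (17/64) = 17/64" "a (9/32) = 9/32"
        using j ends1[OF D, of i] by (simp_all add: a_def)
      have I: "a t \<in> {0..<1}" if "t \<in> {1/4..9/32}" for t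
        using strict_mono_less_eq[OF m, of "1/4" t] strict_mono_less_eq[OF m, of t "9/32"] e that by auto
      have c: "a (\<theta> c k t) = \<theta> c k (a t)" if "t \<in> {1/4..9/32}" "(c, k) = (1/4, 5) \<or> (c, k) = (17/64, 6)" for c k t
      proof -
        have "a (\<theta> c k t) = W1 D (per (\<theta> c k) (t + of_int i)) - of_int i"
          unfolding a_def using per_unit[of t "\<theta> c k" i] that by simp
        also have "\<dots> = per (\<theta> c k) (W1 D (t + of_int i)) - of_int i" using comy[OF D that(2)] by simp
        also have "\<dots> = \<theta> c k (a t)" using per_unit[OF I[OF that(1)], of "\<theta> c k" i] by (simp add: a_def)
        finally show ?thesis .
      qed
      have "a t = t"
        using centralizer_trivial[of a "1/4" 5 t, OF m] e c[of _ "1/4" 5] c[of _ "17/64" 6] t by simp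
      then show ?thesis by (simp add: a_def)
    qed
    define triv where "triv i D \<longleftrightarrow> (\<forall>t\<in>{1/4..5/16}. W0 D (t + of_int i) = t + of_int i \<and> W1 D (t + of_int i) = t + of_int i)"
      for i :: int and D
    define std where "std i D \<longleftrightarrow> (\<forall>t\<in>{1/4..5/16}. W0 D (t + of_int i) = \<theta> (1/4) 4 t + of_int i \<and>
        W1 D (t + of_int i) = \<theta> (9/32) 5 t + of_int i)" for i :: int and D
    \<comment> \<open>The two generators do not commute at 19/64, which serves as the test point
      below.\<close>
    have ev: "\<theta> (9/32) 5 (19/64) = 37/128" "\<theta> (1/4) 4 (37/128) = 35/128"
      "\<theta> (1/4) 4 (19/64) = 9/32" "\<theta> (9/32) 5 (9/32) = 9/32"
      by (simp_all add: \<theta>_def thompson_map_def)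
    have side: "triv i E" if D: "clopen D" "clopen E" "D \<inter> E = {}" "D \<union> E = X"
        and t0: "t0 \<in> {1/4..5/16}" "W1 D (t0 + of_int i) \<noteq> t0 + of_int i" for D E t0 and i :: int
    proof -
      \<comment> \<open>Conjugation by an integer translation brings cell \<open>i\<close> to the
        origin, where \<open>one_side_trivial\<close> is stated.\<close>
      define sh where "sh f t = f (t + of_int i) - of_int i" for f :: "real \<Rightarrow> real" and t
      have m: "strict_mono (sh f)" "surj (sh f)" if f: "strict_mono f" "surj f" for f
      proof -
        show "strict_mono (sh f)" using f(1) by (auto simp: sh_def strict_mono_def)
        have "\<exists>t. sh f t = s" for s
        proof -
          obtain u where "f u = s + of_int i" using f(2) by (metis surjD)
          then have "sh f (u - of_int i) = s" by (simp add: sh_def)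
          then show ?thesis by blast
        qed
        then show "surj (sh f)" by (metis surjI)
      qed
      have un: "clopen (D \<union> E)" using D(4) clX by simp
      have h: "sh (W0 E) t = t \<and> sh (W1 E) t = t" if t: "t \<in> {1/4..5/16}" for t
      proof (rule one_side_trivial[of "sh (W0 D)" "sh (W1 D)" "sh (W0 E)" "sh (W1 E)" "1/4" 4 t0 t])
        show "strict_mono (sh (W0 D))" "strict_mono (sh (W1 D))" "strict_mono (sh (W0 E))" "strict_mono (sh (W1 E))"
          "surj (sh (W0 E))" "surj (sh (W1 E))"
          using m[OF Win(1,3)[OF D(1)]] m[OF Win(2,4)[OF D(1)]] m[OF Win(1,3)[OF D(2)]] m[OF Win(2,4)[OF D(2)]]
          by simp_all
        show "sh (W1 D) (1/4 + 1 / 2 ^ 4) = 1/4 + 1 / 2 ^ 4" "sh (W0 E) (1/4) = 1/4" "sh (W1 E) (1/4) = 1/4"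
          "sh (W0 E) (1/4 + 1 / 2 ^ 4) = 1/4 + 1 / 2 ^ 4" "sh (W1 E) (1/4 + 1 / 2 ^ 4) = 1/4 + 1 / 2 ^ 4"
          using ends0[OF D(2), of i] ends1[OF D(2), of i] ends1[OF D(1), of i] by (simp_all add: sh_def)
        show "sh (W0 D) (sh (W0 E) t) = sh (W0 E) (sh (W0 D) t)" "sh (W0 D) (sh (W1 E) t) = sh (W1 E) (sh (W0 D) t)"
          "sh (W1 D) (sh (W0 E) t) = sh (W0 E) (sh (W1 D) t)" "sh (W1 D) (sh (W1 E) t) = sh (W1 E) (sh (W1 D) t)" for t
          using Wcom[OF D(1-3)] by (simp_all add: sh_def)
        show "sh (W0 D) (sh (W0 E) t) = \<theta> (1/4) 4 t" if "t \<in> {1/4..1/4 + 1 / 2 ^ 4}" for t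
          using Wun(1)[OF D(1,2) un D(3), of "t + of_int i"] WX(1)[of t i] that D(4) by (simp add: sh_def)
        show "sh (W1 D) (sh (W1 E) t) = \<theta> (1/4 + 1 / 2 ^ Suc 4) (Suc 4) t" if "t \<in> {1/4..1/4 + 1 / 2 ^ 4}" for t
          using Wun(2)[OF D(1,2) un D(3), of "t + of_int i"] WX(2)[of t i] that D(4) by (simp add: sh_def)
        show "sh (W1 D) t = t" if "t \<in> {1/4..1/4 + 1 / 2 ^ Suc 4}" for t
          using left[OF D(1), of t i] that by (simp add: sh_def)
        show "t0 \<in> {1/4..1/4 + 1 / 2 ^ 4}" "sh (W1 D) t0 \<noteq> t0" using t0 by (simp_all add: sh_def)
        show "t \<in> {1/4..1/4 + 1 / 2 ^ 4}" using t by simp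
      qed
      show ?thesis unfolding triv_def using h unfolding sh_def by (simp add: diff_eq_eq)
    qed
    \<comment> \<open>Together the two factors move 19/64, so one of them does; then the other one
      is trivial by \<open>side\<close>.\<close>
    have dich: "triv i D \<or> triv i (X - D)" if D: "clopen D" for i D
    proof -
      have DX: "D \<subseteq> X" using clopen_subset[OF D] by simp
      have E: "clopen (X - D)" by (rule clopen_Diff[OF clX D])
      have u: "D \<union> (X - D) = X" "(X - D) \<union> D = X" "D \<inter> (X - D) = {}" "(X - D) \<inter> D = {}" using DX by auto
      have un: "clopen (D \<union> (X - D))" using u(1) clX by simp
      have "W1 D (W1 (X - D) (19/64 + of_int i)) = 37/128 + of_int i"
        using Wun(2)[OF D E un u(3), of "19/64 + of_int i"] WX(2)[of "19/64" i] u(1) ev(1) by simp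
      then have "W1 D (19/64 + of_int i) \<noteq> 19/64 + of_int i \<or> W1 (X - D) (19/64 + of_int i) \<noteq> 19/64 + of_int i"
        by auto
      then show ?thesis
        using side[OF D E u(3,1), of "19/64" i] side[OF E D u(4,2), of "19/64" i] by auto
    qed
    have compl: "std i E" if "clopen D" "clopen E" "clopen (E \<union> D)" "E \<inter> D = {}" "triv i D" "std i (E \<union> D)"
      for i D E
      using that(5,6) Wun[OF that(2,1,3,4)] unfolding std_def triv_def by metis
    have stdX: "std i X" for i unfolding std_def using WX by blast
    \<comment> \<open>Elements over disjoint sets commute, whereas the standard generators do not
      commute at 19/64.\<close>
    have disj: False if D: "clopen D" "clopen E" "D \<inter> E = {}" and s: "std i D" "std i E" for i D E
    proof -
      have "W0 D (W1 E (19/64 + of_int i)) = W1 E (W0 D (19/64 + of_int i))" by (rule Wcom(2)[OF D])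
      moreover have "W1 E (19/64 + of_int i) = 37/128 + of_int i" "W0 D (37/128 + of_int i) = 35/128 + of_int i"
        "W0 D (19/64 + of_int i) = 9/32 + of_int i" "W1 E (9/32 + of_int i) = 9/32 + of_int i"
        using s ev unfolding std_def by simp_all
      ultimately show False by simp
    qed
    \<comment> \<open>If the intersection acted trivially, \<open>D - E\<close> would act in the
      standard way although it is disjoint from \<open>E\<close>. Hence by \<open>dich\<close> the
      complement of the intersection acts trivially and the intersection takes over the action of
      \<open>X\<close>.\<close>
    have inter: "std i (D \<inter> E)" if D: "clopen D" "clopen E" and s: "std i D" "std i E" for i D E
    proof -
      let ?I = "D \<inter> E"
      have I: "clopen ?I" by (rule clopen_Int[OF D])
      have IX: "?I \<subseteq> X" using clopen_subset[OF I] by simp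
      have "\<not> triv i ?I"
      proof
        assume t: "triv i ?I"
        have e: "(D - E) \<union> ?I = D" "(D - E) \<inter> ?I = {}" "(D - E) \<inter> E = {}" by auto
        have "std i (D - E)" using compl[OF I clopen_Diff[OF D] _ e(2) t] e(1) D(1) s(1) by simp
        then show False using disj[OF clopen_Diff[OF D] D(2) e(3)] s(2) by blast
      qed
      then have t: "triv i (X - ?I)" using dich[OF I] by blast
      have e: "?I \<union> (X - ?I) = X" "?I \<inter> (X - ?I) = {}" using IX by auto
      show ?thesis using compl[OF clopen_Diff[OF clX I] I _ e(2) t] e(1) clX stdX by simp
    qed
    \<comment> \<open>The image under \<rho> of \<open>flow_cell_elt\<close>; the time-one flow acts
      as the translation by 1.\<close>
    have shift1: "std i D \<longleftrightarrow> std (i + 1) {x \<in> X. zpow \<X> shift (-1) x \<in> D}" if D: "clopen D" for i D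
    proof -
      let ?D = "{x \<in> X. zpow \<X> shift (-1) x \<in> D}"
      have D': "clopen ?D" using clopen_zpow[of D "-1"] D by (simp add: clopen_def)
      have "\<rho> (cell_elt f D) t + 1 = \<rho> (cell_elt f ?D) (t + 1)" if f: "cell_PL f" for f t
        using flow_cell_elt[OF f D] mult[OF flowT(2) cell_elt_in[OF f D], of t] mult[OF cell_elt_in[OF f D'] flowT(2), of t]
          flow[of 1] by simp
      then have "W0 D t + 1 = W0 ?D (t + 1)" "W1 D t + 1 = W1 ?D (t + 1)" for t
        using PLw by (simp_all add: W0_def W1_def)
      then have "W0 ?D (t + of_int (i + 1)) = W0 D (t + of_int i) + 1" "W1 ?D (t + of_int (i + 1)) = W1 D (t + of_int i) + 1" for t
        by (simp_all add: add.assoc)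
      then show ?thesis unfolding std_def by (simp add: add.assoc[symmetric])
    qed
    have step: "std i {x \<in> X. x (k + 1) \<in> {a}} \<longleftrightarrow> std (i + 1) {x \<in> X. x k \<in> {a}}" for i k a
    proof -
      have eq: "{x \<in> X. zpow \<X> shift (-1) x \<in> {x \<in> X. x (k + 1) \<in> {a}}} = {x \<in> X. x k \<in> {a}}"
        using zpow_shift[OF finA sub] zpow_in[OF stone, of _ "-1"] by auto
      have "std i {x \<in> X. x (k + 1) \<in> {a}} \<longleftrightarrow>
          std (i + 1) {x \<in> X. zpow \<X> shift (-1) x \<in> {x \<in> X. x (k + 1) \<in> {a}}}"
        by (rule shift1[OF cl_coord])
      then show ?thesis unfolding eq .
    qed
    \<comment> \<open>Here the letters of \<open>z\<close> enter: the elements over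
      \<open>cyl {z i}\<close> belong to \<open>Pr\<close>, and their prescribed action over cell
      \<open>i\<close> is the standard one.\<close>
    have base: "std i {x \<in> X. x 0 \<in> {z i}}" for i
    proof -
      have "W0 (cyl {z i}) (t + of_int i) = \<theta> (1/4) 4 t + of_int i \<and>
          W1 (cyl {z i}) (t + of_int i) = \<theta> (9/32) 5 t + of_int i" if t: "t \<in> {1/4..5/16}" for t
      proof -
        have "\<lfloor>t\<rfloor> = 0" using t by (simp add: floor_eq_iff)
        then show ?thesis
          using t per_unit[of t] half_comm_left[of t] presc[of ?w0 "{z i}"] presc[of ?w1 "{z i}"] zA
          by (simp add: W0_def W1_def Fs_def Bs_def)
      qed
      then show ?thesis unfolding std_def cyl_def by blast
    qed
    \<comment> \<open>By \<open>step\<close>, the letter at position \<open>k\<close> seen from cell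
      \<open>i\<close> is the letter at a position closer to 0 seen from a neighbouring cell; the
      induction runs in both directions.\<close>
    have coord: "\<forall>i. std i {x \<in> X. x k \<in> {z (i + k)}}" for k
    proof (induction k rule: int_induct[where k = 0])
      case base
      then show ?case using \<open>\<And>i. std i {x \<in> X. x 0 \<in> {z i}}\<close> by simp
    next
      case (step1 k)
      show ?case
      proof
        fix i
        show "std i {x \<in> X. x (k + 1) \<in> {z (i + (k + 1))}}"
          using step1(2)[rule_format, of "i + 1"] step[of i k "z (i + (k + 1))"] by (simp add: algebra_simps)
      qed
    next
      case (step2 k)
      show ?case
      proof
        fix i
        show "std i {x \<in> X. x (k - 1) \<in> {z (i + (k - 1))}}"
          using step2(2)[rule_format, of "i - 1"] step[of "i - 1" "k - 1" "z (i + (k - 1))"] by (simp add: algebra_simps)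
      qed
    qed
    define Cy where "Cy n = {x \<in> X. \<forall>k::int. \<bar>k\<bar> \<le> int n \<longrightarrow> x k = z k}" for n
    have Cy: "std 0 (Cy n) \<and> clopen (Cy n)" for n
    proof (induction n)
      case 0
      have "Cy 0 = {x \<in> X. x 0 \<in> {z 0}}" by (auto simp: Cy_def)
      then show ?case using base cl_coord[of 0 "{z 0}"] by simp
    next
      case (Suc n)
      let ?C = "\<lambda>k. {x \<in> X. x k \<in> {z (0 + k)}}"
      have k: "\<bar>k\<bar> \<le> int (Suc n) \<longleftrightarrow> \<bar>k\<bar> \<le> int n \<or> k = int (Suc n) \<or> k = - int (Suc n)" for k by linarith
      have "Cy (Suc n) = Cy n \<inter> ?C (int (Suc n)) \<inter> ?C (- int (Suc n))"
        unfolding Cy_def k by auto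
      moreover have "std 0 (Cy n \<inter> ?C (int (Suc n)) \<inter> ?C (- int (Suc n)))"
        using Suc coord cl_coord clopen_Int by (intro inter) blast+
      moreover have "clopen (Cy n \<inter> ?C (int (Suc n)) \<inter> ?C (- int (Suc n)))"
        using Suc cl_coord clopen_Int by blast
      ultimately show ?case by simp
    qed
    \<comment> \<open>Over the empty set the group element is the identity, while a standard action
      moves 19/64.\<close>
    have "Cy n \<noteq> {}" for n
    proof
      assume "Cy n = {}"
      then have "W1 {} (19/64 + of_int 0) = 37/128 + of_int 0" using Cy[of n] ev(1) unfolding std_def by simp
      moreover have "\<rho> \<one>\<^bsub>TG\<^esub> = \<one>\<^bsub>incr_group\<^esub>" by (rule hom_one[OF \<rho>(1) group_TG group_incr_group])
      ultimately show False by (simp add: W1_def cell_elt_empty[OF PLw(2)] incr_group_def)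
    qed
    then have near: "\<exists>x\<in>X. \<forall>k::int. \<bar>k\<bar> \<le> int n \<longrightarrow> x k = z k" for n unfolding Cy_def by blast
    show "z \<in> X"
    proof (rule ccontr)
      assume "z \<notin> X"
      \<comment> \<open>A sequence outside the closed set \<open>X\<close> would have a whole
        cylinder outside \<open>X\<close>, contradicting \<open>near\<close>.\<close>
      have cl: "closedin (full_shift A) X" using sub by (simp add: subshift_def)
      have "openin (full_shift A) (topspace (full_shift A) - X)" using cl by blast
      moreover have "z \<in> topspace (full_shift A) - X" using zA \<open>z \<notin> X\<close> by (simp add: topspace_full_shift)
      ultimately obtain N where N: "\<forall>y\<in>UNIV \<rightarrow> A. (\<forall>k::int. \<bar>k\<bar> \<le> N \<longrightarrow> y k = z k) \<longrightarrow> y \<in> topspace (full_shift A) - X"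
        using open_contains_cylinder_full_shift by blast
      obtain x where x: "x \<in> X" "\<forall>k::int. \<bar>k\<bar> \<le> int (nat N) \<longrightarrow> x k = z k" using near by blast
      have "x \<in> UNIV \<rightarrow> A" using coordinate_in[OF x(1)] by auto
      moreover have "x k = z k" if "\<bar>k\<bar> \<le> N" for k
      proof -
        have "\<bar>k\<bar> \<le> int (nat N)" using that by linarith
        then show ?thesis using x(2) by blast
      qed
      ultimately show False using N x(1) by blast
    qed
  qed
qed

end

theorem theorem7:
  fixes A :: "'a set" and X :: "(int \<Rightarrow> 'a) set"
  assumes "finite A"
    and "subshift A X"
    and "infinite X"
    and "minimal_system (subshift_top A X) shift"
  shows "\<not> finitely_presented (T_group (subshift_top A X) shift)"
proof
  assume fp: "finitely_presented (T_group (subshift_top A X) shift)"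
  interpret free_subshift A X
    using assms infinite_minimal_free[OF assms] by unfold_locales blast+
  obtain M where M: "0 \<le> M" "\<And>z. admissible M z \<Longrightarrow> z \<in> X"
    using finitely_presented_admissible[OF fp] by blast
  obtain x where x: "x \<in> X" using sub by (auto simp: subshift_def)
  have "\<exists>z p. 0 < p \<and> (\<forall>k. z (k + p) = z k) \<and> (\<forall>m. \<exists>n. \<forall>k. \<bar>k\<bar> \<le> M \<longrightarrow> z (k + m) = x (k + n))"
    by (rule exists_periodic_pattern[OF finA coordinate_in[OF x] M(1)])
  then obtain z p where z: "0 < p" "\<forall>k. z (k + p) = z k" "\<forall>m. \<exists>n. \<forall>k. \<bar>k\<bar> \<le> M \<longrightarrow> z (k + m) = x (k + n)"
    by (elim exE conjE) (rule that)
  \<comment> \<open>A window of \<open>z\<close> occurs in \<open>x\<close> at some position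
    \<open>n\<close>, hence at the origin in the \<open>n\<close>-th shift of
    \<open>x\<close>.\<close>
  have "admissible M z"
    unfolding admissible_def
  proof
    fix m
    obtain n where n: "\<forall>k. \<bar>k\<bar> \<le> M \<longrightarrow> z (k + m) = x (k + n)" using z(3) by blast
    have "zpow \<X> shift n x \<in> X" using zpow_in[OF stone, of x n] x by simp
    then show "\<exists>x\<in>X. \<forall>k. \<bar>k\<bar> \<le> M \<longrightarrow> x k = z (k + m)"
      using n zpow_shift[OF finA sub x, of n] by (intro bexI[of _ "zpow \<X> shift n x"]) auto
  qed
  then have "z \<in> X" by (rule M(2))
  then have "zpow \<X> shift p z = z" using zpow_shift[OF finA sub] z(2) by (simp add: fun_eq_iff)
  then have "p = 0" by (rule free_shift[OF \<open>z \<in> X\<close>])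
  then show False using z(1) by simp
qed

end
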